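(* Suppose that $E^*$ has the Radon–Nikodym property. Let $(f_k)$ be a sequence in $\mathcal L^1_E$ and $f_0\in\mathcal L^1_E$. Then $(f_k)$ converges limitedly to $f_0$ if and only if (1) $(f_k)$ converges weakly to $f_0$ in $\mathcal L^1_E$; and (2) for each $x^*\in E^*$, the sequence $(x^*(f_k))_k$ in $\mathcal L^1_{\mathbb R}$ satisfies the sequential Bocce criterion. Moreover, the equivalence remains valid if condition (1) is replaced by (1') $(f_k)$ converges to $f_0$ in the $\sigma(\mathcal L^1_E,\mathcal L^\infty_{E^*})$-topology.
   Context: $(E,\|\cdot\|)$ is a Banach space with dual $E^*$, and $(\Omega,\mathcal F,\mu)$ is a probability space. $\mathcal F^+$ is the collection of sets in $\mathcal F$ with strictly positive measure, and for $B\in\mathcal F$, $\mathcal F^+(B)$ is the collection of measurable subsets of $B$ with strictly positive measure. $\mathcal L^1_E$ is the (prequotient) space of Bochner $\mu$-integrable functions $f:\Omega\to E$, with seminorm $\|f\|_1=\int_\Omega\|f\|\,d\mu$. Weak convergence means convergence against every continuous linear functional on $(\mathcal L^1_E,\|\cdot\|_1)$. $\mathcal L^\infty_{E^*}$ is the space of strongly measurable bounded functions $b:\Omega\to E^*$; $\sigma(\mathcal L^1_E,\mathcal L^\infty_{E^*})$ is the topology on $\mathcal L^1_E$ induced by the functionals $f\mapsto\int_\Omega\langle f,b\rangle\,d\mu$, $b\in\mathcal L^\infty_{E^*}$. For a real function $h\in\mathcal L^1_{\mathbb R}$ and $A\in\mathcal F$, put $m_A(h):=\frac{1}{\mu(A)}\int_A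 h\,d\mu$ and $\text{Bocce-osc } h|_A:=\frac{1}{\mu(A)}\int_A|h-m_A(h)|\,d\mu$ (with $0/0=0$). A sequence $(h_k)$ in $\mathcal L^1_{\mathbb R}$ satisfies the sequential Bocce criterion if for each subsequence $(h_{k_j})$, each $\epsilon>0$ and each $B\in\mathcal F^+$ there is $A\in\mathcal F^+(B)$ such that $\liminf_j \text{Bocce-osc } h_{k_j}|_A<\epsilon$. Let $\mathcal G$ be the collection of all functions $g:\Omega\times E\to\mathbb R$ such that: (i) $g(\omega,0)=0$ for each $\omega\in\Omega$; (ii) $g(\omega,\cdot)$ is weakly, i.e. $\sigma(E,E^* )$-, continuous for each $\omega\in\Omega$; (iii) there exist $C>0$ and $\phi\in\mathcal L^1_{\mathbb R}$ with $|g(\omega,x)|\le C\|x\|+\phi(\omega)$ for all $\omega\in\Omega$, $x\in E$; (iv) $g(\cdot,f(\cdot))$ is $\mathcal F$-measurable for each $f\in\mathcal L^1_E$. A sequence $(f_k)$ in $\mathcal L^1_E$ converges limitedly to $f_0\in\mathcal L^1_E$ if $\lim_k\int_\Omega g(\omega,f_k(\omega)-f_0(\omega))\,d\mu(\omega)=0$ for each $g\in\mathcal G$. *)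

theory Defs
  imports "HOL-Probability.Probability"
begin

section \<open>Bochner integration with values in an arbitrary Banach space\<close>

text \<open>
  The library's \<^const>\<open>has_bochner_integral\<close> lives in second countable spaces, where strong
  measurability is Borel measurability. The Banach space here need not be separable, so strong
  measurability is an explicit condition. It is required at every point of the space (not only
  almost everywhere), so that strongly measurable functions are measurable without any completeness
  assumption on the measure.
\<close>

definition strongly_measurable :: "'w measure \<Rightarrow> ('w \<Rightarrow> 'e::real_normed_vector) \<Rightarrow> bool" where
  "strongly_measurable M f \<longleftrightarrow>
     (\<exists>s. (\<forall>n::nat. simple_function M (s n)) \<and> (\<forall>\<omega>\<in>space M. (\<lambda>n. s n \<omega>) \<longlonglongrightarrow> f \<omega>))"

definition has_strong_bochner_integral ::
    "'w measure \<Rightarrow> ('w \<Rightarrow> 'e::real_normed_vector) \<Rightarrow> 'e \<Rightarrow> bool" where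
  "has_strong_bochner_integral M f x \<longleftrightarrow>
     strongly_measurable M f \<and>
     (\<exists>s. (\<forall>n::nat. Bochner_Integration.simple_bochner_integrable M (s n)) \<and>
          (\<lambda>n. \<integral>\<^sup>+ \<omega>. ennreal (norm (f \<omega> - s n \<omega>)) \<partial>M) \<longlonglongrightarrow> 0 \<and>
          (\<lambda>n. Bochner_Integration.simple_bochner_integral M (s n)) \<longlonglongrightarrow> x)"

lemma has_strong_bochner_integral_iff_has_bochner_integral:
  fixes f :: "'w \<Rightarrow> 'e::{real_normed_vector, second_countable_topology}"
  shows "has_strong_bochner_integral M f x \<longleftrightarrow> has_bochner_integral M f x"
proof -
  have "strongly_measurable M f \<longleftrightarrow> f \<in> borel_measurable M"
  proof
    assume "strongly_measurable M f"
    then obtain s where s: "\<And>n::nat. simple_function M (s n)"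
      and lim: "\<And>\<omega>. \<omega> \<in> space M \<Longrightarrow> (\<lambda>n. s n \<omega>) \<longlonglongrightarrow> f \<omega>"
      unfolding strongly_measurable_def by blast
    have "s n \<in> borel_measurable M" for n
      using s by (rule borel_measurable_simple_function)
    then show "f \<in> borel_measurable M"
      using lim by (rule borel_measurable_LIMSEQ_metric)
  next
    assume "f \<in> borel_measurable M"
    from borel_measurable_implies_sequence_metric[OF this, of 0]
    show "strongly_measurable M f"
      unfolding strongly_measurable_def by blast
  qed
  then show ?thesis
    unfolding has_strong_bochner_integral_def has_bochner_integral.simps by auto
qed

definition bochner_L1 :: "'w measure \<Rightarrow> ('w \<Rightarrow> 'e::banach) set" where
  "bochner_L1 M = {f. \<exists>x. has_strong_bochner_integral M f x}"

definition bochner_Linf :: "'w measure \<Rightarrow> ('w \<Rightarrow> 'e::banach) set" where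
  "bochner_Linf M = {b. strongly_measurable M b \<and> (\<exists>C. \<forall>\<omega>\<in>space M. norm (b \<omega>) \<le> C)}"

section \<open>The Radon--Nikodym property\<close>

text \<open>The Radon--Nikodym property of a Banach space with respect to one measure space: every
  countably additive vector measure that is absolutely continuous and of bounded variation has a
  Bochner integrable density.\<close>

definition vector_measure :: "'w measure \<Rightarrow> ('w set \<Rightarrow> 'x::banach) \<Rightarrow> bool" where
  "vector_measure M G \<longleftrightarrow>
     (\<forall>A::nat \<Rightarrow> 'w set. range A \<subseteq> sets M \<and> disjoint_family A \<longrightarrow>
        (\<lambda>n. G (A n)) sums G (\<Union>n. A n))"

definition vm_continuous :: "'w measure \<Rightarrow> ('w set \<Rightarrow> 'x::banach) \<Rightarrow> bool" where
  "vm_continuous M G \<longleftrightarrow>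
     (\<forall>\<epsilon>>0. \<exists>\<delta>>0. \<forall>A\<in>sets M. measure M A < \<delta> \<longrightarrow> norm (G A) < \<epsilon>)"

definition vm_bounded_variation :: "'w measure \<Rightarrow> ('w set \<Rightarrow> 'x::banach) \<Rightarrow> bool" where
  "vm_bounded_variation M G \<longleftrightarrow>
     (\<exists>K. \<forall>P. finite P \<and> P \<subseteq> sets M \<and> disjoint P \<longrightarrow> (\<Sum>A\<in>P. norm (G A)) \<le> K)"

definition radon_nikodym_property_wrt :: "'w measure \<Rightarrow> 'x::banach itself \<Rightarrow> bool" where
  "radon_nikodym_property_wrt M X \<longleftrightarrow>
     (\<forall>G :: 'w set \<Rightarrow> 'x.
        vector_measure M G \<and> vm_continuous M G \<and> vm_bounded_variation M G \<longrightarrow>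
        (\<exists>g \<in> bochner_L1 M. \<forall>A\<in>sets M.
           has_strong_bochner_integral M (\<lambda>\<omega>. indicator A \<omega> *\<^sub>R g \<omega>) (G A)))"

text \<open>
  A Banach space has the Radon--Nikodym property if it has it with respect to every finite measure
  space. A HOL formula cannot quantify over types, so the carrier type of these measure spaces is
  a parameter. Already the carrier \<^typ>\<open>real\<close> gives the full property, since Lebesgue measure
  on the unit interval is a sufficient test space.
\<close>

definition radon_nikodym_property :: "'w itself \<Rightarrow> 'x::banach itself \<Rightarrow> bool" where
  "radon_nikodym_property W X \<longleftrightarrow>
     (\<forall>M :: 'w measure. finite_measure M \<longrightarrow> radon_nikodym_property_wrt M X)"

section \<open>Weak topologies and weak convergence\<close>

definition initial_topology :: "'a set \<Rightarrow> ('a \<Rightarrow> real) set \<Rightarrow> 'a topology" where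
  "initial_topology S \<Phi> = topology_generated_by {{x \<in> S. \<phi> x \<in> U} | \<phi> U. \<phi> \<in> \<Phi> \<and> open U}"

lemma topspace_initial_topology:
  assumes "\<Phi> \<noteq> {}"
  shows "topspace (initial_topology S \<Phi>) = S"
proof -
  obtain \<phi> where "\<phi> \<in> \<Phi>" using assms by blast
  then have "S \<in> {{x \<in> S. \<phi> x \<in> U} | \<phi> U. \<phi> \<in> \<Phi> \<and> open U}"
    by (auto intro!: exI[of _ \<phi>] exI[of _ UNIV])
  then show ?thesis
    unfolding initial_topology_def topology_generated_by_topspace by auto
qed

definition dual_weak_topology :: "'e::banach topology" where
  "dual_weak_topology = initial_topology UNIV (range (blinfun_apply :: ('e \<Rightarrow>\<^sub>L real) \<Rightarrow> 'e \<Rightarrow> real))"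

definition L1_seminorm :: "'w measure \<Rightarrow> ('w \<Rightarrow> 'e::banach) \<Rightarrow> real" where
  "L1_seminorm M f = (LINT \<omega>|M. norm (f \<omega>))"

text \<open>Only the values of a functional on \<^term>\<open>bochner_L1 M\<close> matter.\<close>

definition L1_dual :: "'w measure \<Rightarrow> (('w \<Rightarrow> 'e::banach) \<Rightarrow> real) set" where
  "L1_dual M = {\<Lambda>.
     (\<forall>f\<in>bochner_L1 M. \<forall>h\<in>bochner_L1 M. \<Lambda> (\<lambda>\<omega>. f \<omega> + h \<omega>) = \<Lambda> f + \<Lambda> h) \<and>
     (\<forall>f\<in>bochner_L1 M. \<forall>c::real. \<Lambda> (\<lambda>\<omega>. c *\<^sub>R f \<omega>) = c * \<Lambda> f) \<and>
     (\<exists>C. \<forall>f\<in>bochner_L1 M. \<bar>\<Lambda> f\<bar> \<le> C * L1_seminorm M f)}"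

definition L1_weakly_converges ::
    "'w measure \<Rightarrow> (nat \<Rightarrow> 'w \<Rightarrow> 'e::banach) \<Rightarrow> ('w \<Rightarrow> 'e) \<Rightarrow> bool" where
  "L1_weakly_converges M f f0 \<longleftrightarrow> (\<forall>\<Lambda>\<in>L1_dual M. (\<lambda>k. \<Lambda> (f k)) \<longlonglongrightarrow> \<Lambda> f0)"

definition sigma_L1_Linf :: "'w measure \<Rightarrow> ('w \<Rightarrow> 'e::banach) topology" where
  "sigma_L1_Linf M = initial_topology (bochner_L1 M)
     {(\<lambda>f. LINT \<omega>|M. blinfun_apply (b \<omega>) (f \<omega>)) | b :: 'w \<Rightarrow> 'e \<Rightarrow>\<^sub>L real. b \<in> bochner_Linf M}"

section \<open>The sequential Bocce criterion\<close>

definition set_mean :: "'w measure \<Rightarrow> 'w set \<Rightarrow> ('w \<Rightarrow> real) \<Rightarrow> real" where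
  "set_mean M A h = 1 / measure M A * (LINT \<omega>:A|M. h \<omega>)"

definition bocce_osc :: "'w measure \<Rightarrow> ('w \<Rightarrow> real) \<Rightarrow> 'w set \<Rightarrow> real" where
  "bocce_osc M h A = 1 / measure M A * (LINT \<omega>:A|M. \<bar>h \<omega> - set_mean M A h\<bar>)"

definition pos_sets :: "'w measure \<Rightarrow> 'w set set" where
  "pos_sets M = {A \<in> sets M. measure M A > 0}"

definition sequential_bocce_criterion :: "'w measure \<Rightarrow> (nat \<Rightarrow> 'w \<Rightarrow> real) \<Rightarrow> bool" where
  "sequential_bocce_criterion M h \<longleftrightarrow>
     (\<forall>r::nat \<Rightarrow> nat. strict_mono r \<longrightarrow>
       (\<forall>\<epsilon>>0. \<forall>B\<in>pos_sets M. \<exists>A\<in>pos_sets M. A \<subseteq> B \<and>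
          liminf (\<lambda>j. ereal (bocce_osc M (h (r j)) A)) < ereal \<epsilon>))"

section \<open>Limited convergence\<close>

definition limited_integrands :: "'w measure \<Rightarrow> ('w \<Rightarrow> 'e::banach \<Rightarrow> real) set" where
  "limited_integrands M = {g.
     (\<forall>\<omega>\<in>space M. g \<omega> 0 = 0) \<and>
     (\<forall>\<omega>\<in>space M. continuous_map dual_weak_topology euclideanreal (g \<omega>)) \<and>
     (\<exists>C>0. \<exists>\<phi>::'w \<Rightarrow> real. integrable M \<phi> \<and>
        (\<forall>\<omega>\<in>space M. \<forall>x. \<bar>g \<omega> x\<bar> \<le> C * norm x + \<phi> \<omega>)) \<and>
     (\<forall>f\<in>bochner_L1 M. (\<lambda>\<omega>. g \<omega> (f \<omega>)) \<in> borel_measurable M)}"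

definition converges_limitedly ::
    "'w measure \<Rightarrow> (nat \<Rightarrow> 'w \<Rightarrow> 'e::banach) \<Rightarrow> ('w \<Rightarrow> 'e) \<Rightarrow> bool" where
  "converges_limitedly M f f0 \<longleftrightarrow>
     (\<forall>g\<in>limited_integrands M. (\<lambda>k. LINT \<omega>|M. g \<omega> (f k \<omega> - f0 \<omega>)) \<longlonglongrightarrow> 0)"

end

theory Submission
  imports Defs
begin

text \<open>
  Limited convergence tests against the integrands \<open>\<langle>x, b(\<omega>)\<rangle>\<close> and \<open>\<bar>\<langle>x, x*\<rangle>\<bar>\<close>. The former represent
  the dual of \<open>L\<^sup>1\<close>, by the Radon--Nikodym property of the dual space; the latter give convergence
  in mean of \<open>x*(f\<^sub>k)\<close>, hence the Bocce criterion.

  For the converse let \<open>d\<^sub>k = f\<^sub>k - f\<^sub>0\<close> be null for \<open>\<sigma>(L\<^sup>1, L\<^sup>\<infinity>)\<close>. A Baire category argument makes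
  the norms \<open>\<parallel>d\<^sub>k\<parallel>\<close> equi-integrable, and the Bocce criterion then gives \<open>x*(d\<^sub>k) \<longlonglongrightarrow> 0\<close> in mean for
  each \<open>x*\<close>, so that \<open>\<langle>d\<^sub>k, b\<rangle> \<longlonglongrightarrow> 0\<close> in probability for every strongly measurable field \<open>b\<close> of
  functionals. If \<open>g(\<omega>, d\<^sub>k)\<close> did not tend to zero in probability, weak continuity of \<open>g(\<omega>, \<cdot>)\<close>
  would provide measurably chosen functionals that stay away from zero along \<open>d\<^sub>k\<close>, and the
  Radon--Nikodym property would make them strongly measurable. Stegall's theorem on the
  separability of duals of separable subspaces is thus avoided.
\<close>

section \<open>Strong measurability and Bochner integrable functions\<close>

text \<open>The obstacle is that neither the space nor its dual need be separable and that the weak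
  topology need not be metrizable; strong measurability only confines the values of the sequence to
  the closure of a countable set \<open>x n\<close>. Random functionals are therefore handled as
  points of a compact product of real lines, where selections and weak-star cluster points exist,
  and they are asked to be measurable only along the points \<open>x n\<close>. Equi-integrability
  comes from the convergence against bounded fields alone and is spent twice: it keeps a countable
  increasing union of good sets good in the Bocce argument, and it turns convergence in probability
  of \<open>g\<close> into convergence of the integrals. Testing with an indicator times a constant
  functional makes the means over a fixed set tend to zero, so that on this set small oscillation is
  the same as small mean modulus. Passing between \<open>f k\<close> and \<open>f k - f0\<close> in
  the Bocce criterion is harmless, because a single integrable function is almost constant on some
  smaller set of positive measure.\<close>

lemma strongly_measurable_simple_function:
  assumes "simple_function M s"
  shows "strongly_measurable M s"
  unfolding strongly_measurable_def by (rule exI[of _ "\<lambda>_. s"]) (use assms in auto)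

lemma strongly_measurable_compose2:
  assumes cont: "continuous_on UNIV (\<lambda>p. h (fst p) (snd p))"
    and f: "strongly_measurable M f" and g: "strongly_measurable M g"
  shows "strongly_measurable M (\<lambda>\<omega>. h (f \<omega>) (g \<omega>))"
proof -
  from f obtain s where s: "\<And>n::nat. simple_function M (s n)"
    and s_lim: "\<And>\<omega>. \<omega> \<in> space M \<Longrightarrow> (\<lambda>n. s n \<omega>) \<longlonglongrightarrow> f \<omega>"
    unfolding strongly_measurable_def by blast
  from g obtain t where t: "\<And>n::nat. simple_function M (t n)"
    and t_lim: "\<And>\<omega>. \<omega> \<in> space M \<Longrightarrow> (\<lambda>n. t n \<omega>) \<longlonglongrightarrow> g \<omega>"
    unfolding strongly_measurable_def by blast
  have "(\<lambda>n. h (s n \<omega>) (t n \<omega>)) \<longlonglongrightarrow> h (f \<omega>) (g \<omega>)" if "\<omega> \<in> space M" for \<omega>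
    using continuous_on_tendsto_compose[OF cont tendsto_Pair[OF s_lim[OF that] t_lim[OF that]]]
    by simp
  then show ?thesis
    unfolding strongly_measurable_def
    using simple_function_compose2[OF s t, of h] by (intro exI[of _ "\<lambda>n \<omega>. h (s n \<omega>) (t n \<omega>)"]) auto
qed

lemma strongly_measurable_compose:
  assumes "continuous_on UNIV h" and "strongly_measurable M f"
  shows "strongly_measurable M (\<lambda>\<omega>. h (f \<omega>))"
  by (rule strongly_measurable_compose2[where h = "\<lambda>x _. h x", OF _ assms(2) assms(2)])
     (intro continuous_on_compose2[OF assms(1)] continuous_intros, auto)

lemma strongly_measurable_add:
  "strongly_measurable M f \<Longrightarrow> strongly_measurable M g \<Longrightarrow> strongly_measurable M (\<lambda>\<omega>. f \<omega> + g \<omega>)"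
  by (rule strongly_measurable_compose2) (intro continuous_intros)

lemma strongly_measurable_diff:
  "strongly_measurable M f \<Longrightarrow> strongly_measurable M g \<Longrightarrow> strongly_measurable M (\<lambda>\<omega>. f \<omega> - g \<omega>)"
  by (rule strongly_measurable_compose2) (intro continuous_intros)

lemma strongly_measurable_real:
  fixes f :: "'w \<Rightarrow> real"
  assumes "strongly_measurable M f"
  shows "f \<in> borel_measurable M"
proof -
  from assms obtain s where s: "\<And>n::nat. simple_function M (s n)"
    and lim: "\<And>\<omega>. \<omega> \<in> space M \<Longrightarrow> (\<lambda>n. s n \<omega>) \<longlonglongrightarrow> f \<omega>"
    unfolding strongly_measurable_def by blast
  show ?thesis
    by (rule borel_measurable_LIMSEQ_metric[OF borel_measurable_simple_function[OF s] lim])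
qed

lemma strongly_measurable_norm:
  "strongly_measurable M f \<Longrightarrow> (\<lambda>\<omega>. norm (f \<omega>)) \<in> borel_measurable M"
  by (rule strongly_measurable_real, rule strongly_measurable_compose) (intro continuous_intros)

lemma strongly_measurable_pairing:
  fixes f :: "'w \<Rightarrow> 'a::real_normed_vector" and g :: "'w \<Rightarrow> 'b::real_normed_vector"
  assumes "bounded_bilinear B" and "strongly_measurable M f" and "strongly_measurable M g"
  shows "strongly_measurable M (\<lambda>\<omega>. B (f \<omega>) (g \<omega>))"
  by (rule strongly_measurable_compose2[OF _ assms(2,3)])
     (rule bounded_bilinear.continuous_on[OF assms(1)], intro continuous_intros, intro
         continuous_intros)

lemma strongly_measurable_borel:
  fixes f :: "'w \<Rightarrow> real"
  assumes "f \<in> borel_measurable M"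
  shows "strongly_measurable M f"
  using borel_measurable_implies_sequence_metric[OF assms, of 0]
  unfolding strongly_measurable_def by blast

lemma strongly_measurable_indicator:
  fixes f :: "'w \<Rightarrow> 'e::real_normed_vector"
  assumes "A \<in> sets M" and "strongly_measurable M f"
  shows "strongly_measurable M (\<lambda>\<omega>. indicator A \<omega> *\<^sub>R f \<omega>)"
  by (rule strongly_measurable_pairing[OF bounded_bilinear_scaleR strongly_measurable_borel
      assms(2)])
     (use assms(1) in measurable)

lemma strongly_measurable_blinfun_apply:
  fixes b :: "'w \<Rightarrow> 'e::real_normed_vector \<Rightarrow>\<^sub>L real"
  assumes "strongly_measurable M b" and "strongly_measurable M f"
  shows "(\<lambda>\<omega>. blinfun_apply (b \<omega>) (f \<omega>)) \<in> borel_measurable M"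
  by (rule strongly_measurable_real[OF
      strongly_measurable_pairing[OF bounded_bilinear_blinfun_apply assms]])

lemma simple_function_bounded:
  fixes s :: "'w \<Rightarrow> 'e::real_normed_vector"
  assumes "simple_function M s"
  obtains C where "C > 0" and "\<And>\<omega>. \<omega> \<in> space M \<Longrightarrow> norm (s \<omega>) \<le> C"
proof -
  have fin: "finite ((\<lambda>\<omega>. norm (s \<omega>)) ` space M)"
    using simple_functionD(1)[OF assms] by (metis finite_imageI image_image)
  show thesis
  proof
    show "max 1 (Max ((\<lambda>\<omega>. norm (s \<omega>)) ` space M)) > 0" by simp
    show "norm (s \<omega>) \<le> max 1 (Max ((\<lambda>\<omega>. norm (s \<omega>)) ` space M))" if "\<omega> \<in> space M" for \<omega>
      using fin that by (simp add: le_max_iff_disj)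
  qed
qed

context finite_measure
begin

lemma simple_bochner_integrable_iff:
  "Bochner_Integration.simple_bochner_integrable M s \<longleftrightarrow> simple_function M s"
  by (auto simp: simple_bochner_integrable.simps)

lemma integrable_norm_simple:
  fixes s :: "'a \<Rightarrow> 'e::real_normed_vector"
  assumes "simple_function M s"
  shows "integrable M (\<lambda>\<omega>. norm (s \<omega>))"
proof -
  obtain C where "\<And>\<omega>. \<omega> \<in> space M \<Longrightarrow> norm (s \<omega>) \<le> C"
    using simple_function_bounded[OF assms] by blast
  then show ?thesis
    by (intro integrable_const_bound[where B = C] AE_I2
        strongly_measurable_norm[OF strongly_measurable_simple_function[OF assms]]) simp
qed

lemma integrable_norm_simple_approx:
  fixes f :: "'a \<Rightarrow> 'e::real_normed_vector"
  assumes f: "strongly_measurable M f" and int: "integrable M (\<lambda>\<omega>. norm (f \<omega>))"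
  obtains s where "\<And>n::nat. simple_function M (s n)"
    and "(\<lambda>n. LINT \<omega>|M. norm (f \<omega> - s n \<omega>)) \<longlonglongrightarrow> 0"
proof -
  from f obtain s where s: "\<And>n::nat. simple_function M (s n)"
    and lim: "\<And>\<omega>. \<omega> \<in> space M \<Longrightarrow> (\<lambda>n. s n \<omega>) \<longlonglongrightarrow> f \<omega>"
    unfolding strongly_measurable_def by blast
  note [measurable] = strongly_measurable_norm[OF f]
    strongly_measurable_norm[OF strongly_measurable_simple_function[OF s]]
  \<comment> \<open>The approximants may be much larger than \<open>f\<close>. Cutting them to zero
    where their norm exceeds \<open>norm (f \<omega>) + 1\<close> provides the dominating function
    \<open>2 * norm (f \<omega>) + 1\<close>; the margin 1 makes the cut inactive from some index on
    at each point.\<close>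
  define A where "A n = {\<omega> \<in> space M. norm (s n \<omega>) \<le> norm (f \<omega>) + 1}" for n
  have A[measurable]: "A n \<in> sets M" for n
    unfolding A_def by measurable
  define t where "t n \<omega> = indicat_real (A n) \<omega> *\<^sub>R s n \<omega>" for n \<omega>
  have t: "simple_function M (t n)" for n
    unfolding t_def by (intro simple_function_compose2[where h = scaleR] simple_function_indicator A
        s)
  show thesis
  proof (rule that[OF t])
    have "(\<lambda>n. LINT \<omega>|M. norm (f \<omega> - t n \<omega>)) \<longlonglongrightarrow> (LINT \<omega>|M. 0)"
    proof (rule integral_dominated_convergence[where w = "\<lambda>\<omega>. 2 * norm (f \<omega>) + 1"])
      show "AE \<omega> in M. (\<lambda>n. norm (f \<omega> - t n \<omega>)) \<longlonglongrightarrow> 0"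
      proof (rule AE_I2)
        fix \<omega> assume \<omega>: "\<omega> \<in> space M"
        have "(\<lambda>n. norm (s n \<omega>)) \<longlonglongrightarrow> norm (f \<omega>)"
          using lim[OF \<omega>] by (rule tendsto_norm)
        then have "\<forall>\<^sub>F n in sequentially. norm (s n \<omega>) < norm (f \<omega>) + 1"
          by (rule order_tendstoD) simp
        then have "\<forall>\<^sub>F n in sequentially. norm (f \<omega> - s n \<omega>) = norm (f \<omega> - t n \<omega>)"
          by eventually_elim (use \<omega> in \<open>auto simp: t_def A_def\<close>)
        moreover have "(\<lambda>n. norm (f \<omega> - s n \<omega>)) \<longlonglongrightarrow> 0"
          using tendsto_norm[OF tendsto_diff[OF tendsto_const[of "f \<omega>"] lim[OF \<omega>]]] by simp
        ultimately show "(\<lambda>n. norm (f \<omega> - t n \<omega>)) \<longlonglongrightarrow> 0"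
          by (rule Lim_transform_eventually[rotated])
      qed
      show "AE \<omega> in M. norm (norm (f \<omega> - t n \<omega>)) \<le> 2 * norm (f \<omega>) + 1" for n
      proof (rule AE_I2)
        fix \<omega> assume \<omega>: "\<omega> \<in> space M"
        have "norm (t n \<omega>) \<le> norm (f \<omega>) + 1"
          using \<omega> by (auto simp: t_def A_def indicator_def)
        then show "norm (norm (f \<omega> - t n \<omega>)) \<le> 2 * norm (f \<omega>) + 1"
          using norm_triangle_ineq4[of "f \<omega>" "t n \<omega>"] by simp
      qed
      show "(\<lambda>\<omega>. norm (f \<omega> - t n \<omega>)) \<in> borel_measurable M" for n
        by (rule strongly_measurable_norm[OF strongly_measurable_diff[OF f
              strongly_measurable_simple_function[OF t]]])
      show "integrable M (\<lambda>\<omega>. 2 * norm (f \<omega>) + 1)"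
        using int by auto
    qed auto
    then show "(\<lambda>n. LINT \<omega>|M. norm (f \<omega> - t n \<omega>)) \<longlonglongrightarrow> 0" by simp
  qed
qed

lemma norm_simple_bochner_integral_diff_le:
  fixes s t :: "'a \<Rightarrow> 'e::real_normed_vector"
  assumes s: "simple_function M s" and t: "simple_function M t"
  shows "norm (Bochner_Integration.simple_bochner_integral M s -
      Bochner_Integration.simple_bochner_integral M t)
    \<le> (LINT \<omega>|M. norm (s \<omega> - t \<omega>))"
proof -
  have st: "simple_function M (\<lambda>\<omega>. s \<omega> - t \<omega>)"
    using s t by (rule simple_function_compose2)
  have "norm (Bochner_Integration.simple_bochner_integral M (\<lambda>\<omega>. s \<omega> - t \<omega>)) \<le>
      Bochner_Integration.simple_bochner_integral M (\<lambda>\<omega>. norm (s \<omega> - t \<omega>))"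
    using st by (intro simple_bochner_integral_norm_bound) (simp add: simple_bochner_integrable_iff)
  also have "\<dots> = (LINT \<omega>|M. norm (s \<omega> - t \<omega>))"
    by (intro simple_bochner_integrable_eq_integral)
       (simp add: simple_bochner_integrable_iff simple_function_compose1[OF st])
  finally show ?thesis
    using s t by (simp add: simple_bochner_integral_diff simple_bochner_integrable_iff)
qed

text \<open>In one direction a single simple function at finite distance dominates \<open>f\<close>.
  In the other, the truncated approximants have a Cauchy sequence of integrals, and completeness of
  the space supplies the value. From here on membership is decided by measurability and an
  integrable norm.\<close>

lemma bochner_L1_iff:
  fixes f :: "'a \<Rightarrow> 'e::banach"
  shows "f \<in> bochner_L1 M \<longleftrightarrow> strongly_measurable M f \<and> integrable M (\<lambda>\<omega>. norm (f \<omega>))"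
proof
  assume "f \<in> bochner_L1 M"
  then obtain s where f: "strongly_measurable M f" and s: "\<And>n::nat. simple_function M (s n)"
    and lim: "(\<lambda>n. \<integral>\<^sup>+ \<omega>. ennreal (norm (f \<omega> - s n \<omega>)) \<partial>M) \<longlonglongrightarrow> 0"
    unfolding bochner_L1_def has_strong_bochner_integral_def simple_bochner_integrable_iff by blast
  from lim have "\<forall>\<^sub>F n in sequentially. (\<integral>\<^sup>+ \<omega>. ennreal (norm (f \<omega> - s n \<omega>)) \<partial>M) < \<infinity>"
    by (rule order_tendstoD) simp
  then obtain n where n: "(\<integral>\<^sup>+ \<omega>. ennreal (norm (f \<omega> - s n \<omega>)) \<partial>M) < \<infinity>"
    by (auto simp: eventually_sequentially)
  have meas: "(\<lambda>\<omega>. norm (f \<omega> - s n \<omega>)) \<in> borel_measurable M"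
    by (rule strongly_measurable_norm[OF strongly_measurable_diff[OF f
          strongly_measurable_simple_function[OF s]]])
  have "integrable M (\<lambda>\<omega>. norm (f \<omega> - s n \<omega>))"
    by (rule integrableI_bounded[OF meas]) (use n in simp)
  then have "integrable M (\<lambda>\<omega>. norm (f \<omega> - s n \<omega>) + norm (s n \<omega>))"
    using integrable_norm_simple[OF s] by (rule Bochner_Integration.integrable_add)
  then have "integrable M (\<lambda>\<omega>. norm (f \<omega>))"
    by (rule Bochner_Integration.integrable_bound[OF _ strongly_measurable_norm[OF f]])
       (simp add: add.commute norm_triangle_sub)
  with f show "strongly_measurable M f \<and> integrable M (\<lambda>\<omega>. norm (f \<omega>))" by simp
next
  assume "strongly_measurable M f \<and> integrable M (\<lambda>\<omega>. norm (f \<omega>))"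
  then have f: "strongly_measurable M f" and int: "integrable M (\<lambda>\<omega>. norm (f \<omega>))" by auto
  obtain s where s: "\<And>n::nat. simple_function M (s n)"
    and lim: "(\<lambda>n. LINT \<omega>|M. norm (f \<omega> - s n \<omega>)) \<longlonglongrightarrow> 0"
    using integrable_norm_simple_approx[OF f int] by blast
  have int_diff: "integrable M (\<lambda>\<omega>. norm (f \<omega> - s n \<omega>))" for n
    by (rule Bochner_Integration.integrable_bound[OF Bochner_Integration.integrable_add
          [OF int integrable_norm_simple[OF s[of n]]] strongly_measurable_norm[OF
            strongly_measurable_diff[OF f strongly_measurable_simple_function[OF s]]]])
       (simp add: norm_triangle_ineq4)
  have "Cauchy (\<lambda>n. Bochner_Integration.simple_bochner_integral M (s n))"
  proof (rule metric_CauchyI)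
    fix e :: real assume "e > 0"
    then have "\<forall>\<^sub>F n in sequentially. (LINT \<omega>|M. norm (f \<omega> - s n \<omega>)) < e / 2"
      using lim by (intro order_tendstoD) auto
    then obtain N where N: "\<And>n. n \<ge> N \<Longrightarrow> (LINT \<omega>|M. norm (f \<omega> - s n \<omega>)) < e / 2"
      by (auto simp: eventually_sequentially)
    have "dist (Bochner_Integration.simple_bochner_integral M (s m))
        (Bochner_Integration.simple_bochner_integral M (s n)) < e"
      if "m \<ge> N" "n \<ge> N" for m n
    proof -
      have "dist (Bochner_Integration.simple_bochner_integral M (s m))
          (Bochner_Integration.simple_bochner_integral M (s n))
          \<le> (LINT \<omega>|M. norm (s m \<omega> - s n \<omega>))"
        using norm_simple_bochner_integral_diff_le[OF s s] by (simp add: dist_norm)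
      also have "\<dots> \<le> (LINT \<omega>|M. norm (f \<omega> - s m \<omega>) + norm (f \<omega> - s n \<omega>))"
      proof (rule Bochner_Integration.integral_mono)
        show "integrable M (\<lambda>\<omega>. norm (s m \<omega> - s n \<omega>))"
          by (rule integrable_norm_simple) (rule simple_function_compose2[OF s s])
        show "norm (s m \<omega> - s n \<omega>) \<le> norm (f \<omega> - s m \<omega>) + norm (f \<omega> - s n \<omega>)" for \<omega>
          using norm_triangle_ineq4[of "f \<omega> - s n \<omega>" "f \<omega> - s m \<omega>"] by simp
      qed (use int_diff in auto)
      also have "\<dots> < e"
        using N[OF that(1)] N[OF that(2)] int_diff by simp
      finally show ?thesis .
    qed
    then show "\<exists>N. \<forall>m\<ge>N. \<forall>n\<ge>N.
        dist (Bochner_Integration.simple_bochner_integral M (s m))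
            (Bochner_Integration.simple_bochner_integral M (s n)) < e" by blast
  qed
  then obtain x where "(\<lambda>n. Bochner_Integration.simple_bochner_integral M (s n)) \<longlonglongrightarrow> x"
    by (auto simp: Cauchy_convergent_iff convergent_def)
  moreover have "(\<lambda>n. \<integral>\<^sup>+ \<omega>. ennreal (norm (f \<omega> - s n \<omega>)) \<partial>M) \<longlonglongrightarrow> 0"
    using tendsto_ennrealI[OF lim] by (simp add: nn_integral_eq_integral[OF int_diff])
  ultimately show "f \<in> bochner_L1 M"
    using f s unfolding bochner_L1_def has_strong_bochner_integral_def simple_bochner_integrable_iff
    by blast
qed

lemma bochner_L1_approx:
  fixes f :: "'a \<Rightarrow> 'e::banach"
  assumes "f \<in> bochner_L1 M" and "e > 0"
  obtains s where "simple_function M s" and "(LINT \<omega>|M. norm (f \<omega> - s \<omega>)) < e"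
proof -
  obtain s where s: "\<And>n::nat. simple_function M (s n)"
    and lim: "(\<lambda>n. LINT \<omega>|M. norm (f \<omega> - s n \<omega>)) \<longlonglongrightarrow> 0"
    using assms integrable_norm_simple_approx unfolding bochner_L1_iff by blast
  from order_tendstoD(2)[OF lim \<open>e > 0\<close>] obtain n where "(LINT \<omega>|M. norm (f \<omega> - s n \<omega>)) < e"
    by (auto simp: eventually_sequentially)
  with s show thesis by (rule that)
qed

lemma bochner_L1_simple: "simple_function M s \<Longrightarrow> s \<in> bochner_L1 M"
  by (simp add: bochner_L1_iff strongly_measurable_simple_function integrable_norm_simple)

lemma bochner_L1_add:
  assumes "f \<in> bochner_L1 M" and "g \<in> bochner_L1 M"
  shows "(\<lambda>\<omega>. f \<omega> + g \<omega>) \<in> bochner_L1 M"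
proof -
  have sm: "strongly_measurable M (\<lambda>\<omega>. f \<omega> + g \<omega>)"
    using assms by (simp add: bochner_L1_iff strongly_measurable_add)
  have "integrable M (\<lambda>\<omega>. norm (f \<omega>) + norm (g \<omega>))"
    using assms by (simp add: bochner_L1_iff)
  then have "integrable M (\<lambda>\<omega>. norm (f \<omega> + g \<omega>))"
    by (rule Bochner_Integration.integrable_bound[OF _ strongly_measurable_norm[OF sm]])
       (simp add: norm_triangle_ineq)
  then show ?thesis
    using sm by (simp add: bochner_L1_iff)
qed

lemma bochner_L1_diff:
  assumes "f \<in> bochner_L1 M" and "g \<in> bochner_L1 M"
  shows "(\<lambda>\<omega>. f \<omega> - g \<omega>) \<in> bochner_L1 M"
proof -
  have sm: "strongly_measurable M (\<lambda>\<omega>. f \<omega> - g \<omega>)"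
    using assms by (simp add: bochner_L1_iff strongly_measurable_diff)
  have "integrable M (\<lambda>\<omega>. norm (f \<omega>) + norm (g \<omega>))"
    using assms by (simp add: bochner_L1_iff)
  then have "integrable M (\<lambda>\<omega>. norm (f \<omega> - g \<omega>))"
    by (rule Bochner_Integration.integrable_bound[OF _ strongly_measurable_norm[OF sm]])
       (simp add: norm_triangle_ineq4)
  then show ?thesis
    using sm by (simp add: bochner_L1_iff)
qed

lemma bochner_L1_indicator:
  assumes "A \<in> sets M"
  shows "(\<lambda>\<omega>. indicat_real A \<omega> *\<^sub>R x) \<in> bochner_L1 M"
  by (rule bochner_L1_simple, rule simple_function_compose1[where g = "\<lambda>r. r *\<^sub>R x"])
     (intro simple_function_indicator assms)

lemma bochner_L1_pairing:
  fixes f :: "'a \<Rightarrow> 'e::banach" and b :: "'a \<Rightarrow> 'e \<Rightarrow>\<^sub>L real"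
  assumes f: "f \<in> bochner_L1 M" and b: "strongly_measurable M b"
    and C: "\<And>\<omega>. \<omega> \<in> space M \<Longrightarrow> norm (b \<omega>) \<le> C"
  shows "integrable M (\<lambda>\<omega>. b \<omega> (f \<omega>))"
    and "\<bar>LINT \<omega>|M. b \<omega> (f \<omega>)\<bar> \<le> C * (LINT \<omega>|M. norm (f \<omega>))"
proof -
  have int: "integrable M (\<lambda>\<omega>. C * norm (f \<omega>))"
    using f by (simp add: bochner_L1_iff)
  have bound: "\<bar>b \<omega> (f \<omega>)\<bar> \<le> C * norm (f \<omega>)" if "\<omega> \<in> space M" for \<omega>
    using norm_blinfun[of "b \<omega>" "f \<omega>"] mult_right_mono[OF C[OF that] norm_ge_zero[of "f \<omega>"]]
    by simp
  have meas: "(\<lambda>\<omega>. b \<omega> (f \<omega>)) \<in> borel_measurable M"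
    using f b by (simp add: bochner_L1_iff strongly_measurable_blinfun_apply)
  show int': "integrable M (\<lambda>\<omega>. b \<omega> (f \<omega>))"
    by (rule Bochner_Integration.integrable_bound[OF int meas])
       (rule AE_I2, use bound in force)
  have "\<bar>LINT \<omega>|M. b \<omega> (f \<omega>)\<bar> \<le> (LINT \<omega>|M. \<bar>b \<omega> (f \<omega>)\<bar>)"
    using integral_norm_bound[of M "\<lambda>\<omega>. b \<omega> (f \<omega>)"] by simp
  also have "\<dots> \<le> (LINT \<omega>|M. C * norm (f \<omega>))"
    by (rule integral_mono[OF integrable_abs[OF int'] int bound])
  finally have "\<bar>LINT \<omega>|M. b \<omega> (f \<omega>)\<bar> \<le> (LINT \<omega>|M. C * norm (f \<omega>))" .
  then show "\<bar>LINT \<omega>|M. b \<omega> (f \<omega>)\<bar> \<le> C * (LINT \<omega>|M. norm (f \<omega>))" by simp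
qed

text \<open>The approximating simple functions are pushed through \<open>T\<close>, whose bound
  controls the error. With \<open>T\<close> the evaluation at a vector, this turns the vector-valued
  identity for a Radon-Nikodym density into scalar integrals.\<close>

lemma has_strong_bochner_integral_blinfun:
  fixes f :: "'a \<Rightarrow> 'e::banach" and T :: "'e \<Rightarrow> real"
  assumes "has_strong_bochner_integral M f y" and T: "bounded_linear T"
  shows "(LINT \<omega>|M. T (f \<omega>)) = T y"
proof -
  interpret T: bounded_linear T by fact
  from assms obtain s where f: "strongly_measurable M f"
    and s: "\<And>n::nat. simple_function M (s n)"
    and lim: "(\<lambda>n. \<integral>\<^sup>+ \<omega>. ennreal (norm (f \<omega> - s n \<omega>)) \<partial>M) \<longlonglongrightarrow> 0"
    and y: "(\<lambda>n. Bochner_Integration.simple_bochner_integral M (s n)) \<longlonglongrightarrow> y"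
    unfolding has_strong_bochner_integral_def simple_bochner_integrable_iff by blast
  obtain K where K: "\<And>x. norm (T x) \<le> norm x * K" and "K > 0"
    using T.pos_bounded by blast
  have "has_bochner_integral M (\<lambda>\<omega>. T (f \<omega>)) (T y)"
  proof (rule has_bochner_integral.intros[where s = "\<lambda>n \<omega>. T (s n \<omega>)"])
    show "(\<lambda>\<omega>. T (f \<omega>)) \<in> borel_measurable M"
      by (rule strongly_measurable_real, rule strongly_measurable_compose[OF _ f])
         (rule T.continuous_on, intro continuous_intros)
    show "Bochner_Integration.simple_bochner_integrable M (\<lambda>\<omega>. T (s n \<omega>))" for n
      using simple_function_compose1[OF s] by (simp add: simple_bochner_integrable_iff)
    have "Bochner_Integration.simple_bochner_integral M (\<lambda>\<omega>. T (s n \<omega>)) =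
        T (Bochner_Integration.simple_bochner_integral M (s n))" for n
      using s by (intro simple_bochner_integral_linear T.linear_axioms)
         (simp add: simple_bochner_integrable_iff)
    then show "(\<lambda>n. Bochner_Integration.simple_bochner_integral M (\<lambda>\<omega>. T (s n \<omega>))) \<longlonglongrightarrow> T y"
      using T.tendsto[OF y] by simp
    have "(\<lambda>n. ennreal K * (\<integral>\<^sup>+ \<omega>. ennreal (norm (f \<omega> - s n \<omega>)) \<partial>M)) \<longlonglongrightarrow> ennreal K * 0"
      by (intro ennreal_tendsto_cmult lim) simp
    then have lim': "(\<lambda>n. ennreal K * (\<integral>\<^sup>+ \<omega>. ennreal (norm (f \<omega> - s n \<omega>)) \<partial>M)) \<longlonglongrightarrow> 0" by simp
    show "(\<lambda>n. \<integral>\<^sup>+ \<omega>. ennreal (norm (T (f \<omega>) - T (s n \<omega>))) \<partial>M) \<longlonglongrightarrow> 0"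
    proof (rule tendsto_sandwich[OF _ _ tendsto_const lim'])
      have "(\<integral>\<^sup>+ \<omega>. ennreal (norm (T (f \<omega>) - T (s n \<omega>))) \<partial>M)
          \<le> ennreal K * (\<integral>\<^sup>+ \<omega>. ennreal (norm (f \<omega> - s n \<omega>)) \<partial>M)" for n
      proof -
        have "(\<integral>\<^sup>+ \<omega>. ennreal (norm (T (f \<omega>) - T (s n \<omega>))) \<partial>M)
            \<le> (\<integral>\<^sup>+ \<omega>. ennreal K * ennreal (norm (f \<omega> - s n \<omega>)) \<partial>M)"
          using K \<open>K > 0\<close> by (intro nn_integral_mono)
            (auto simp: T.diff[symmetric] ennreal_mult'[symmetric] mult.commute)
        also have "\<dots> = ennreal K * (\<integral>\<^sup>+ \<omega>. ennreal (norm (f \<omega> - s n \<omega>)) \<partial>M)"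
          by (rule nn_integral_cmult[OF measurable_compose[OF strongly_measurable_norm[OF
                  strongly_measurable_diff[OF f strongly_measurable_simple_function[OF s]]]
                  measurable_ennreal]])
        finally show ?thesis .
      qed
      then show "\<forall>\<^sub>F n in sequentially. (\<integral>\<^sup>+ \<omega>. ennreal (norm (T (f \<omega>) - T (s n \<omega>))) \<partial>M)
          \<le> ennreal K * (\<integral>\<^sup>+ \<omega>. ennreal (norm (f \<omega> - s n \<omega>)) \<partial>M)" by simp
    qed simp
  qed
  then show ?thesis by (rule has_bochner_integral_integral_eq)
qed

end

section \<open>Norming functionals\<close>

definition sublinear :: "('e::real_vector \<Rightarrow> real) \<Rightarrow> bool" where
  "sublinear p \<longleftrightarrow> (\<forall>x y. p (x + y) \<le> p x + p y) \<and> (\<forall>c\<ge>0. \<forall>x. p (c *\<^sub>R x) = c * p x)"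

lemma sublinear_zero: "sublinear p \<Longrightarrow> p 0 = 0"
  unfolding sublinear_def by (metis mult_zero_left order_refl scaleR_zero_left)

lemma sublinear_lower: "sublinear p \<Longrightarrow> - p (- x) \<le> p x"
  using sublinear_zero[of p] unfolding sublinear_def
  by (metis add.right_inverse diff_ge_0_iff_ge diff_minus_eq_add)

text \<open>Applying \<open>le\<close> with factor \<open>1 / c\<close> to the vector
  \<open>c *\<^sub>R x\<close> gives the reverse inequality, so exact homogeneity needs no separate
  proof.\<close>

lemma sublinearI:
  assumes "\<And>x y. p (x + y) \<le> p x + p y" and "p 0 = 0"
    and le: "\<And>c x. c > 0 \<Longrightarrow> p (c *\<^sub>R x) \<le> c * p x"
  shows "sublinear p"
proof -
  have "p (c *\<^sub>R x) = c * p x" if "c \<ge> 0" for c x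
  proof (cases "c = 0")
    case False
    with that have "c > 0" by simp
    then have "p ((1 / c) *\<^sub>R (c *\<^sub>R x)) \<le> (1 / c) * p (c *\<^sub>R x)"
      by (intro le) simp
    then have "c * p x \<le> p (c *\<^sub>R x)"
      using \<open>c > 0\<close> by (simp add: field_simps)
    with le[OF \<open>c > 0\<close>] show ?thesis by (simp add: antisym)
  qed (simp add: assms(2))
  with assms(1) show ?thesis by (auto simp: sublinear_def)
qed

text \<open>Minimality with respect to this operation forces linearity, which yields the Hahn--Banach
  theorem without extending functionals from subspaces.\<close>

lemma sublinear_shift:
  assumes p: "sublinear p"
  obtains q where "sublinear q" and "q \<le> p" and "q (- v) \<le> - p v"
proof -
  have add: "p (x + y) \<le> p x + p y" for x y
    using p by (simp add: sublinear_def)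
  have scale: "p (c *\<^sub>R x) = c * p x" if "c \<ge> 0" for c x
    using p that by (simp add: sublinear_def)
  \<comment> \<open>The parameter \<open>t = 0\<close> shows \<open>q \<le> p\<close>, and
    \<open>t = 1\<close> at the point \<open>- v\<close> shows \<open>q (- v) \<le> - p v\<close>.
    Subadditivity of \<open>p\<close> bounds the family below by \<open>- p (- x)\<close>, so the
    infimum is finite.\<close>
  define q where "q x = (INF t\<in>{0..}. p (x + t *\<^sub>R v) - t * p v)" for x
  have lower: "- p (- x) \<le> p (x + t *\<^sub>R v) - t * p v" if "t \<ge> 0" for t x
    using add[of "x + t *\<^sub>R v" "- x"] scale[OF that, of v] by simp
  have bdd: "bdd_below ((\<lambda>t. p (x + t *\<^sub>R v) - t * p v) ` {0..})" for x
    using lower by (intro bdd_belowI2[where m = "- p (- x)"]) auto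
  have q_le: "q x \<le> p (x + t *\<^sub>R v) - t * p v" if "t \<ge> 0" for x t
    unfolding q_def by (rule cINF_lower[OF bdd]) (use that in simp)
  have q_ge: "m \<le> q x" if "\<And>t. t \<ge> 0 \<Longrightarrow> m \<le> p (x + t *\<^sub>R v) - t * p v" for m x
    unfolding q_def by (rule cINF_greatest) (use that in auto)
  show thesis
  proof (rule that)
    show "q \<le> p"
      using q_le[of 0] by (intro le_funI) simp
    show "q (- v) \<le> - p v"
      using q_le[of 1 "- v"] sublinear_zero[OF p] by simp
    show "sublinear q"
    proof (rule sublinearI)
      show "q (x + y) \<le> q x + q y" for x y
      proof -
        have "q (x + y) - (p (y + t *\<^sub>R v) - t * p v) \<le> q x" if "t \<ge> 0" for t
        proof (rule q_ge)
          fix s :: real assume "s \<ge> 0"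
          have "q (x + y) \<le> p (x + y + (s + t) *\<^sub>R v) - (s + t) * p v"
            using \<open>s \<ge> 0\<close> \<open>t \<ge> 0\<close> by (intro q_le) simp
          also have "p (x + y + (s + t) *\<^sub>R v) \<le> p (x + s *\<^sub>R v) + p (y + t *\<^sub>R v)"
            using add[of "x + s *\<^sub>R v" "y + t *\<^sub>R v"] by (simp add: algebra_simps)
          finally show "q (x + y) - (p (y + t *\<^sub>R v) - t * p v) \<le> p (x + s *\<^sub>R v) - s * p v"
            by (simp add: algebra_simps)
        qed
        then have "q (x + y) - q x \<le> q y"
          by (intro q_ge) (simp add: algebra_simps)
        then show ?thesis by simp
      qed
      show "q 0 = 0"
        using q_le[of 0 0] q_ge[of 0 0] lower[of _ 0] sublinear_zero[OF p] by force
      show "q (c *\<^sub>R x) \<le> c * q x" if "c > 0" for c x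
      proof -
        have "q (c *\<^sub>R x) / c \<le> q x"
        proof (rule q_ge)
          fix t :: real assume "t \<ge> 0"
          have "q (c *\<^sub>R x) \<le> p (c *\<^sub>R x + (c * t) *\<^sub>R v) - (c * t) * p v"
            using \<open>t \<ge> 0\<close> \<open>c > 0\<close> by (intro q_le) simp
          also have "\<dots> = c * (p (x + t *\<^sub>R v) - t * p v)"
            using scale[of c "x + t *\<^sub>R v"] \<open>c > 0\<close> by (simp add: algebra_simps)
          finally show "q (c *\<^sub>R x) / c \<le> p (x + t *\<^sub>R v) - t * p v"
            using \<open>c > 0\<close> by (simp add: field_simps)
        qed
        then show ?thesis using \<open>c > 0\<close> by (simp add: field_simps)
      qed
    qed
  qed
qed

text \<open>Pointwise infima of sublinear functionals are not subadditive in general; in a chain any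
  two members have a common lower bound, the smaller of the two, which restores the inequality. The
  bound \<open>- p (- x)\<close> keeps the infimum finite.\<close>

lemma sublinear_INF_chain:
  assumes "C \<noteq> {}" and sub: "\<And>q. q \<in> C \<Longrightarrow> sublinear q \<and> q \<le> p"
    and chain: "\<And>a b. a \<in> C \<Longrightarrow> b \<in> C \<Longrightarrow> a \<le> b \<or> b \<le> a"
  shows "sublinear (\<lambda>x. INF q\<in>C. q x)" and "\<And>a. a \<in> C \<Longrightarrow> (\<lambda>x. INF q\<in>C. q x) \<le> a"
proof -
  have lower: "- p (- x) \<le> q x" if "q \<in> C" for q x
    using sublinear_lower[of q x] sub[OF that] by (meson le_funD le_imp_neg_le order_trans)
  have bdd: "bdd_below ((\<lambda>q. q x) ` C)" for x
    using lower by (intro bdd_belowI2[where m = "- p (- x)"]) auto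
  have INF_le: "(INF q\<in>C. q x) \<le> a x" if "a \<in> C" for a x
    by (rule cINF_lower[OF bdd that])
  have le_INF: "m \<le> (INF q\<in>C. q x)" if "\<And>a. a \<in> C \<Longrightarrow> m \<le> a x" for m x
    by (rule cINF_greatest[OF assms(1)]) (use that in auto)
  show "(\<lambda>x. INF q\<in>C. q x) \<le> a" if "a \<in> C" for a
    using INF_le[OF that] by (intro le_funI)
  show "sublinear (\<lambda>x. INF q\<in>C. q x)"
  proof (rule sublinearI)
    fix x y
    have "(INF q\<in>C. q (x + y)) \<le> a x + b y" if ab: "a \<in> C" "b \<in> C" for a b
    proof -
      obtain c where c: "c \<in> C" "c \<le> a" "c \<le> b"
        using chain[OF ab] ab by (metis order_refl)
      have "(INF q\<in>C. q (x + y)) \<le> c (x + y)" by (rule INF_le[OF c(1)])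
      also have "\<dots> \<le> c x + c y" using sub[OF c(1)] by (simp add: sublinear_def)
      also have "\<dots> \<le> a x + b y" using c by (intro add_mono) (auto simp: le_fun_def)
      finally show ?thesis .
    qed
    then have "(INF q\<in>C. q (x + y)) - b y \<le> (INF q\<in>C. q x)" if "b \<in> C" for b
      using that by (intro le_INF) (simp add: algebra_simps)
    then have "(INF q\<in>C. q (x + y)) - (INF q\<in>C. q x) \<le> (INF q\<in>C. q y)"
      by (intro le_INF) (simp add: algebra_simps)
    then show "(INF q\<in>C. q (x + y)) \<le> (INF q\<in>C. q x) + (INF q\<in>C. q y)" by simp
  next
    have "q 0 = 0" if "q \<in> C" for q
      using sub[OF that] sublinear_zero by blast
    then have "(INF q\<in>C. q 0) = (INF q\<in>C. 0 :: real)" by (intro INF_cong) auto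
    then show "(INF q\<in>C. q 0) = 0" using assms(1) by simp
  next
    fix c :: real and x assume "c > 0"
    have "(INF q\<in>C. q (c *\<^sub>R x)) / c \<le> (INF q\<in>C. q x)"
    proof (rule le_INF)
      fix a assume "a \<in> C"
      have "(INF q\<in>C. q (c *\<^sub>R x)) \<le> a (c *\<^sub>R x)" by (rule INF_le[OF \<open>a \<in> C\<close>])
      also have "\<dots> = c * a x" using sub[OF \<open>a \<in> C\<close>] \<open>c > 0\<close> by (simp add: sublinear_def)
      finally show "(INF q\<in>C. q (c *\<^sub>R x)) / c \<le> a x" using \<open>c > 0\<close> by (simp add: field_simps)
    qed
    then show "(INF q\<in>C. q (c *\<^sub>R x)) \<le> c * (INF q\<in>C. q x)"
      using \<open>c > 0\<close> by (simp add: field_simps)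
  qed
qed

text \<open>Zorn's lemma, with the order reversed, gives a minimal sublinear \<open>l\<close> below
  \<open>p\<close>. The shift of \<open>l\<close> at any \<open>v\<close> cannot lie strictly below
  \<open>l\<close>, so \<open>l (- v) = - l v\<close>; oddness turns subadditivity into additivity
  and extends homogeneity to negative factors.\<close>

lemma sublinear_dominates_linear:
  fixes p :: "'e::real_vector \<Rightarrow> real"
  assumes p: "sublinear p"
  obtains l where "linear l" and "\<And>x. l x \<le> p x"
proof -
  define S where "S = {q. sublinear q \<and> q \<le> p}"
  have "\<exists>m\<in>S. \<forall>a\<in>S. a \<le> m \<longrightarrow> a = m"
  proof (rule predicate_Zorn[where P = "\<lambda>a b. b \<le> a"])
    show "partial_order_on S (relation_of (\<lambda>a b. b \<le> a) S)"
      by (rule partial_order_on_relation_ofI) auto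
    show "\<exists>u\<in>S. \<forall>a\<in>C. u \<le> a" if "C \<in> Chains (relation_of (\<lambda>a b. b \<le> a) S)" for C
    proof (cases "C = {}")
      case True
      with p show ?thesis by (auto simp: S_def)
    next
      case False
      have C: "a \<in> S" if "a \<in> C" for a
        using \<open>C \<in> Chains _\<close> that by (auto simp: Chains_def relation_of_def)
      have chain: "a \<le> b \<or> b \<le> a" if "a \<in> C" "b \<in> C" for a b
        using \<open>C \<in> Chains _\<close> that by (auto simp: Chains_def relation_of_def)
      have sub: "sublinear q \<and> q \<le> p" if "q \<in> C" for q
        using C[OF that] by (simp add: S_def)
      have INF: "sublinear (\<lambda>x. INF q\<in>C. q x)" "\<And>a. a \<in> C \<Longrightarrow> (\<lambda>x. INF q\<in>C. q x) \<le> a"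
        using sublinear_INF_chain[where p = p, OF False] sub chain by blast+
      from False obtain a where "a \<in> C" by blast
      have "(\<lambda>x. INF q\<in>C. q x) \<in> S"
        using INF(1) order_trans[OF INF(2)[OF \<open>a \<in> C\<close>]] sub[OF \<open>a \<in> C\<close>] by (simp add: S_def)
      with INF(2) show ?thesis by blast
    qed
  qed
  then obtain l where l: "sublinear l" "l \<le> p"
    and min: "\<And>a. sublinear a \<Longrightarrow> a \<le> l \<Longrightarrow> a = l"
    unfolding S_def by (metis (no_types, lifting) mem_Collect_eq order_trans)
  have minus: "l (- v) = - l v" for v
  proof -
    obtain q where "sublinear q" "q \<le> l" "q (- v) \<le> - l v"
      using sublinear_shift[OF l(1)] by blast
    with min[of q] sublinear_lower[OF l(1), of v] show ?thesis by simp
  qed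
  have add: "l (x + y) = l x + l y" for x y
  proof -
    have le: "l (x + y) \<le> l x + l y" for x y
      using l(1) by (simp add: sublinear_def)
    have "l (- x + - y) = - l (x + y)"
      using minus[of "x + y"] by simp
    with le[of "- x" "- y"] le[of x y] show ?thesis by (simp add: minus)
  qed
  show thesis
  proof (rule that)
    show "l x \<le> p x" for x using l(2) by (simp add: le_fun_def)
    show "linear l"
    proof (rule linearI)
      fix c x
      have "l (\<bar>c\<bar> *\<^sub>R x) = \<bar>c\<bar> * l x"
        using l(1) by (simp add: sublinear_def)
      then show "l (c *\<^sub>R x) = c *\<^sub>R l x"
        using minus[of "\<bar>c\<bar> *\<^sub>R x"] by (cases "c \<ge> 0") auto
    qed (rule add)
  qed
qed

text \<open>The norm is shifted at \<open>v\<close> before a linear minorant is taken: every linear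
  \<open>l\<close> below the shifted functional satisfies \<open>l (- v) \<le> - norm v\<close>,
  which forces the value \<open>norm v\<close> at \<open>v\<close>.\<close>

lemma norming_functional:
  fixes v :: "'e::real_normed_vector"
  obtains b :: "'e \<Rightarrow>\<^sub>L real" where "norm b \<le> 1" and "b v = norm v"
proof -
  have "sublinear (norm :: 'e \<Rightarrow> real)"
    by (simp add: sublinear_def norm_triangle_ineq)
  then obtain q where q: "sublinear q" "q \<le> norm" "q (- v) \<le> - norm v"
    using sublinear_shift by blast
  obtain l where l: "linear l" "\<And>x. l x \<le> q x"
    using sublinear_dominates_linear[OF q(1)] by blast
  have le: "l x \<le> norm x" for x
    using l(2)[of x] le_funD[OF q(2), of x] by simp
  have abs: "\<bar>l x\<bar> \<le> norm x * 1" for x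
    using le[of x] le[of "- x"] linear_neg[OF l(1), of x] by simp
  have "bounded_linear l"
    using l(1) by (intro bounded_linear_intro[where K = 1])
      (use abs in \<open>auto simp: linear_add linear_scale\<close>)
  then have l_eq: "blinfun_apply (Blinfun l) = l"
    by (rule bounded_linear_Blinfun_apply)
  show thesis
  proof (rule that)
    show "norm (Blinfun l) \<le> 1"
      by (rule norm_blinfun_bound) (use abs in \<open>auto simp: l_eq\<close>)
    show "Blinfun l v = norm v"
      using l(2)[of "- v"] q(3) linear_neg[OF l(1), of v] le[of v] by (simp add: l_eq)
  qed
qed

text \<open>A functional need not attain its norm, hence the loss \<open>e\<close>. Were all values
  on the unit ball below \<open>norm b - e\<close>, homogeneity would make \<open>norm b - e\<close>
  a bound for the operator norm.\<close>

lemma almost_norming_vector: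
  fixes b :: "'e::real_normed_vector \<Rightarrow>\<^sub>L real"
  assumes "e > 0"
  obtains x where "norm x \<le> 1" and "b x \<ge> norm b - e"
proof (rule ccontr)
  assume "\<not> thesis"
  with that have *: "b x < norm b - e" if "norm x \<le> 1" for x
    using \<open>norm x \<le> 1\<close> by force
  have "norm (b x) \<le> (norm b - e) * norm x" for x
  proof (cases "x = 0")
    case False
    have "b (x /\<^sub>R norm x) < norm b - e" "b (- (x /\<^sub>R norm x)) < norm b - e"
      using False by (intro *; simp)+
    then show ?thesis
      using False by (simp add: blinfun.scaleR_right blinfun.minus_right abs_if field_simps)
  qed simp
  moreover have "0 \<le> norm b - e"
    using *[of 0] by simp
  ultimately have "norm b \<le> norm b - e"
    by (intro norm_blinfun_bound)
  with \<open>e > 0\<close> show False by simp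
qed

text \<open>The abstract pairing \<open>B\<close> lets the two spaces exchange roles: vectors are
  tested by functionals for equi-integrability, and functionals by vectors for the bound on a
  density. Replacing \<open>f\<close> by a nearby simple function makes an almost norming partner
  simple as well.\<close>

lemma (in finite_measure) set_integral_norm_le_by_simple:
  fixes f :: "'a \<Rightarrow> 'x::banach" and B :: "'x \<Rightarrow> 'y::real_normed_vector \<Rightarrow> real"
  assumes f: "f \<in> bochner_L1 M" and A: "A \<in> sets M"
    and B: "bounded_bilinear B" and B_le: "\<And>v c. \<bar>B v c\<bar> \<le> norm v * norm c"
    and norming: "\<And>v e. e > 0 \<Longrightarrow> \<exists>c. norm c \<le> 1 \<and> B v c \<ge> norm v - e"
    and K: "\<And>c. simple_function M c \<Longrightarrow> (\<And>\<omega>. norm (c \<omega>) \<le> 1) \<Longrightarrow>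
      (LINT \<omega>|M. indicator A \<omega> * B (f \<omega>) (c \<omega>)) \<le> K"
  shows "(LINT \<omega>|M. indicator A \<omega> * norm (f \<omega>)) \<le> K"
proof (rule field_le_epsilon)
  fix \<epsilon> :: real assume "\<epsilon> > 0"
  \<comment> \<open>The error has three parts: the distance from \<open>f\<close> to
    \<open>s\<close> enters twice, at most \<open>2 * e\<close>, and the norming defect
    \<open>e\<close> is integrated over the whole space.\<close>
  define e where "e = \<epsilon> / (2 + measure M (space M))"
  have "e > 0" using \<open>\<epsilon> > 0\<close> by (simp add: e_def add_pos_nonneg)
  obtain s where s: "simple_function M s" and s_f: "(LINT \<omega>|M. norm (f \<omega> - s \<omega>)) < e"
    using bochner_L1_approx[OF f \<open>e > 0\<close>] by blast
  obtain N where N: "\<And>v. norm (N v) \<le> 1" "\<And>v. B v (N v) \<ge> norm v - e"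
    using norming[OF \<open>e > 0\<close>] by metis
  \<comment> \<open>\<open>N\<close> is an arbitrary choice without any measurability; composing it
    with a function of finite range is harmless.\<close>
  have c: "simple_function M (\<lambda>\<omega>. N (s \<omega>))"
    by (rule simple_function_compose1[OF s])
  have fs: "(\<lambda>\<omega>. f \<omega> - s \<omega>) \<in> bochner_L1 M"
    by (rule bochner_L1_diff[OF f bochner_L1_simple[OF s]])
  have int_f: "integrable M (\<lambda>\<omega>. norm (f \<omega>))" and int_fs: "integrable M (\<lambda>\<omega>. norm (f \<omega> - s \<omega>))"
    using f fs by (auto simp: bochner_L1_iff)
  have meas: "(\<lambda>\<omega>. B (f \<omega>) (N (s \<omega>))) \<in> borel_measurable M"
    using f by (intro strongly_measurable_real strongly_measurable_pairing[OF B]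
        strongly_measurable_simple_function[OF c]) (simp add: bochner_L1_iff)
  have "\<bar>B v (N w)\<bar> \<le> norm v" for v w
    using B_le[of v "N w"] mult_left_mono[OF N(1)[of w] norm_ge_zero[of v]] by simp
  note B_N = this
  have int_B: "integrable M (\<lambda>\<omega>. B (f \<omega>) (N (s \<omega>)))"
    by (rule Bochner_Integration.integrable_bound[OF int_f meas]) (use B_N in simp)
  have "(LINT \<omega>|M. indicator A \<omega> * norm (f \<omega>)) \<le>
    (LINT \<omega>|M. indicator A \<omega> * B (f \<omega>) (N (s \<omega>)) + (2 * norm (f \<omega> - s \<omega>) + e))"
  proof (rule integral_mono)
    show "integrable M (\<lambda>\<omega>. indicat_real A \<omega> * norm (f \<omega>))"
      using integrable_mult_indicator[OF A int_f] by simp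
    show "integrable M (\<lambda>\<omega>. indicat_real A \<omega> * B (f \<omega>) (N (s \<omega>)) + (2 * norm (f \<omega> - s \<omega>) + e))"
      using integrable_mult_indicator[OF A int_B] int_fs by simp
    fix \<omega>
    have "norm (f \<omega>) \<le> norm (s \<omega>) + norm (f \<omega> - s \<omega>)"
      by (rule norm_triangle_sub)
    moreover have "B (f \<omega>) (N (s \<omega>)) = B (s \<omega>) (N (s \<omega>)) + B (f \<omega> - s \<omega>) (N (s \<omega>))"
      by (simp add: bounded_bilinear.diff_left[OF B])
    ultimately have "norm (f \<omega>) \<le> B (f \<omega>) (N (s \<omega>)) + (2 * norm (f \<omega> - s \<omega>) + e)"
      using N(2)[of "s \<omega>"] B_N[of "f \<omega> - s \<omega>" "s \<omega>"] by linarith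
    then show "indicat_real A \<omega> * norm (f \<omega>) \<le>
        indicat_real A \<omega> * B (f \<omega>) (N (s \<omega>)) + (2 * norm (f \<omega> - s \<omega>) + e)"
      using \<open>e > 0\<close> by (auto simp: indicator_def)
  qed
  also have "\<dots> = (LINT \<omega>|M. indicator A \<omega> * B (f \<omega>) (N (s \<omega>))) +
      (2 * (LINT \<omega>|M. norm (f \<omega> - s \<omega>)) + e * measure M (space M))"
    using integrable_mult_indicator[OF A int_B] int_fs by simp
  also have "\<dots> \<le> K + (2 * e + e * measure M (space M))"
    using K[OF c N(1)] s_f by (intro add_mono) auto
  also have "\<dots> = K + \<epsilon>"
    using measure_nonneg[of M "space M"] unfolding e_def
    by (simp add: field_simps add_nonneg_eq_0_iff)
  finally show "(LINT \<omega>|M. indicator A \<omega> * norm (f \<omega>)) \<le> K + \<epsilon>" .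
qed

section \<open>Weakly null sequences are equi-integrable\<close>

definition unit_fields :: "'w measure \<Rightarrow> ('w \<Rightarrow> 'e::real_normed_vector \<Rightarrow>\<^sub>L real) set" where
  "unit_fields M = {b. strongly_measurable M b \<and> (\<forall>\<omega>\<in>space M. norm (b \<omega>) \<le> 1)}"

lemma (in finite_measure) unit_fields_diff:
  assumes "b \<in> unit_fields M" and "c \<in> unit_fields M"
  shows "integrable M (\<lambda>\<omega>. norm (b \<omega> - c \<omega>))"
    and "\<omega> \<in> space M \<Longrightarrow> norm (b \<omega> - c \<omega>) \<le> 2"
proof -
  show le: "norm (b \<omega> - c \<omega>) \<le> 2" if "\<omega> \<in> space M" for \<omega>
    using norm_triangle_ineq4[of "b \<omega>" "c \<omega>"] assms that by (force simp: unit_fields_def)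
  show "integrable M (\<lambda>\<omega>. norm (b \<omega> - c \<omega>))"
    using assms le by (intro integrable_const_bound[where B = 2] AE_I2
        strongly_measurable_norm strongly_measurable_diff) (auto simp: unit_fields_def)
qed

lemma (in finite_measure) unit_fields_pairing:
  assumes "f \<in> bochner_L1 M" and "b \<in> unit_fields M"
  shows "integrable M (\<lambda>\<omega>. b \<omega> (f \<omega>))"
  using bochner_L1_pairing(1)[OF assms(1), of b 1] assms(2) by (auto simp: unit_fields_def)

text \<open>Split \<open>f\<close> into a bounded simple part and a remainder small in mean. Two
  fields of norm at most 1 differ by at most 2 against the remainder, giving half of
  \<open>\<epsilon>\<close>, while against the bounded part the distance of the fields in mean
  counts, giving the other half.\<close>

lemma (in finite_measure) pairing_L1_continuous:
  fixes f :: "'a \<Rightarrow> 'e::banach"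
  assumes f: "f \<in> bochner_L1 M" and "\<epsilon> > 0"
  obtains \<rho> where "\<rho> > 0" and "\<And>b c. b \<in> unit_fields M \<Longrightarrow> c \<in> unit_fields M \<Longrightarrow>
    (LINT \<omega>|M. norm (b \<omega> - c \<omega>)) \<le> \<rho> \<Longrightarrow> \<bar>(LINT \<omega>|M. b \<omega> (f \<omega>)) - (LINT \<omega>|M. c \<omega> (f \<omega>))\<bar> \<le> \<epsilon>"
proof -
  obtain s where s: "simple_function M s" and fs: "(LINT \<omega>|M. norm (f \<omega> - s \<omega>)) < \<epsilon> / 4"
    using bochner_L1_approx[OF f, of "\<epsilon> / 4"] \<open>\<epsilon> > 0\<close> by auto
  obtain C where "C > 0" and C: "\<And>\<omega>. \<omega> \<in> space M \<Longrightarrow> norm (s \<omega>) \<le> C"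
    using simple_function_bounded[OF s] by blast
  show thesis
  proof (rule that)
    show "\<epsilon> / (2 * C) > 0" using \<open>\<epsilon> > 0\<close> \<open>C > 0\<close> by simp
    fix b c :: "'a \<Rightarrow> 'e \<Rightarrow>\<^sub>L real"
    assume b: "b \<in> unit_fields M" and c: "c \<in> unit_fields M"
      and d: "(LINT \<omega>|M. norm (b \<omega> - c \<omega>)) \<le> \<epsilon> / (2 * C)"
    have int_fs: "integrable M (\<lambda>\<omega>. norm (f \<omega> - s \<omega>))"
      using bochner_L1_diff[OF f bochner_L1_simple[OF s]] by (simp add: bochner_L1_iff)
    have int: "integrable M (\<lambda>\<omega>. 2 * norm (f \<omega> - s \<omega>) + C * norm (b \<omega> - c \<omega>))"
      using int_fs unit_fields_diff(1)[OF b c] by simp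
    have int_bc: "integrable M (\<lambda>\<omega>. b \<omega> (f \<omega>) - c \<omega> (f \<omega>))"
      using unit_fields_pairing[OF f b] unit_fields_pairing[OF f c] by simp
    have le: "\<bar>b \<omega> (f \<omega>) - c \<omega> (f \<omega>)\<bar> \<le> 2 * norm (f \<omega> - s \<omega>) + C * norm (b \<omega> - c \<omega>)"
      if \<omega>: "\<omega> \<in> space M" for \<omega>
    proof -
      have "\<bar>(b \<omega> - c \<omega>) (f \<omega> - s \<omega>)\<bar> \<le> 2 * norm (f \<omega> - s \<omega>)"
        using norm_blinfun[of "b \<omega> - c \<omega>" "f \<omega> - s \<omega>"]
          mult_right_mono[OF unit_fields_diff(2)[OF b c \<omega>] norm_ge_zero[of "f \<omega> - s \<omega>"]] by simp
      moreover have "\<bar>(b \<omega> - c \<omega>) (s \<omega>)\<bar> \<le> C * norm (b \<omega> - c \<omega>)"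
        using norm_blinfun[of "b \<omega> - c \<omega>" "s \<omega>"]
          mult_left_mono[OF C[OF \<omega>] norm_ge_zero[of "b \<omega> - c \<omega>"]] by (simp add: mult.commute)
      ultimately show ?thesis
        by (simp add: blinfun.diff_left blinfun.diff_right abs_le_iff)
    qed
    have "\<bar>LINT \<omega>|M. b \<omega> (f \<omega>) - c \<omega> (f \<omega>)\<bar> \<le> (LINT \<omega>|M. \<bar>b \<omega> (f \<omega>) - c \<omega> (f \<omega>)\<bar>)"
      using integral_norm_bound[of M "\<lambda>\<omega>. b \<omega> (f \<omega>) - c \<omega> (f \<omega>)"] by simp
    also have "\<dots> \<le> (LINT \<omega>|M. 2 * norm (f \<omega> - s \<omega>) + C * norm (b \<omega> - c \<omega>))"
      by (rule integral_mono[OF integrable_abs[OF int_bc] int le])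
    also have "\<dots> = 2 * (LINT \<omega>|M. norm (f \<omega> - s \<omega>)) + C * (LINT \<omega>|M. norm (b \<omega> - c \<omega>))"
      using int_fs unit_fields_diff(1)[OF b c] by simp
    also have "\<dots> \<le> 2 * (\<epsilon> / 4) + C * (\<epsilon> / (2 * C))"
      using fs d \<open>C > 0\<close> by (intro add_mono mult_left_mono) auto
    also have "\<dots> = \<epsilon>" using \<open>C > 0\<close> by simp
    finally show "\<bar>(LINT \<omega>|M. b \<omega> (f \<omega>)) - (LINT \<omega>|M. c \<omega> (f \<omega>))\<bar> \<le> \<epsilon>"
      using unit_fields_pairing[OF f b] unit_fields_pairing[OF f c] by simp
  qed
qed

text \<open>This is the completeness needed for the category argument. Radii that at least halve
  make the increments summable in mean, hence almost everywhere absolutely summable; the factor 2 is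
  the sum of the geometric series.\<close>

lemma (in finite_measure) simple_unit_fields_L1_limit:
  fixes b :: "nat \<Rightarrow> 'a \<Rightarrow> 'e::real_normed_vector \<Rightarrow>\<^sub>L real"
  assumes simple: "\<And>n. simple_function M (b n)" and unit: "\<And>n. b n \<in> unit_fields M"
    and close: "\<And>n. (LINT \<omega>|M. norm (b (Suc n) \<omega> - b n \<omega>)) \<le> \<rho> n"
    and \<rho>: "\<And>n. \<rho> (Suc n) \<le> \<rho> n / 2" "\<And>n. \<rho> n > 0"
  obtains c where "c \<in> unit_fields M" and "\<And>n. (LINT \<omega>|M. norm (c \<omega> - b n \<omega>)) \<le> 2 * \<rho> n"
proof -
  have norm_meas: "(\<lambda>\<omega>. norm (b m \<omega> - b n \<omega>)) \<in> borel_measurable M" for m n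
    using unit by (intro strongly_measurable_norm strongly_measurable_diff)
        (auto simp: unit_fields_def)
  \<comment> \<open>Subtracting \<open>2 * \<rho> m\<close> is what carries the induction: the next
    increment costs \<open>\<rho> m\<close>, and
    \<open>2 * \<rho> (Suc m) \<le> \<rho> m\<close>.\<close>
  have cauchy: "(LINT \<omega>|M. norm (b m \<omega> - b n \<omega>)) \<le> 2 * \<rho> n - 2 * \<rho> m" if "n \<le> m" for m n
    using that
  proof (induction m rule: dec_induct)
    case (step m)
    have "(LINT \<omega>|M. norm (b (Suc m) \<omega> - b n \<omega>))
        \<le> (LINT \<omega>|M. norm (b (Suc m) \<omega> - b m \<omega>) + norm (b m \<omega> - b n \<omega>))"
    proof (rule integral_mono)
      show "norm (b (Suc m) \<omega> - b n \<omega>) \<le> norm (b (Suc m) \<omega> - b m \<omega>) + norm (b m \<omega> - b n \<omega>)" for \<omega>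
        using norm_triangle_ineq[of "b (Suc m) \<omega> - b m \<omega>" "b m \<omega> - b n \<omega>"] by simp
    qed (intro unit_fields_diff(1) unit Bochner_Integration.integrable_add)+
    also have "\<dots> = (LINT \<omega>|M. norm (b (Suc m) \<omega> - b m \<omega>)) + (LINT \<omega>|M. norm (b m \<omega> - b n \<omega>))"
      using unit_fields_diff(1)[OF unit unit] by simp
    also have "\<dots> \<le> 2 * \<rho> n - 2 * \<rho> (Suc m)"
      using step.IH close[of m] \<rho>(1)[of m] by simp
    finally show ?case .
  qed simp
  define S where "S \<omega> = (\<Sum>n. ennreal (norm (b (Suc n) \<omega> - b n \<omega>)))" for \<omega>
  have S_meas[measurable]: "S \<in> borel_measurable M"
    unfolding S_def using norm_meas by measurable
  have "(\<integral>\<^sup>+ \<omega>. S \<omega> \<partial>M) = (\<Sum>n. ennreal (LINT \<omega>|M. norm (b (Suc n) \<omega> - b n \<omega>)))"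
    unfolding S_def using norm_meas
    by (subst nn_integral_suminf)
       (simp_all add: nn_integral_eq_integral[OF unit_fields_diff(1)[OF unit unit]])
  also have "\<dots> \<noteq> \<infinity>"
  proof -
    have "summable (\<lambda>n. LINT \<omega>|M. norm (b (Suc n) \<omega> - b n \<omega>))"
    proof (rule summable_comparison_test'[where N = 0])
      have "\<rho> n \<le> \<rho> 0 * (1 / 2) ^ n" for n
      proof (induction n)
        case (Suc n)
        then show ?case using \<rho>(1)[of n] by simp
      qed simp
      then show "norm (LINT \<omega>|M. norm (b (Suc n) \<omega> - b n \<omega>)) \<le> \<rho> 0 * (1 / 2) ^ n" for n
        using close[of n] by (simp add: order_trans)
      show "summable (\<lambda>n. \<rho> 0 * (1 / 2) ^ n)" by (intro summable_mult summable_geometric) simp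
    qed
    then show ?thesis by (simp add: suminf_ennreal_eq[OF _ summable_sums] )
  qed
  finally have "AE \<omega> in M. S \<omega> \<noteq> \<infinity>"
    by (intro nn_integral_PInf_AE) auto
  \<comment> \<open>Off the full set \<open>N\<close> the fields may diverge. Setting them to zero
    there makes the cut fields converge at every point of the space, as strong measurability
    requires.\<close>
  define N where "N = {\<omega> \<in> space M. S \<omega> \<noteq> \<infinity>}"
  have N: "N \<in> sets M" unfolding N_def by measurable
  define t where "t n \<omega> = indicat_real N \<omega> *\<^sub>R b n \<omega>" for n \<omega>
  define c where "c \<omega> = (if \<omega> \<in> N then lim (\<lambda>n. b n \<omega>) else 0)" for \<omega>
  have conv: "(\<lambda>n. b n \<omega>) \<longlonglongrightarrow> c \<omega>" if "\<omega> \<in> N" for \<omega>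
  proof -
    have "summable (\<lambda>n. norm (b (Suc n) \<omega> - b n \<omega>))"
      using that by (intro summable_suminf_not_top) (auto simp: N_def S_def)
    then have "convergent (\<lambda>n. \<Sum>i<n. b (Suc i) \<omega> - b i \<omega>)"
      unfolding summable_iff_convergent[symmetric] by (rule summable_norm_cancel)
    then have "convergent (\<lambda>n. b n \<omega> - b 0 \<omega>)"
      by (simp only: sum_lessThan_telescope[where f = "\<lambda>n. b n \<omega>"])
    from convergent_add[OF this convergent_const[of "b 0 \<omega>"]] have "convergent (\<lambda>n. b n \<omega>)"
      by simp
    with that show ?thesis by (simp add: c_def convergent_LIMSEQ_iff)
  qed
  have unit_b: "norm (b n \<omega>) \<le> 1" if "\<omega> \<in> space M" for n \<omega>
    using unit[of n] that by (simp add: unit_fields_def)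
  have c_meas: "strongly_measurable M c"
    unfolding strongly_measurable_def
  proof (intro exI[of _ t] conjI allI ballI)
    show "simple_function M (t n)" for n
      unfolding t_def by (intro simple_function_compose2[where h = scaleR]
          simple_function_indicator N simple)
    show "(\<lambda>n. t n \<omega>) \<longlonglongrightarrow> c \<omega>" for \<omega>
      using conv[of \<omega>] by (cases "\<omega> \<in> N") (auto simp: t_def c_def)
  qed
  have c_norm: "norm (c \<omega>) \<le> 1" if "\<omega> \<in> space M" for \<omega>
  proof (cases "\<omega> \<in> N")
    case True
    show ?thesis
      by (rule LIMSEQ_le_const2[OF tendsto_norm[OF conv[OF True]]]) (use unit_b[OF that] in auto)
  qed (simp add: c_def)
  have c: "c \<in> unit_fields M"
    using c_meas c_norm by (simp add: unit_fields_def)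
  show thesis
  proof (rule that[OF c])
    fix n
    have "(\<lambda>m. LINT \<omega>|M. norm (b m \<omega> - b n \<omega>)) \<longlonglongrightarrow> (LINT \<omega>|M. norm (c \<omega> - b n \<omega>))"
    proof (rule integral_dominated_convergence[where w = "\<lambda>_. 2"])
      show "(\<lambda>\<omega>. norm (c \<omega> - b n \<omega>)) \<in> borel_measurable M"
        by (rule borel_measurable_integrable[OF unit_fields_diff(1)[OF c unit]])
      show "AE \<omega> in M. (\<lambda>m. norm (b m \<omega> - b n \<omega>)) \<longlonglongrightarrow> norm (c \<omega> - b n \<omega>)"
        using \<open>AE \<omega> in M. S \<omega> \<noteq> \<infinity>\<close>
      proof (rule AE_mp[OF _ AE_I2], intro impI)
        fix \<omega> assume "\<omega> \<in> space M" "S \<omega> \<noteq> \<infinity>"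
        then have "\<omega> \<in> N" by (simp add: N_def)
        then show "(\<lambda>m. norm (b m \<omega> - b n \<omega>)) \<longlonglongrightarrow> norm (c \<omega> - b n \<omega>)"
          by (intro tendsto_intros conv)
      qed
      show "AE \<omega> in M. norm (norm (b m \<omega> - b n \<omega>)) \<le> 2" for m
        using unit_fields_diff(2)[OF unit unit] by (intro AE_I2) simp
    qed (use norm_meas in auto)
    then show "(LINT \<omega>|M. norm (c \<omega> - b n \<omega>)) \<le> 2 * \<rho> n"
    proof (rule LIMSEQ_le_const2)
      have "(LINT \<omega>|M. norm (b m \<omega> - b n \<omega>)) \<le> 2 * \<rho> n" if "m \<ge> n" for m
        using cauchy[OF that] \<rho>(2)[of m] by simp
      then show "\<exists>N. \<forall>m\<ge>N. (LINT \<omega>|M. norm (b m \<omega> - b n \<omega>)) \<le> 2 * \<rho> n" by blast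
    qed
  qed
qed

text \<open>The Baire category argument in the unit ball of essentially bounded fields under the
  \<open>L\<^sup>1\<close> metric, carried out by hand along simple functions.\<close>

lemma (in finite_measure) pairing_equicontinuous_at_some_point:
  fixes d :: "nat \<Rightarrow> 'a \<Rightarrow> 'e::banach"
  assumes d: "\<And>k. d k \<in> bochner_L1 M"
    and lim: "\<And>b. b \<in> unit_fields M \<Longrightarrow> (\<lambda>k. LINT \<omega>|M. b \<omega> (d k \<omega>)) \<longlonglongrightarrow> 0"
    and "\<epsilon> > 0"
  obtains b0 \<rho> n where "simple_function M b0" and "b0 \<in> unit_fields M" and "\<rho> > 0"
    and "\<And>b k. simple_function M b \<Longrightarrow> b \<in> unit_fields M \<Longrightarrow>
      (LINT \<omega>|M. norm (b \<omega> - b0 \<omega>)) < \<rho> \<Longrightarrow> k \<ge> n \<Longrightarrow> \<bar>LINT \<omega>|M. b \<omega> (d k \<omega>)\<bar> \<le> \<epsilon>"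
proof (rule ccontr)
  note pick = that
  assume neg: "\<not> thesis"
  have step: "\<exists>b k. simple_function M b \<and> b \<in> unit_fields M \<and>
      (LINT \<omega>|M. norm (b \<omega> - b0 \<omega>)) < \<rho> \<and> k \<ge> n \<and> \<epsilon> < \<bar>LINT \<omega>|M. b \<omega> (d k \<omega>)\<bar>"
    if "simple_function M b0" "b0 \<in> unit_fields M" "\<rho> > 0" for b0 \<rho> n
  proof (rule ccontr)
    assume none: "\<not> ?thesis"
    have thesis
    proof (rule pick[OF that])
      fix b k
      assume "simple_function M b" "b \<in> unit_fields M" "(LINT \<omega>|M. norm (b \<omega> - b0 \<omega>)) < \<rho>" "k \<ge> n"
      with none show "\<bar>LINT \<omega>|M. b \<omega> (d k \<omega>)\<bar> \<le> \<epsilon>" by (meson not_less)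
    qed
    with neg show False by contradiction
  qed
  \<comment> \<open>The radius \<open>2 * \<rho>\<close> is the distance at which the limit field
    will remain from this stage, so that its pairing with \<open>d k\<close> stays within
    \<open>\<epsilon> / 2\<close> of the pairing of \<open>b\<close>.\<close>
  define good where "good b k \<rho> \<longleftrightarrow> simple_function M b \<and> b \<in> unit_fields M \<and> \<rho> > 0 \<and>
    (\<forall>c\<in>unit_fields M. (LINT \<omega>|M. norm (c \<omega> - b \<omega>)) \<le> 2 * \<rho> \<longrightarrow>
      \<bar>(LINT \<omega>|M. c \<omega> (d k \<omega>)) - (LINT \<omega>|M. b \<omega> (d k \<omega>))\<bar> \<le> \<epsilon> / 2)"
    for b :: "'a \<Rightarrow> 'e \<Rightarrow>\<^sub>L real" and k :: nat and \<rho> :: real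
  have radius: "\<exists>\<rho>\<le>r. good b k \<rho>"
    if "simple_function M b" "b \<in> unit_fields M" "r > 0" for b k r
  proof -
    have "\<epsilon> / 2 > 0" using \<open>\<epsilon> > 0\<close> by simp
    from pairing_L1_continuous[OF d[of k] this] obtain \<rho> where "\<rho> > 0"
      and \<rho>: "\<And>b c. b \<in> unit_fields M \<Longrightarrow> c \<in> unit_fields M \<Longrightarrow>
        (LINT \<omega>|M. norm (b \<omega> - c \<omega>)) \<le> \<rho> \<Longrightarrow>
        \<bar>(LINT \<omega>|M. b \<omega> (d k \<omega>)) - (LINT \<omega>|M. c \<omega> (d k \<omega>))\<bar> \<le> \<epsilon> / 2"
      by blast
    have "good b k (min r (\<rho> / 2))"
      using that \<open>\<rho> > 0\<close> \<rho>[OF _ that(2)] by (simp add: good_def)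
    then show ?thesis by (intro exI[of _ "min r (\<rho> / 2)"]) simp
  qed
  define P where "P x \<longleftrightarrow> good (fst x) (fst (snd x)) (snd (snd x))" for x
  define Q where "Q x y \<longleftrightarrow> (LINT \<omega>|M. norm (fst y \<omega> - fst x \<omega>)) < snd (snd x) \<and>
      snd (snd y) \<le> snd (snd x) / 2 \<and> fst (snd x) < fst (snd y) \<and>
      \<epsilon> < \<bar>LINT \<omega>|M. blinfun_apply (fst y \<omega>) (d (fst (snd y)) \<omega>)\<bar>"
    for x y :: "('a \<Rightarrow> 'e \<Rightarrow>\<^sub>L real) \<times> nat \<times> real"
  have init: "\<exists>x. P x"
  proof -
    have zero: "simple_function M (\<lambda>_. 0 :: 'e \<Rightarrow>\<^sub>L real)" by simp
    then have "(\<lambda>_. 0 :: 'e \<Rightarrow>\<^sub>L real) \<in> unit_fields M"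
      by (simp add: unit_fields_def strongly_measurable_simple_function)
    from radius[OF zero this, of 1 0] obtain \<rho> where "good (\<lambda>_. 0) 0 \<rho>" by auto
    then show ?thesis by (intro exI[of _ "(\<lambda>_. 0, 0, \<rho>)"]) (simp add: P_def)
  qed
  have extend: "\<exists>y. P y \<and> Q x y" if "P x" for x
  proof -
    have "simple_function M (fst x)" "fst x \<in> unit_fields M" "snd (snd x) > 0"
      using that by (auto simp: P_def good_def)
    from step[OF this, of "Suc (fst (snd x))"] obtain b k where
      b: "simple_function M b" "b \<in> unit_fields M" "(LINT \<omega>|M. norm (b \<omega> - fst x \<omega>)) < snd (snd x)"
      and k: "k \<ge> Suc (fst (snd x))" "\<epsilon> < \<bar>LINT \<omega>|M. blinfun_apply (b \<omega>) (d k \<omega>)\<bar>" by blast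
    obtain \<rho> where "\<rho> \<le> snd (snd x) / 2" "good b k \<rho>"
      using radius[OF b(1,2), of "snd (snd x) / 2" k] \<open>snd (snd x) > 0\<close> by auto
    with b k show ?thesis by (intro exI[of _ "(b, k, \<rho>)"]) (simp add: P_def Q_def)
  qed
  obtain x where x: "\<And>n. P (x n)" "\<And>n. Q (x n) (x (Suc n))"
    using dependent_nat_choice[of "\<lambda>_. P" "\<lambda>_. Q"] init extend by blast
  define b where "b n = fst (x n)" for n
  define k where "k n = fst (snd (x n))" for n
  define \<rho> where "\<rho> n = snd (snd (x n))" for n
  have P: "simple_function M (b n)" "b n \<in> unit_fields M" "\<rho> n > 0"
    "\<And>c. c \<in> unit_fields M \<Longrightarrow> (LINT \<omega>|M. norm (c \<omega> - b n \<omega>)) \<le> 2 * \<rho> n \<Longrightarrow>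
      \<bar>(LINT \<omega>|M. c \<omega> (d (k n) \<omega>)) - (LINT \<omega>|M. b n \<omega> (d (k n) \<omega>))\<bar> \<le> \<epsilon> / 2" for n
    using x(1)[of n] by (simp_all add: P_def good_def b_def k_def \<rho>_def)
  have Q: "(LINT \<omega>|M. norm (b (Suc n) \<omega> - b n \<omega>)) < \<rho> n" "\<rho> (Suc n) \<le> \<rho> n / 2" "k n < k (Suc n)"
    "\<epsilon> < \<bar>LINT \<omega>|M. b (Suc n) \<omega> (d (k (Suc n)) \<omega>)\<bar>" for n
    using x(2)[of n] by (simp_all add: Q_def b_def k_def \<rho>_def)
  obtain c where c: "c \<in> unit_fields M" "\<And>n. (LINT \<omega>|M. norm (c \<omega> - b n \<omega>)) \<le> 2 * \<rho> n"
    using simple_unit_fields_L1_limit[of b \<rho>, OF P(1,2) less_imp_le[OF Q(1)] Q(2) P(3)] by blast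
  have "strict_mono k" using Q(3) by (rule strict_monoI_Suc)
  have "(\<lambda>n. LINT \<omega>|M. c \<omega> (d (k n) \<omega>)) \<longlonglongrightarrow> 0"
    using LIMSEQ_subseq_LIMSEQ[OF lim[OF c(1)] \<open>strict_mono k\<close>] by (simp add: o_def)
  then have "\<forall>\<^sub>F n in sequentially. \<bar>LINT \<omega>|M. c \<omega> (d (k n) \<omega>)\<bar> < \<epsilon> / 2"
    using \<open>\<epsilon> > 0\<close> tendstoD[of "\<lambda>n. LINT \<omega>|M. c \<omega> (d (k n) \<omega>)" 0 sequentially "\<epsilon> / 2"]
    by (simp add: dist_real_def)
  \<comment> \<open>The index is \<open>Suc n\<close> because \<open>Q\<close> makes the pairing
    exceed \<open>\<epsilon>\<close> only from the second stage on. At that stage the limit field is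
    still above \<open>\<epsilon> / 2\<close>, against its convergence to zero.\<close>
  then obtain n where "\<bar>LINT \<omega>|M. c \<omega> (d (k (Suc n)) \<omega>)\<bar> < \<epsilon> / 2"
    by (meson eventually_sequentially le_Suc_eq order_refl)
  with P(4)[OF c(1) c(2), of "Suc n"] Q(4)[of n] show False by linarith
qed

text \<open>Uniform integrability. Boundedness in mean is a conjunct of its own, since on an atom of
  large measure uniform absolute continuity says nothing about the size of the functions.\<close>

definition equi_integrable :: "'w measure \<Rightarrow> (nat \<Rightarrow> 'w \<Rightarrow> real) \<Rightarrow> bool" where
  "equi_integrable M h \<longleftrightarrow> (\<exists>R. \<forall>k. (LINT \<omega>|M. \<bar>h k \<omega>\<bar>) \<le> R) \<and>
    (\<forall>\<epsilon>>0. \<exists>\<delta>>0. \<forall>k. \<forall>A\<in>sets M. measure M A < \<delta> \<longrightarrow>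
      (LINT \<omega>|M. indicator A \<omega> * \<bar>h k \<omega>\<bar>) \<le> \<epsilon>)"

text \<open>A simple approximant is bounded, so its contribution is at most a constant times the
  measure. The lemma serves single functions: finitely many early terms of a sequence, and the bound
  \<open>\<phi>\<close> of an integrand.\<close>

lemma (in finite_measure) bochner_L1_absolutely_continuous:
  fixes f :: "'a \<Rightarrow> 'e::banach"
  assumes f: "f \<in> bochner_L1 M" and "\<epsilon> > 0"
  obtains \<delta> where "\<delta> > 0"
    and "\<And>A. A \<in> sets M \<Longrightarrow> measure M A < \<delta> \<Longrightarrow> (LINT \<omega>|M. indicator A \<omega> * norm (f \<omega>)) \<le> \<epsilon>"
proof -
  obtain s where s: "simple_function M s" and fs: "(LINT \<omega>|M. norm (f \<omega> - s \<omega>)) < \<epsilon> / 2"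
    using bochner_L1_approx[OF f, of "\<epsilon> / 2"] \<open>\<epsilon> > 0\<close> by auto
  obtain C where "C > 0" and C: "\<And>\<omega>. \<omega> \<in> space M \<Longrightarrow> norm (s \<omega>) \<le> C"
    using simple_function_bounded[OF s] by blast
  show thesis
  proof (rule that)
    show "\<epsilon> / (2 * C) > 0" using \<open>\<epsilon> > 0\<close> \<open>C > 0\<close> by simp
    fix A assume A: "A \<in> sets M" "measure M A < \<epsilon> / (2 * C)"
    have int_f: "integrable M (\<lambda>\<omega>. indicator A \<omega> * norm (f \<omega>))"
      using integrable_mult_indicator[OF A(1), of "\<lambda>\<omega>. norm (f \<omega>)"] f by (simp add: bochner_L1_iff)
    have int_fs: "integrable M (\<lambda>\<omega>. norm (f \<omega> - s \<omega>))"
      using bochner_L1_diff[OF f bochner_L1_simple[OF s]] by (simp add: bochner_L1_iff)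
    have int_A: "integrable M (indicat_real A)"
      using A(1) by (simp add: integrable_real_indicator less_top[symmetric])
    have "(LINT \<omega>|M. indicator A \<omega> * norm (f \<omega>)) \<le>
        (LINT \<omega>|M. norm (f \<omega> - s \<omega>) + C * indicator A \<omega>)"
    proof (rule integral_mono[OF int_f])
      show "integrable M (\<lambda>\<omega>. norm (f \<omega> - s \<omega>) + C * indicat_real A \<omega>)"
        using int_fs int_A by simp
      fix \<omega> assume "\<omega> \<in> space M"
      then have "norm (f \<omega>) \<le> norm (f \<omega> - s \<omega>) + C"
        using norm_triangle_sub[of "f \<omega>" "s \<omega>"] C[of \<omega>] by simp
      then show "indicat_real A \<omega> * norm (f \<omega>) \<le> norm (f \<omega> - s \<omega>) + C * indicat_real A \<omega>"
        by (simp add: indicator_def)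
    qed
    also have "\<dots> = (LINT \<omega>|M. norm (f \<omega> - s \<omega>)) + C * measure M A"
      using int_fs int_A A(1) by simp
    also have "\<dots> \<le> \<epsilon> / 2 + C * (\<epsilon> / (2 * C))"
      using fs A(2) \<open>C > 0\<close> by (intro add_mono mult_left_mono) auto
    also have "\<dots> = \<epsilon>" using \<open>C > 0\<close> by simp
    finally show "(LINT \<omega>|M. indicator A \<omega> * norm (f \<omega>)) \<le> \<epsilon>" .
  qed
qed

text \<open>The uniform estimate near some unknown field \<open>b0\<close> is transported to zero by
  taking differences: two small modifications of \<open>b0\<close>, one towards \<open>c\<close> and
  one towards zero on \<open>A\<close>, differ exactly by a multiple of \<open>c\<close> on
  \<open>A\<close>. Taking \<open>c\<close> almost norming for \<open>d k\<close> recovers the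
  norm.\<close>

lemma (in prob_space) weakly_null_equi_integrable:
  fixes d :: "nat \<Rightarrow> 'a \<Rightarrow> 'e::banach"
  assumes d: "\<And>k. d k \<in> bochner_L1 M"
    and lim: "\<And>b. b \<in> unit_fields M \<Longrightarrow> (\<lambda>k. LINT \<omega>|M. b \<omega> (d k \<omega>)) \<longlonglongrightarrow> 0"
  shows "equi_integrable M (\<lambda>k \<omega>. norm (d k \<omega>))"
proof -
  have norming: "\<exists>c::'e \<Rightarrow>\<^sub>L real. norm c \<le> 1 \<and> blinfun_apply c v \<ge> norm v - e"
    if "e > 0" for e and v :: 'e
  proof -
    obtain c :: "'e \<Rightarrow>\<^sub>L real" where "norm c \<le> 1" "blinfun_apply c v = norm v"
      by (rule norming_functional)
    with that show ?thesis by (intro exI[of _ c]) simp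
  qed
  have pairing: "bounded_bilinear (\<lambda>v (c :: 'e \<Rightarrow>\<^sub>L real). blinfun_apply c v)"
    by (rule bounded_bilinear.flip[OF bounded_bilinear_blinfun_apply])
  have pairing_le: "\<bar>blinfun_apply c v\<bar> \<le> norm v * norm c" for v and c :: "'e \<Rightarrow>\<^sub>L real"
    using norm_blinfun[of c v] by (simp add: mult.commute)
  have norm_le: "(LINT \<omega>|M. indicator A \<omega> * norm (d k \<omega>)) \<le> K"
    if "A \<in> sets M" and "\<And>c. simple_function M c \<Longrightarrow> (\<And>\<omega>. norm (c \<omega>) \<le> 1) \<Longrightarrow>
      (LINT \<omega>|M. indicator A \<omega> * blinfun_apply (c \<omega>) (d k \<omega>)) \<le> K" for A K k
    by (rule set_integral_norm_le_by_simple[where B = "\<lambda>v c. blinfun_apply c v",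
          OF d that(1) pairing pairing_le norming that(2)])
  \<comment> \<open>One estimate covers both halves of equi-integrability: \<open>t = 1\<close> with
    \<open>A\<close> small gives uniform absolute continuity, and \<open>A\<close> the whole space
    with \<open>t\<close> small gives boundedness in mean.\<close>
  have key: "\<exists>\<rho>>0. \<exists>n. \<forall>t A k. 0 < t \<longrightarrow> t \<le> 1 \<longrightarrow> A \<in> sets M \<longrightarrow> 2 * t * measure M A < \<rho> \<longrightarrow> n \<le> k \<longrightarrow>
      (LINT \<omega>|M. indicator A \<omega> * norm (d k \<omega>)) \<le> 2 * \<epsilon> / t" if "\<epsilon> > 0" for \<epsilon> :: real
  proof (rule pairing_equicontinuous_at_some_point[of d, OF d lim that])
    fix b0 :: "'a \<Rightarrow> 'e \<Rightarrow>\<^sub>L real" and \<rho> n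
    assume b0: "simple_function M b0" "b0 \<in> unit_fields M" and "\<rho> > 0"
      and small: "\<And>b k. simple_function M b \<Longrightarrow> b \<in> unit_fields M \<Longrightarrow>
        (LINT \<omega>|M. norm (b \<omega> - b0 \<omega>)) < \<rho> \<Longrightarrow> k \<ge> n \<Longrightarrow> \<bar>LINT \<omega>|M. b \<omega> (d k \<omega>)\<bar> \<le> \<epsilon>"
    have b0_le: "norm (b0 \<omega>) \<le> 1" if "\<omega> \<in> space M" for \<omega>
      using b0(2) that by (simp add: unit_fields_def)
    have "(LINT \<omega>|M. indicator A \<omega> * norm (d k \<omega>)) \<le> 2 * \<epsilon> / t"
      if t: "0 < t" "t \<le> 1" and A: "A \<in> sets M" "2 * t * measure M A < \<rho>" and "n \<le> k" for t A k
    proof (rule norm_le[OF A(1)])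
      \<comment> \<open>Convexity keeps the field in the unit ball, and since it moves by the
        fraction \<open>t\<close> and only on \<open>A\<close>, its distance from \<open>b0\<close>
        in mean is at most \<open>2 * t * measure M A\<close>.\<close>
      define p where "p c \<omega> = (if \<omega> \<in> A then (1 - t) *\<^sub>R b0 \<omega> + t *\<^sub>R c \<omega> else b0 \<omega>)"
        for c :: "'a \<Rightarrow> 'e \<Rightarrow>\<^sub>L real" and \<omega>
      have p: "p c \<in> unit_fields M" "\<bar>LINT \<omega>|M. p c \<omega> (d k \<omega>)\<bar> \<le> \<epsilon>"
        if c: "simple_function M c" "\<And>\<omega>. norm (c \<omega>) \<le> 1" for c
      proof -
        have simple: "simple_function M (p c)"
          unfolding p_def[abs_def] using A(1)
          by (intro simple_function_If_set simple_function_compose2[OF b0(1) c(1)] b0(1)) auto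
        have "norm (p c \<omega>) \<le> 1" if \<omega>: "\<omega> \<in> space M" for \<omega>
        proof -
          have "norm ((1 - t) *\<^sub>R b0 \<omega> + t *\<^sub>R c \<omega>) \<le> (1 - t) * norm (b0 \<omega>) + t * norm (c \<omega>)"
            using norm_triangle_ineq[of "(1 - t) *\<^sub>R b0 \<omega>" "t *\<^sub>R c \<omega>"] t by simp
          also have "\<dots> \<le> (1 - t) * 1 + t * 1"
            using b0_le[OF \<omega>] c(2)[of \<omega>] t by (intro add_mono mult_left_mono) auto
          finally show ?thesis using b0_le[OF \<omega>] by (simp add: p_def)
        qed
        then show unit: "p c \<in> unit_fields M"
          by (simp add: unit_fields_def strongly_measurable_simple_function[OF simple])
        have "(LINT \<omega>|M. norm (p c \<omega> - b0 \<omega>)) \<le> (LINT \<omega>|M. 2 * t * indicator A \<omega>)"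
        proof (rule integral_mono)
          show "integrable M (\<lambda>\<omega>. norm (p c \<omega> - b0 \<omega>))" by (rule unit_fields_diff(1)[OF unit b0(2)])
          have "integrable M (indicat_real A)"
            using A(1) by (simp add: integrable_real_indicator less_top[symmetric])
          then show "integrable M (\<lambda>\<omega>. 2 * t * indicat_real A \<omega>)" by simp
          fix \<omega> assume \<omega>: "\<omega> \<in> space M"
          have "p c \<omega> - b0 \<omega> = (t * indicator A \<omega>) *\<^sub>R (c \<omega> - b0 \<omega>)"
            by (simp add: p_def algebra_simps)
          moreover have "norm (c \<omega> - b0 \<omega>) \<le> 2"
            using norm_triangle_ineq4[of "c \<omega>" "b0 \<omega>"] c(2)[of \<omega>] b0_le[OF \<omega>] by linarith
          ultimately show "norm (p c \<omega> - b0 \<omega>) \<le> 2 * t * indicator A \<omega>"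
            using t by (simp add: indicator_def)
        qed
        also have "\<dots> = 2 * t * measure M A" using A(1) by simp
        finally show "\<bar>LINT \<omega>|M. p c \<omega> (d k \<omega>)\<bar> \<le> \<epsilon>"
          using A(2) by (intro small[OF simple unit _ \<open>n \<le> k\<close>]) linarith
      qed
      fix c :: "'a \<Rightarrow> 'e \<Rightarrow>\<^sub>L real"
      assume c: "simple_function M c" "\<And>\<omega>. norm (c \<omega>) \<le> 1"
      have zero: "simple_function M (\<lambda>_. 0 :: 'e \<Rightarrow>\<^sub>L real)" "\<And>\<omega>. norm (0 :: 'e \<Rightarrow>\<^sub>L real) \<le> 1"
        by auto
      have "t * (LINT \<omega>|M. indicator A \<omega> * c \<omega> (d k \<omega>)) =
          (LINT \<omega>|M. p c \<omega> (d k \<omega>) - p (\<lambda>_. 0) \<omega> (d k \<omega>))"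
        unfolding integral_mult_right_zero[symmetric]
        by (intro Bochner_Integration.integral_cong)
           (auto simp: p_def blinfun.add_left blinfun.scaleR_left)
      also have "\<dots> = (LINT \<omega>|M. p c \<omega> (d k \<omega>)) - (LINT \<omega>|M. p (\<lambda>_. 0) \<omega> (d k \<omega>))"
        by (intro Bochner_Integration.integral_diff unit_fields_pairing[OF d p(1)[OF c]]
            unit_fields_pairing[OF d p(1)[OF zero]])
      also have "\<dots> \<le> 2 * \<epsilon>" using p(2)[OF c] p(2)[OF zero] by linarith
      finally show "(LINT \<omega>|M. indicator A \<omega> * c \<omega> (d k \<omega>)) \<le> 2 * \<epsilon> / t"
        using t(1) by (simp add: field_simps)
    qed
    with \<open>\<rho> > 0\<close> show ?thesis by blast
  qed
  have "\<exists>R. \<forall>k. (LINT \<omega>|M. norm (d k \<omega>)) \<le> R"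
  proof -
    obtain \<rho> n where "\<rho> > 0" and le: "\<forall>t A k. 0 < t \<longrightarrow> t \<le> 1 \<longrightarrow> A \<in> sets M \<longrightarrow>
        2 * t * measure M A < \<rho> \<longrightarrow> n \<le> k \<longrightarrow> (LINT \<omega>|M. indicator A \<omega> * norm (d k \<omega>)) \<le> 2 * 1 / t"
      using key[OF zero_less_one] by blast
    \<comment> \<open>With total mass 1 this gives \<open>2 * t \<le> \<rho> / 2 < \<rho>\<close>,
      so the whole space is admissible in \<open>le\<close>.\<close>
    define t where "t = min 1 (\<rho> / 4)"
    have t: "t > 0" "t \<le> 1" "2 * t * measure M (space M) < \<rho>"
      using \<open>\<rho> > 0\<close> by (auto simp: t_def min_def prob_space)
    have "(LINT \<omega>|M. indicator (space M) \<omega> * norm (d k \<omega>)) = (LINT \<omega>|M. norm (d k \<omega>))" for k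
      by (rule Bochner_Integration.integral_cong) auto
    then have "(LINT \<omega>|M. norm (d k \<omega>)) \<le> 2 / t" if "k \<ge> n" for k
      using le t that by force
    then have "(LINT \<omega>|M. norm (d k \<omega>)) \<le> max (2 / t) (Max ((\<lambda>k. LINT \<omega>|M. norm (d k \<omega>)) ` {..n}))"
      for k
      by (cases "k \<ge> n") (auto simp: le_max_iff_disj)
    then show ?thesis by blast
  qed
  moreover have "\<exists>\<delta>>0. \<forall>k. \<forall>A\<in>sets M. measure M A < \<delta> \<longrightarrow>
      (LINT \<omega>|M. indicator A \<omega> * norm (d k \<omega>)) \<le> \<epsilon>" if "\<epsilon> > 0" for \<epsilon> :: real
  proof -
    obtain \<rho> n where "\<rho> > 0" and le: "\<forall>t A k. 0 < t \<longrightarrow> t \<le> 1 \<longrightarrow> A \<in> sets M \<longrightarrow>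
        2 * t * measure M A < \<rho> \<longrightarrow> n \<le> k \<longrightarrow>
        (LINT \<omega>|M. indicator A \<omega> * norm (d k \<omega>)) \<le> 2 * (\<epsilon> / 2) / t"
      using key[OF half_gt_zero[OF \<open>\<epsilon> > 0\<close>]] by blast
    have large: "(LINT \<omega>|M. indicator A \<omega> * norm (d k \<omega>)) \<le> \<epsilon>"
      if "A \<in> sets M" "measure M A < \<rho> / 2" "n \<le> k" for k A
      using le[rule_format, of 1 A k] that by simp
    have "\<exists>\<delta>>0. \<forall>A\<in>sets M. measure M A < \<delta> \<longrightarrow>
        (LINT \<omega>|M. indicator A \<omega> * norm (d k \<omega>)) \<le> \<epsilon>" for k
      by (rule bochner_L1_absolutely_continuous[OF d[of k] \<open>\<epsilon> > 0\<close>]) blast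
    then have "\<forall>k. \<exists>\<delta>. \<delta> > 0 \<and> (\<forall>A\<in>sets M. measure M A < \<delta> \<longrightarrow>
        (LINT \<omega>|M. indicator A \<omega> * norm (d k \<omega>)) \<le> \<epsilon>)" by blast
    from choice[OF this] obtain \<delta> where \<delta>: "\<And>k. \<delta> k > 0" "\<And>k A. A \<in> sets M \<Longrightarrow> measure M A < \<delta> k \<Longrightarrow>
        (LINT \<omega>|M. indicator A \<omega> * norm (d k \<omega>)) \<le> \<epsilon>" by blast
    \<comment> \<open>\<open>key\<close> says nothing about indices below \<open>n\<close>; these
      are finitely many, and each has its own modulus of absolute continuity.\<close>
    define \<delta>' where "\<delta>' = min (\<rho> / 2) (Min (\<delta> ` {..n}))"
    have "\<delta>' > 0" using \<open>\<rho> > 0\<close> \<delta>(1) by (simp add: \<delta>'_def)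
    moreover have "(LINT \<omega>|M. indicator A \<omega> * norm (d k \<omega>)) \<le> \<epsilon>"
      if "A \<in> sets M" "measure M A < \<delta>'" for k A
    proof (cases "k \<ge> n")
      case True
      then show ?thesis using large[OF that(1) _ True] that(2) by (simp add: \<delta>'_def)
    next
      case False
      then show ?thesis using \<delta>(2)[OF that(1), of k] that(2) by (simp add: \<delta>'_def)
    qed
    ultimately show ?thesis by blast
  qed
  ultimately show ?thesis by (simp add: equi_integrable_def)
qed

section \<open>The sequential Bocce criterion and convergence in mean\<close>

text \<open>The ordering principle of Brezis and Browder. It asks for upper bounds of sequences
  only, whereas Zorn's lemma would ask for all chains; pseudo-intersections of index sets exist only
  along sequences. Each step gains at least half of what can still be gained for
  \<open>\<phi>\<close>.\<close>

lemma brezis_browder: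
  fixes \<phi> :: "'x \<Rightarrow> real"
  assumes "x0 \<in> X" and refl: "\<And>x. x \<in> X \<Longrightarrow> R x x"
    and trans: "\<And>x y z. R x y \<Longrightarrow> R y z \<Longrightarrow> R x z"
    and mono: "\<And>x y. x \<in> X \<Longrightarrow> y \<in> X \<Longrightarrow> R x y \<Longrightarrow> \<phi> x \<le> \<phi> y"
    and bound: "\<And>x. x \<in> X \<Longrightarrow> \<phi> x \<le> K"
    and chain: "\<And>s. (\<And>n. s n \<in> X) \<Longrightarrow> (\<And>n. R (s n) (s (Suc n))) \<Longrightarrow> \<exists>u\<in>X. \<forall>n::nat. R (s n) u"
  obtains u where "u \<in> X" and "R x0 u" and "\<And>y. y \<in> X \<Longrightarrow> R u y \<Longrightarrow> \<phi> y \<le> \<phi> u"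
proof -
  have step: "\<exists>y\<in>X. R x y \<and> (\<forall>z\<in>X. R x z \<longrightarrow> \<phi> x + \<phi> z \<le> 2 * \<phi> y)" if "x \<in> X" for x
  proof -
    define V where "V = \<phi> ` {z \<in> X. R x z}"
    have "\<phi> x \<in> V" using that refl by (auto simp: V_def)
    have bdd: "bdd_above V" using bound by (intro bdd_aboveI[where M = K]) (auto simp: V_def)
    have "\<exists>y\<in>V. (\<phi> x + Sup V) / 2 \<le> y"
    proof (cases "Sup V \<le> \<phi> x")
      case True
      with \<open>\<phi> x \<in> V\<close> show ?thesis by (intro bexI[of _ "\<phi> x"]) auto
    next
      case False
      then have "(\<phi> x + Sup V) / 2 < Sup V" by simp
      with less_cSupD[of V] \<open>\<phi> x \<in> V\<close> obtain y where "y \<in> V" "(\<phi> x + Sup V) / 2 < y" by blast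
      then show ?thesis by (intro bexI[of _ y] less_imp_le)
    qed
    then obtain y where y: "y \<in> X" "R x y" "(\<phi> x + Sup V) / 2 \<le> \<phi> y" by (auto simp: V_def)
    have "\<phi> z \<le> Sup V" if "z \<in> X" "R x z" for z
      using that by (intro cSup_upper bdd) (auto simp: V_def)
    then have "\<phi> x + \<phi> z \<le> 2 * \<phi> y" if "z \<in> X" "R x z" for z
      using y(3) that by fastforce
    with y(1,2) show ?thesis by blast
  qed
  define P where "P x \<longleftrightarrow> x \<in> X \<and> R x0 x" for x
  define Q where "Q x y \<longleftrightarrow> R x y \<and> (\<forall>z\<in>X. R x z \<longrightarrow> \<phi> x + \<phi> z \<le> 2 * \<phi> y)" for x y
  have "\<exists>s. \<forall>n. P (s n) \<and> Q (s n) (s (Suc n))"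
  proof (rule dependent_nat_choice[of "\<lambda>_. P" "\<lambda>_. Q"])
    show "\<exists>x. P x" using assms(1) refl by (auto simp: P_def)
    show "\<exists>y. P y \<and> Q x y" if x: "P x" for x
    proof -
      from x have "x \<in> X" "R x0 x" by (auto simp: P_def)
      from step[OF this(1)] obtain y where "y \<in> X" "R x y" "\<forall>z\<in>X. R x z \<longrightarrow> \<phi> x + \<phi> z \<le> 2 * \<phi> y"
        by blast
      with trans[OF \<open>R x0 x\<close> \<open>R x y\<close>] show ?thesis by (auto simp: P_def Q_def)
    qed
  qed
  then obtain s where s: "\<And>n. s n \<in> X" "\<And>n. R x0 (s n)" "\<And>n. R (s n) (s (Suc n))"
    and half: "\<And>n z. z \<in> X \<Longrightarrow> R (s n) z \<Longrightarrow> \<phi> (s n) + \<phi> z \<le> 2 * \<phi> (s (Suc n))"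
    by (auto simp: P_def Q_def)
  obtain u where u: "u \<in> X" "\<And>n. R (s n) u" using chain[of s, OF s(1,3)] by blast
  have "incseq (\<lambda>n. \<phi> (s n))" using mono s by (intro incseq_SucI) blast
  moreover have "\<forall>n. \<phi> (s n) \<le> K" using bound s(1) by blast
  ultimately have "convergent (\<lambda>n. \<phi> (s n))"
    by (rule incseq_convergent) (auto simp: convergent_def)
  then obtain L where L: "(\<lambda>n. \<phi> (s n)) \<longlonglongrightarrow> L" by (auto simp: convergent_def)
  show thesis
  proof (rule that[OF u(1) trans[OF s(2) u(2)]])
    fix y assume y: "y \<in> X" "R u y"
    \<comment> \<open>Any \<open>y\<close> above \<open>u\<close> competes at every stage. Passing
      to the limit in the halving inequality \<open>half\<close> leaves
      \<open>\<phi> y \<le> L\<close>, and \<open>L \<le> \<phi> u\<close> by monotonicity.\<close>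
    have "(\<lambda>n. \<phi> (s n) + \<phi> y) \<longlonglongrightarrow> L + \<phi> y" by (intro tendsto_intros L)
    moreover have "(\<lambda>n. 2 * \<phi> (s (Suc n))) \<longlonglongrightarrow> 2 * L"
      by (intro tendsto_intros LIMSEQ_Suc[OF L])
    ultimately have "L + \<phi> y \<le> 2 * L"
      by (rule LIMSEQ_le) (use half[OF y(1) trans[OF u(2) y(2)]] in blast)
    moreover have "L \<le> \<phi> u"
      using mono[OF s(1) u(1) u(2)] by (intro LIMSEQ_le_const2[OF L]) auto
    ultimately show "\<phi> y \<le> \<phi> u" by simp
  qed
qed

text \<open>A diagonal sequence whose term \<open>j n\<close> lies in the first sets up to
  \<open>n\<close>. Finite intersections stay infinite because every \<open>J n\<close> differs from
  the intersection \<open>K n\<close> by finitely many indices.\<close>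

lemma pseudo_intersection:
  fixes J :: "nat \<Rightarrow> nat set"
  assumes inf: "\<And>n. infinite (J n)" and fin: "\<And>n. finite (J (Suc n) - J n)"
  obtains I where "infinite I" and "\<And>n. finite (I - J n)"
proof -
  define K where "K n = (\<Inter>i\<le>n. J i)" for n
  have diff: "finite (J n - K n)" for n
  proof (induction n)
    case (Suc n)
    have "J (Suc n) - K (Suc n) \<subseteq> (J (Suc n) - J n) \<union> (J n - K n)"
      by (auto simp: K_def atMost_Suc)
    with fin[of n] Suc show ?case by (auto intro: finite_subset)
  qed (simp add: K_def)
  have infK: "infinite (K n)" for n
    using diff[of n] inf[of n] by (meson finite_Diff2)
  have "\<exists>j. \<forall>n. j n \<in> K n \<and> j n < j (Suc n)"
  proof (rule dependent_nat_choice[of "\<lambda>n j. j \<in> K n" "\<lambda>_ i j. i < j"])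
    show "\<exists>j. j \<in> K 0" using infK[of 0] by (metis ex_in_conv finite.emptyI)
    show "\<exists>i. i \<in> K (Suc n) \<and> j < i" for j n
      using infK[of "Suc n"] unfolding infinite_nat_iff_unbounded by blast
  qed
  then obtain j where j: "\<And>n. j n \<in> K n" "\<And>n. j n < j (Suc n)" by blast
  have "strict_mono j" using j(2) by (rule strict_monoI_Suc)
  show thesis
  proof (rule that)
    show "infinite (range j)"
      using \<open>strict_mono j\<close> by (simp add: finite_image_iff strict_mono_imp_inj_on)
    have "range j - J n \<subseteq> j ` {..<n}" for n
    proof
      fix i assume "i \<in> range j - J n"
      then obtain m where m: "i = j m" "j m \<notin> J n" by auto
      then have "\<not> n \<le> m" using j(1)[of m] by (auto simp: K_def)
      with m show "i \<in> j ` {..<n}" by auto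
    qed
    then show "finite (range j - J n)" for n by (rule finite_subset) simp
  qed
qed

text \<open>The triangle inequality bounds the mean modulus on \<open>A\<close> by the oscillation
  plus the modulus of the mean, and \<open>null\<close> makes the latter eventually smaller than any
  \<open>\<eta>\<close>. Stating the result through finite exceptional sets makes it insensitive to
  finite changes of the index set.\<close>

lemma (in prob_space) bocce_extension_step:
  fixes h :: "nat \<Rightarrow> 'a \<Rightarrow> real"
  assumes int: "\<And>k. integrable M (h k)"
    and null: "\<And>A. A \<in> sets M \<Longrightarrow> (\<lambda>k. LINT \<omega>|M. indicator A \<omega> * h k \<omega>) \<longlonglongrightarrow> 0"
    and bocce: "sequential_bocce_criterion M h"
    and "infinite J" and B: "B \<in> pos_sets M" and "\<epsilon> > 0"
  obtains A I where "A \<in> pos_sets M" and "A \<subseteq> B" and "I \<subseteq> J" and "infinite I"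
    and "\<And>\<eta>. \<eta> > 0 \<Longrightarrow> finite {j \<in> I. \<epsilon> * measure M A + \<eta> < (LINT \<omega>|M. indicator A \<omega> * \<bar>h j \<omega>\<bar>)}"
proof -
  have "strict_mono (enumerate J)" using \<open>infinite J\<close> by (rule strict_mono_enumerate)
  then obtain A where A: "A \<in> pos_sets M" "A \<subseteq> B"
    and liminf: "liminf (\<lambda>j. ereal (bocce_osc M (h (enumerate J j)) A)) < ereal \<epsilon>"
    using bocce B \<open>\<epsilon> > 0\<close> unfolding sequential_bocce_criterion_def by metis
  have A_sets: "A \<in> sets M" and A_pos: "measure M A > 0" using A(1) by (auto simp: pos_sets_def)
  \<comment> \<open>A lower limit below \<open>\<epsilon>\<close> only says that the oscillation is
    below \<open>\<epsilon>\<close> for infinitely many terms, so the index set must shrink along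
    with the set \<open>B\<close>.\<close>
  define I where "I = {j \<in> J. bocce_osc M (h j) A < \<epsilon>}"
  show thesis
  proof (rule that[OF A])
    show "I \<subseteq> J" by (auto simp: I_def)
    have "\<not> (\<forall>\<^sub>F j in sequentially. ereal \<epsilon> \<le> ereal (bocce_osc M (h (enumerate J j)) A))"
      using liminf Liminf_bounded[of "ereal \<epsilon>"
          "\<lambda>j. ereal (bocce_osc M (h (enumerate J j)) A)" sequentially]
      by (auto simp: not_le)
    then have "\<exists>\<^sub>F j in sequentially. bocce_osc M (h (enumerate J j)) A < \<epsilon>"
      by (simp add: frequently_def not_less)
    then have "infinite {j. bocce_osc M (h (enumerate J j)) A < \<epsilon>}"
      by (simp add: frequently_cofinite flip: cofinite_eq_sequentially)
    moreover have "inj (enumerate J)"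
      using \<open>strict_mono (enumerate J)\<close> by (rule strict_mono_imp_inj_on)
    ultimately have "infinite (enumerate J ` {j. bocce_osc M (h (enumerate J j)) A < \<epsilon>})"
      by (metis finite_imageD inj_on_subset subset_UNIV)
    moreover have "enumerate J ` {j. bocce_osc M (h (enumerate J j)) A < \<epsilon>} \<subseteq> I"
      using enumerate_in_set[OF \<open>infinite J\<close>] by (auto simp: I_def)
    ultimately show "infinite I" by (meson finite_subset)
    fix \<eta> :: real assume "\<eta> > 0"
    have "\<forall>\<^sub>F k in sequentially. \<bar>LINT \<omega>|M. indicator A \<omega> * h k \<omega>\<bar> < \<eta>"
      using tendstoD[OF null[OF A_sets] \<open>\<eta> > 0\<close>] by (simp add: dist_real_def)
    then have "finite {k. \<eta> \<le> \<bar>LINT \<omega>|M. indicator A \<omega> * h k \<omega>\<bar>}"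
      by (simp add: eventually_cofinite cofinite_eq_sequentially[symmetric] not_less)
    moreover have "(LINT \<omega>|M. indicator A \<omega> * \<bar>h k \<omega>\<bar>) \<le> \<epsilon> * measure M A + \<eta>"
      if k: "k \<in> I" "\<bar>LINT \<omega>|M. indicator A \<omega> * h k \<omega>\<bar> < \<eta>" for k
    proof -
      define m where "m = set_mean M A (h k)"
      have int_A: "integrable M (indicat_real A)"
        using A_sets by (simp add: integrable_real_indicator less_top[symmetric])
      have int_hm: "integrable M (\<lambda>\<omega>. indicator A \<omega> * \<bar>h k \<omega> - m\<bar>)"
        using integrable_mult_indicator[OF A_sets, of "\<lambda>\<omega>. \<bar>h k \<omega> - m\<bar>"] int[of k] by simp
      have "(LINT \<omega>|M. indicator A \<omega> * \<bar>h k \<omega>\<bar>) \<le>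
          (LINT \<omega>|M. indicator A \<omega> * \<bar>h k \<omega> - m\<bar> + \<bar>m\<bar> * indicator A \<omega>)"
      proof (rule integral_mono)
        show "integrable M (\<lambda>\<omega>. indicat_real A \<omega> * \<bar>h k \<omega>\<bar>)"
          using integrable_mult_indicator[OF A_sets, of "\<lambda>\<omega>. \<bar>h k \<omega>\<bar>"] int[of k] by simp
        show "integrable M (\<lambda>\<omega>. indicat_real A \<omega> * \<bar>h k \<omega> - m\<bar> + \<bar>m\<bar> * indicat_real A \<omega>)"
          using int_hm int_A by simp
      qed (auto simp: indicator_def)
      also have "\<dots> = (LINT \<omega>|M. indicator A \<omega> * \<bar>h k \<omega> - m\<bar>) + \<bar>m\<bar> * measure M A"
        using int_hm int_A A_sets by simp
      also have "(LINT \<omega>|M. indicator A \<omega> * \<bar>h k \<omega> - m\<bar>) = measure M A * bocce_osc M (h k) A"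
        using A_pos by (simp add: bocce_osc_def set_lebesgue_integral_def m_def)
      also have "\<bar>m\<bar> * measure M A = \<bar>LINT \<omega>|M. indicator A \<omega> * h k \<omega>\<bar>"
        using A_pos by (simp add: m_def set_mean_def set_lebesgue_integral_def abs_mult abs_divide)
      also have "measure M A * bocce_osc M (h k) A + \<bar>LINT \<omega>|M. indicator A \<omega> * h k \<omega>\<bar>
          \<le> measure M A * \<epsilon> + \<eta>"
        using k A_pos by (intro add_mono mult_left_mono) (auto simp: I_def)
      finally show ?thesis by (simp add: mult.commute)
    qed
    ultimately show "finite {j \<in> I. \<epsilon> * measure M A + \<eta> < (LINT \<omega>|M. indicator A \<omega> * \<bar>h j \<omega>\<bar>)}"
      by (elim finite_subset[rotated]) force
  qed
qed

text \<open>A maximal pair \<open>(A, J)\<close> such that the terms with index in \<open>J\<close> are eventually small in mean on \<open>A\<close>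
  exhausts the space, since the criterion enlarges any other \<open>A\<close>.\<close>

lemma (in prob_space) bocce_imp_L1_null:
  fixes h :: "nat \<Rightarrow> 'a \<Rightarrow> real"
  assumes int: "\<And>k. integrable M (h k)" and equi: "equi_integrable M h"
    and null: "\<And>A. A \<in> sets M \<Longrightarrow> (\<lambda>k. LINT \<omega>|M. indicator A \<omega> * h k \<omega>) \<longlonglongrightarrow> 0"
    and bocce: "sequential_bocce_criterion M h"
  shows "(\<lambda>k. LINT \<omega>|M. \<bar>h k \<omega>\<bar>) \<longlonglongrightarrow> 0"
proof (rule ccontr)
  assume "\<not> ?thesis"
  then obtain \<delta> where "\<delta> > 0" and "\<not> (\<forall>\<^sub>F k in sequentially. (LINT \<omega>|M. \<bar>h k \<omega>\<bar>) < \<delta>)"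
    unfolding tendsto_iff by (auto simp: dist_real_def)
  then have J0: "infinite {k. \<delta> \<le> (LINT \<omega>|M. \<bar>h k \<omega>\<bar>)}"
    by (simp add: eventually_cofinite cofinite_eq_sequentially[symmetric] not_less)
  define J0 where "J0 = {k. \<delta> \<le> (LINT \<omega>|M. \<bar>h k \<omega>\<bar>)}"
  \<comment> \<open>On a good pair of full measure the mean modulus is at most
    \<open>\<epsilon> + \<epsilon>\<close>, half of the value \<open>\<delta>\<close> that every
    index in \<open>J0\<close> reaches.\<close>
  define \<epsilon> where "\<epsilon> = \<delta> / 4"
  have "\<epsilon> > 0" using \<open>\<delta> > 0\<close> by (simp add: \<epsilon>_def)
  define I where "I A k = (LINT \<omega>|M. indicator A \<omega> * \<bar>h k \<omega>\<bar>)" for A k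
  have int_I: "integrable M (\<lambda>\<omega>. indicator A \<omega> * \<bar>h k \<omega>\<bar>)" if "A \<in> sets M" for A k
    using integrable_mult_indicator[OF that, of "\<lambda>\<omega>. \<bar>h k \<omega>\<bar>"] int[of k] by simp
  have I_union: "I (A \<union> B) k = I A k + I B k" if "A \<in> sets M" "B \<in> sets M" "A \<inter> B = {}" for A B k
  proof -
    have "I (A \<union> B) k = (LINT \<omega>|M. indicator A \<omega> * \<bar>h k \<omega>\<bar> + indicator B \<omega> * \<bar>h k \<omega>\<bar>)"
      unfolding I_def using that(3)
      by (intro Bochner_Integration.integral_cong) (auto simp: indicator_def)
    then show ?thesis using int_I that by (simp add: I_def)
  qed
  define X where "X = {(A, J). A \<in> sets M \<and> infinite J \<and>
    (\<forall>\<eta>>0. finite {j \<in> J. \<epsilon> * measure M A + \<eta> < I A j})}"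
  \<comment> \<open>Index sets may only shrink, up to finitely many new indices. This is the almost
    inclusion that a pseudo-intersection satisfies, and \<open>X\<close> tolerates finitely many
    exceptions.\<close>
  define R where "R x y \<longleftrightarrow> fst x \<subseteq> fst y \<and> finite (snd y - snd x)" for x y :: "'a set \<times> nat set"
  have X: "(A, J) \<in> X \<longleftrightarrow> A \<in> sets M \<and> infinite J \<and>
    (\<forall>\<eta>>0. finite {j \<in> J. \<epsilon> * measure M A + \<eta> < I A j})" for A J
    by (simp add: X_def)
  have "({}, J0) \<in> X"
    using J0 by (simp add: X I_def J0_def not_less)
  have "\<exists>u\<in>X. R ({}, J0) u \<and> (\<forall>y\<in>X. R u y \<longrightarrow> measure M (fst y) \<le> measure M (fst u))"
  proof (rule brezis_browder[where R = R and \<phi> = "\<lambda>x. measure M (fst x)" and K = 1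
        and X = X and ?x0.0 = "({}, J0)"])
    show "({}, J0) \<in> X" by fact
    show "R x x" for x by (simp add: R_def)
    show "R x z" if "R x y" "R y z" for x y z
    proof -
      have "snd z - snd x \<subseteq> (snd z - snd y) \<union> (snd y - snd x)" by auto
      with that show ?thesis by (auto simp: R_def intro: finite_subset)
    qed
    show "measure M (fst x) \<le> measure M (fst y)" if "x \<in> X" "y \<in> X" "R x y" for x y
      using that by (auto simp: X_def R_def intro!: finite_measure_mono)
    show "measure M (fst x) \<le> 1" for x by simp
    fix s assume s: "\<And>n. s n \<in> X" "\<And>n. R (s n) (s (Suc n))"
    define A where "A n = fst (s n)" for n
    define J where "J n = snd (s n)" for n
    have A: "A n \<in> sets M" "infinite (J n)"
      "\<And>\<eta>. \<eta> > 0 \<Longrightarrow> finite {j \<in> J n. \<epsilon> * measure M (A n) + \<eta> < I (A n) j}" for n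
      using s(1)[of n] unfolding A_def J_def by (auto simp: X_def split_beta)
    have "incseq A" using s(2) by (intro incseq_SucI) (auto simp: R_def A_def)
    obtain K where K: "infinite K" "\<And>n. finite (K - J n)"
      using pseudo_intersection[of J] A(2) s(2) by (auto simp: R_def J_def)
    have UA: "(\<Union>n. A n) \<in> sets M" using A(1) by auto
    have "((\<Union>n. A n), K) \<in> X"
      unfolding X
    proof (intro conjI allI impI UA K(1))
      fix \<eta> :: real assume "\<eta> > 0"
      then obtain \<delta> where "\<delta> > 0" and \<delta>: "\<And>k B. B \<in> sets M \<Longrightarrow> measure M B < \<delta> \<Longrightarrow> I B k \<le> \<eta> / 2"
        using equi unfolding equi_integrable_def I_def by (meson half_gt_zero)
      \<comment> \<open>Equi-integrability makes the union admissible: some \<open>A n\<close>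
        misses so little of it that the rest contributes at most \<open>\<eta> / 2\<close> for all
        indices at once, while the pair \<open>n\<close> is used with the other
        \<open>\<eta> / 2\<close>.\<close>
      have "(\<lambda>n. measure M (A n)) \<longlonglongrightarrow> measure M (\<Union>n. A n)"
        using A(1) \<open>incseq A\<close> by (intro finite_Lim_measure_incseq) auto
      from order_tendstoD(1)[OF this, of "measure M (\<Union>n. A n) - \<delta>"] \<open>\<delta> > 0\<close>
      obtain n where n: "measure M (\<Union>n. A n) - \<delta> < measure M (A n)"
        by (auto simp: eventually_sequentially)
      have diff: "(\<Union>n. A n) - A n \<in> sets M" using UA A(1) by auto
      have "measure M ((\<Union>n. A n) - A n) < \<delta>"
        using n finite_measure_Diff[OF UA A(1)[of n]] by (auto simp: UN_upper)
      then have tail: "I ((\<Union>n. A n) - A n) k \<le> \<eta> / 2" for k by (rule \<delta>[OF diff])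
      have split: "I (\<Union>n. A n) k = I (A n) k + I ((\<Union>n. A n) - A n) k" for k
        using I_union[OF A(1) diff, of n k] by (simp add: Un_absorb1 UN_upper)
      have "measure M (A n) \<le> measure M (\<Union>n. A n)"
        using UA by (intro finite_measure_mono) auto
      then have "\<epsilon> * measure M (A n) \<le> \<epsilon> * measure M (\<Union>n. A n)"
        using \<open>\<epsilon> > 0\<close> by simp
      then have "{j \<in> K. \<epsilon> * measure M (\<Union>n. A n) + \<eta> < I (\<Union>n. A n) j} \<subseteq>
          (K - J n) \<union> {j \<in> J n. \<epsilon> * measure M (A n) + \<eta> / 2 < I (A n) j}"
        using tail split by (auto simp: ) (smt (verit) field_sum_of_halves)
      then show "finite {j \<in> K. \<epsilon> * measure M (\<Union>n. A n) + \<eta> < I (\<Union>n. A n) j}"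
        using K(2)[of n] A(3)[of "\<eta> / 2" n] \<open>\<eta> > 0\<close> by (auto intro: finite_subset)
    qed
    moreover have "R (s n) ((\<Union>n. A n), K)" for n
      using K(2)[of n] by (auto simp: R_def A_def J_def)
    ultimately show "\<exists>u\<in>X. \<forall>n. R (s n) u" by blast
  qed blast+
  then obtain u where u: "u \<in> X" "R ({}, J0) u"
    and max: "\<And>y. y \<in> X \<Longrightarrow> R u y \<Longrightarrow> measure M (fst y) \<le> measure M (fst u)" by blast
  obtain A J where u_eq: "u = (A, J)" by (cases u)
  have A: "A \<in> sets M" "infinite J" "\<And>\<eta>. \<eta> > 0 \<Longrightarrow> finite {j \<in> J. \<epsilon> * measure M A + \<eta> < I A j}"
    using u(1) by (auto simp: u_eq X)
  have full: "measure M (space M - A) = 0"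
  proof (rule ccontr)
    assume "measure M (space M - A) \<noteq> 0"
    then have pos: "space M - A \<in> pos_sets M"
      using A(1) by (auto simp: pos_sets_def zero_less_measure_iff)
    \<comment> \<open>Since \<open>L\<close> is part of \<open>J\<close>, the estimate already known
      on \<open>A\<close> survives, and adding the new set \<open>B\<close> strictly enlarges the
      measure of a maximal pair.\<close>
    have "\<exists>B L. B \<in> pos_sets M \<and> B \<subseteq> space M - A \<and> L \<subseteq> J \<and> infinite L \<and>
      (\<forall>\<eta>>0. finite {j \<in> L. \<epsilon> * measure M B + \<eta> < I B j})"
      unfolding I_def
      by (rule bocce_extension_step[OF int null bocce A(2) pos \<open>\<epsilon> > 0\<close>]) blast+
    then obtain B L where B: "B \<in> pos_sets M" "B \<subseteq> space M - A" "L \<subseteq> J" "infinite L"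
      "\<And>\<eta>. \<eta> > 0 \<Longrightarrow> finite {j \<in> L. \<epsilon> * measure M B + \<eta> < I B j}"
      by blast
    have B_sets: "B \<in> sets M" "measure M B > 0" "A \<inter> B = {}" using B(1,2)
      by (auto simp: pos_sets_def)
    have meas: "measure M (A \<union> B) = measure M A + measure M B"
      using A(1) B_sets by (intro finite_measure_Union) auto
    have "(A \<union> B, L) \<in> X"
      unfolding X
    proof (intro conjI allI impI B(4))
      show "A \<union> B \<in> sets M" using A(1) B_sets(1) by auto
      fix \<eta> :: real assume "\<eta> > 0"
      have "{j \<in> L. \<epsilon> * measure M (A \<union> B) + \<eta> < I (A \<union> B) j} \<subseteq>
        {j \<in> J. \<epsilon> * measure M A + \<eta> / 2 < I A j} \<union> {j \<in> L. \<epsilon> * measure M B + \<eta> / 2 < I B j}"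
      proof
        fix j assume j: "j \<in> {j \<in> L. \<epsilon> * measure M (A \<union> B) + \<eta> < I (A \<union> B) j}"
        then have "\<epsilon> * measure M A + \<epsilon> * measure M B + \<eta> < I A j + I B j"
          using I_union[OF A(1) B_sets(1) B_sets(3)] by (simp add: meas algebra_simps)
        then have "\<epsilon> * measure M A + \<eta> / 2 < I A j \<or> \<epsilon> * measure M B + \<eta> / 2 < I B j"
          by linarith
        with j B(3) show "j \<in> {j \<in> J. \<epsilon> * measure M A + \<eta> / 2 < I A j} \<union>
            {j \<in> L. \<epsilon> * measure M B + \<eta> / 2 < I B j}" by auto
      qed
      then show "finite {j \<in> L. \<epsilon> * measure M (A \<union> B) + \<eta> < I (A \<union> B) j}"
        using A(3)[of "\<eta> / 2"] B(5)[of "\<eta> / 2"] \<open>\<eta> > 0\<close> by (auto intro: finite_subset)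
    qed
    moreover have "R u (A \<union> B, L)" using B(3)
      by (auto simp: R_def u_eq Diff_eq_empty_iff[THEN iffD2])
    ultimately have "measure M (A \<union> B) \<le> measure M A" using max[of "(A \<union> B, L)"] by (simp add: u_eq)
    with meas B_sets(2) show False by simp
  qed
  have "finite (J - J0)" using u(2) by (simp add: R_def u_eq)
  moreover have "finite {j \<in> J. \<epsilon> * measure M A + \<epsilon> < I A j}" using A(3)[OF \<open>\<epsilon> > 0\<close>] .
  ultimately have "infinite (J - (J - J0) - {j \<in> J. \<epsilon> * measure M A + \<epsilon> < I A j})"
    using A(2) by simp
  then obtain j where "j \<in> J - (J - J0) - {j \<in> J. \<epsilon> * measure M A + \<epsilon> < I A j}"
    by (metis ex_in_conv finite.emptyI)
  then have j: "j \<in> J0" "I A j \<le> \<epsilon> * measure M A + \<epsilon>" by auto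
  have "AE \<omega> in M. \<omega> \<in> A"
    using full A(1) by (intro AE_prob_1) (simp add: prob_compl)
  then have "I A j = (LINT \<omega>|M. \<bar>h j \<omega>\<bar>)"
    unfolding I_def using int_I[OF A(1)] int[of j] by (intro integral_cong_AE) auto
  moreover have "\<epsilon> * measure M A \<le> \<epsilon> * 1"
    using \<open>\<epsilon> > 0\<close> by (intro mult_left_mono) auto
  ultimately have "\<delta> \<le> \<epsilon> + \<epsilon>" using j unfolding J0_def by simp
  with \<open>\<delta> > 0\<close> show False by (simp add: \<epsilon>_def)
qed

section \<open>Measurable selection and compactness\<close>

lemma (in prob_space) prob_ge_tendsto_0:
  fixes X :: "nat \<Rightarrow> 'a \<Rightarrow> real"
  assumes meas[measurable]: "\<And>n. X n \<in> borel_measurable M"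
    and lim: "\<And>\<omega>. \<omega> \<in> space M \<Longrightarrow> (\<lambda>n. X n \<omega>) \<longlonglongrightarrow> 0" and "\<eta> > 0"
  shows "(\<lambda>n. prob {\<omega> \<in> space M. \<eta> \<le> X n \<omega>}) \<longlonglongrightarrow> 0"
proof -
  have "(\<lambda>n. LINT \<omega>|M. indicat_real {\<omega> \<in> space M. \<eta> \<le> X n \<omega>} \<omega>) \<longlonglongrightarrow> (LINT \<omega>|M. 0)"
  proof (rule integral_dominated_convergence[where w = "\<lambda>_. 1"])
    show "AE \<omega> in M. (\<lambda>n. indicat_real {\<omega> \<in> space M. \<eta> \<le> X n \<omega>} \<omega>) \<longlonglongrightarrow> 0"
    proof (rule AE_I2)
      fix \<omega> assume "\<omega> \<in> space M"
      then have "\<forall>\<^sub>F n in sequentially. X n \<omega> < \<eta>"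
        using lim \<open>\<eta> > 0\<close> by (intro order_tendstoD) auto
      then have "\<forall>\<^sub>F n in sequentially. indicat_real {\<omega> \<in> space M. \<eta> \<le> X n \<omega>} \<omega> = 0"
        by eventually_elim simp
      then show "(\<lambda>n. indicat_real {\<omega> \<in> space M. \<eta> \<le> X n \<omega>} \<omega>) \<longlonglongrightarrow> 0"
        by (rule tendsto_eventually)
    qed
  qed auto
  then show ?thesis by simp
qed

text \<open>For one fixed functional this is Markov's inequality. A strongly measurable field is,
  outside a set of small probability, uniformly close to a field with finitely many values; the
  closeness can be used wherever the norm of \<open>d k\<close> is below \<open>L\<close>.\<close>

lemma (in prob_space) prob_pairing_ge_tendsto_0:
  fixes d :: "nat \<Rightarrow> 'a \<Rightarrow> 'e::banach" and \<beta> :: "'a \<Rightarrow> 'e \<Rightarrow>\<^sub>L real"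
  assumes d: "\<And>k. d k \<in> bochner_L1 M" and bound: "\<And>k. (LINT \<omega>|M. norm (d k \<omega>)) \<le> R"
    and null: "\<And>x :: 'e \<Rightarrow>\<^sub>L real. (\<lambda>k. LINT \<omega>|M. \<bar>blinfun_apply x (d k \<omega>)\<bar>) \<longlonglongrightarrow> 0"
    and \<beta>: "strongly_measurable M \<beta>" and "\<eta> > 0"
  shows "(\<lambda>k. prob {\<omega> \<in> space M. \<eta> \<le> \<bar>blinfun_apply (\<beta> \<omega>) (d k \<omega>)\<bar>}) \<longlonglongrightarrow> 0"
proof (rule tendstoI)
  fix \<epsilon> :: real assume "\<epsilon> > 0"
  have d_meas: "strongly_measurable M (d k)" and d_int: "integrable M (\<lambda>\<omega>. norm (d k \<omega>))" for k
    using d[of k] by (auto simp: bochner_L1_iff)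
  have "0 \<le> (LINT \<omega>|M. norm (d 0 \<omega>))" by simp
  then have "R \<ge> 0" using bound[of 0] by (rule order_trans)
  \<comment> \<open>By Markov's inequality the norm of \<open>d k\<close> reaches \<open>L\<close>
    with probability at most \<open>R / L\<close>, which is below \<open>\<epsilon> / 3\<close>; the
    summand 1 keeps \<open>L\<close> positive when \<open>R\<close> vanishes.\<close>
  define L where "L = 3 * (R + 1) / \<epsilon>"
  have "L > 0" using \<open>R \<ge> 0\<close> \<open>\<epsilon> > 0\<close> by (simp add: L_def)
  obtain s where s: "\<And>n::nat. simple_function M (s n)"
    and s_lim: "\<And>\<omega>. \<omega> \<in> space M \<Longrightarrow> (\<lambda>n. s n \<omega>) \<longlonglongrightarrow> \<beta> \<omega>"
    using \<beta> unfolding strongly_measurable_def by blast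
  have diff_meas: "(\<lambda>\<omega>. norm (s n \<omega> - \<beta> \<omega>)) \<in> borel_measurable M" for n
    by (rule strongly_measurable_norm[OF strongly_measurable_diff[OF
          strongly_measurable_simple_function[OF s] \<beta>]])
  have "(\<lambda>n. prob {\<omega> \<in> space M. \<eta> / (2 * L) \<le> norm (s n \<omega> - \<beta> \<omega>)}) \<longlonglongrightarrow> 0"
  proof (rule prob_ge_tendsto_0[OF diff_meas])
    show "(\<lambda>n. norm (s n \<omega> - \<beta> \<omega>)) \<longlonglongrightarrow> 0" if "\<omega> \<in> space M" for \<omega>
      using tendsto_norm[OF tendsto_diff[OF s_lim[OF that] tendsto_const[of "\<beta> \<omega>"]]] by simp
    show "\<eta> / (2 * L) > 0" using \<open>\<eta> > 0\<close> \<open>L > 0\<close> by simp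
  qed
  then have "\<forall>\<^sub>F n in sequentially. prob {\<omega> \<in> space M. \<eta> / (2 * L) \<le> norm (s n \<omega> - \<beta> \<omega>)} < \<epsilon> / 3"
    using \<open>\<epsilon> > 0\<close> by (intro order_tendstoD) auto
  then obtain n where n: "prob {\<omega> \<in> space M. \<eta> / (2 * L) \<le> norm (s n \<omega> - \<beta> \<omega>)} < \<epsilon> / 3"
    by (auto simp: eventually_sequentially)
  define V where "V = s n ` space M"
  have "finite V" unfolding V_def by (rule simple_functionD(1)[OF s])
  have x_meas: "(\<lambda>\<omega>. blinfun_apply x (d k \<omega>)) \<in> borel_measurable M" for x :: "'e \<Rightarrow>\<^sub>L real" and k
    by (rule strongly_measurable_blinfun_apply[OF strongly_measurable_simple_function d_meas]) simp
  have x_int: "integrable M (\<lambda>\<omega>. blinfun_apply x (d k \<omega>))" for x :: "'e \<Rightarrow>\<^sub>L real" and k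
    using bochner_L1_pairing(1)[OF d[of k] strongly_measurable_simple_function, of "\<lambda>_. x" "norm x"]
    by simp
  define P where "P k = (\<Sum>x\<in>V. prob {\<omega> \<in> space M. \<eta> / 2 \<le> \<bar>blinfun_apply x (d k \<omega>)\<bar>})" for k
  have "P \<longlonglongrightarrow> (\<Sum>x\<in>V. 0)"
    unfolding P_def
  proof (rule tendsto_sum)
    fix x :: "'e \<Rightarrow>\<^sub>L real"
    have lim': "(\<lambda>k. (LINT \<omega>|M. \<bar>blinfun_apply x (d k \<omega>)\<bar>) / (\<eta> / 2)) \<longlonglongrightarrow> 0"
      using tendsto_divide[OF null[of x] tendsto_const[of "\<eta> / 2"]] \<open>\<eta> > 0\<close> by simp
    show "(\<lambda>k. prob {\<omega> \<in> space M. \<eta> / 2 \<le> \<bar>blinfun_apply x (d k \<omega>)\<bar>}) \<longlonglongrightarrow> 0"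
    proof (rule tendsto_sandwich[OF _ _ tendsto_const lim'])
      show "\<forall>\<^sub>F k in sequentially. prob {\<omega> \<in> space M. \<eta> / 2 \<le> \<bar>blinfun_apply x (d k \<omega>)\<bar>}
          \<le> (LINT \<omega>|M. \<bar>blinfun_apply x (d k \<omega>)\<bar>) / (\<eta> / 2)"
      proof (intro always_eventually allI)
        show "prob {\<omega> \<in> space M. \<eta> / 2 \<le> \<bar>blinfun_apply x (d k \<omega>)\<bar>}
            \<le> (LINT \<omega>|M. \<bar>blinfun_apply x (d k \<omega>)\<bar>) / (\<eta> / 2)" for k
          by (rule integral_Markov_inequality_measure[where A = "space M"])
             (use x_int[of x k] \<open>\<eta> > 0\<close> in auto)
      qed
    qed simp
  qed
  then have "\<forall>\<^sub>F k in sequentially. P k < \<epsilon> / 3"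
    using \<open>\<epsilon> > 0\<close> by (intro order_tendstoD(2)[where y = 0]) auto
  then show "\<forall>\<^sub>F k in sequentially. dist (prob {\<omega> \<in> space M. \<eta> \<le>
      \<bar>blinfun_apply (\<beta> \<omega>) (d k \<omega>)\<bar>}) 0 < \<epsilon>"
  proof eventually_elim
    fix k assume P: "P k < \<epsilon> / 3"
    let ?D = "{\<omega> \<in> space M. L \<le> norm (d k \<omega>)}"
    let ?S = "{\<omega> \<in> space M. \<eta> / (2 * L) \<le> norm (s n \<omega> - \<beta> \<omega>)}"
    let ?X = "\<lambda>x. {\<omega> \<in> space M. \<eta> / 2 \<le> \<bar>blinfun_apply x (d k \<omega>)\<bar>}"
    note [measurable] = diff_meas x_meas strongly_measurable_norm[OF d_meas]
    have "prob ?D \<le> (LINT \<omega>|M. norm (d k \<omega>)) / L"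
      by (rule integral_Markov_inequality_measure[where A = "space M"]) (use d_int \<open>L > 0\<close> in auto)
    also have "\<dots> \<le> R / L" using bound[of k] \<open>L > 0\<close> by (intro divide_right_mono) auto
    also have "\<dots> < \<epsilon> / 3" using \<open>R \<ge> 0\<close> \<open>\<epsilon> > 0\<close> by (simp add: L_def field_simps)
    finally have D: "prob ?D < \<epsilon> / 3" .
    have sub: "{\<omega> \<in> space M. \<eta> \<le> \<bar>blinfun_apply (\<beta> \<omega>) (d k \<omega>)\<bar>} \<subseteq> ?D \<union> ?S \<union> (\<Union>x\<in>V. ?X x)"
    proof (rule subsetI, rule ccontr)
      fix \<omega> assume \<omega>: "\<omega> \<in> {\<omega> \<in> space M. \<eta> \<le> \<bar>blinfun_apply (\<beta> \<omega>) (d k \<omega>)\<bar>}"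
        and "\<omega> \<notin> ?D \<union> ?S \<union> (\<Union>x\<in>V. ?X x)"
      then have *: "norm (d k \<omega>) < L" "norm (s n \<omega> - \<beta> \<omega>) < \<eta> / (2 * L)"
        "\<bar>blinfun_apply (s n \<omega>) (d k \<omega>)\<bar> < \<eta> / 2" by (auto simp: V_def not_le)
      have "\<bar>blinfun_apply (s n \<omega> - \<beta> \<omega>) (d k \<omega>)\<bar> \<le> norm (s n \<omega> - \<beta> \<omega>) * norm (d k \<omega>)"
        using norm_blinfun[of "s n \<omega> - \<beta> \<omega>" "d k \<omega>"] by simp
      also have "\<dots> \<le> \<eta> / (2 * L) * L" using * \<open>\<eta> > 0\<close> \<open>L > 0\<close>
        by (intro mult_mono) auto
      also have "\<dots> = \<eta> / 2" using \<open>L > 0\<close> by simp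
      finally have "\<bar>blinfun_apply (s n \<omega>) (d k \<omega>) - blinfun_apply (\<beta> \<omega>) (d k \<omega>)\<bar> \<le> \<eta> / 2"
        by (simp add: blinfun.diff_left)
      moreover have "\<eta> \<le> \<bar>blinfun_apply (\<beta> \<omega>) (d k \<omega>)\<bar>" using \<omega> by simp
      ultimately show False using *(3) by linarith
    qed
    have "prob {\<omega> \<in> space M. \<eta> \<le> \<bar>blinfun_apply (\<beta> \<omega>) (d k \<omega>)\<bar>} \<le> prob (?D \<union> ?S \<union> (\<Union>x\<in>V. ?X x))"
      using \<open>finite V\<close> by (intro finite_measure_mono[OF sub] sets.Un sets.finite_UN) measurable
    also have "\<dots> \<le> prob (?D \<union> ?S) + prob (\<Union>x\<in>V. ?X x)"
      using \<open>finite V\<close> by (intro measure_Un_le sets.Un sets.finite_UN) measurable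
    also have "prob (?D \<union> ?S) \<le> prob ?D + prob ?S"
      by (intro measure_Un_le) measurable
    also have "prob (\<Union>x\<in>V. ?X x) \<le> P k"
      unfolding P_def using \<open>finite V\<close> by (intro measure_UNION_le) measurable
    finally show "dist (prob {\<omega> \<in> space M. \<eta> \<le> \<bar>blinfun_apply (\<beta> \<omega>) (d k \<omega>)\<bar>}) 0 < \<epsilon>"
      using D n P by simp
  qed
qed

text \<open>The selection takes the lexicographically largest value of the coordinates \<open>\<pi> n\<close>.\<close>

lemma measurable_selection:
  fixes S :: "'w \<Rightarrow> 'z::topological_space set" and \<pi> :: "nat \<Rightarrow> 'z \<Rightarrow> real"
  assumes "compact K"
    and S: "\<And>\<omega>. \<omega> \<in> space M \<Longrightarrow> closed (S \<omega>) \<and> S \<omega> \<subseteq> K \<and> S \<omega> \<noteq> {}"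
    and cont: "\<And>n. continuous_on UNIV (\<pi> n)"
    and hit: "\<And>C. closed C \<Longrightarrow> {\<omega> \<in> space M. S \<omega> \<inter> C \<noteq> {}} \<in> sets M"
  obtains u where "\<And>\<omega>. \<omega> \<in> space M \<Longrightarrow> u \<omega> \<in> S \<omega>" and "\<And>n. (\<lambda>\<omega>. \<pi> n (u \<omega>)) \<in> borel_measurable M"
proof -
  define T where "T = rec_nat S (\<lambda>n T \<omega>. {z \<in> T \<omega>. \<pi> n z = Sup (\<pi> n ` T \<omega>)})"
  have T_0: "T 0 = S" by (simp add: T_def)
  have T_Suc: "T (Suc n) \<omega> = {z \<in> T n \<omega>. \<pi> n z = Sup (\<pi> n ` T n \<omega>)}" for n \<omega>
    by (simp add: T_def)
  define t where "t n \<omega> = Sup (\<pi> n ` T n \<omega>)" for n \<omega>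
  have max: "\<exists>z\<in>A. \<forall>y\<in>A. \<pi> n y \<le> \<pi> n z" if "closed A" "A \<subseteq> K" "A \<noteq> {}" for A n
  proof (rule continuous_attains_sup)
    show "compact A" using compact_Int_closed[OF \<open>compact K\<close> that(1)] that(2)
      by (simp add: Int_absorb1)
    show "continuous_on A (\<pi> n)" using cont by (rule continuous_on_subset) simp
  qed fact
  have t_max: "(\<exists>z\<in>T n \<omega>. \<pi> n z = t n \<omega>) \<and> (\<forall>z\<in>T n \<omega>. \<pi> n z \<le> t n \<omega>)"
    if T: "closed (T n \<omega>) \<and> T n \<omega> \<subseteq> K \<and> T n \<omega> \<noteq> {}" for n \<omega>
  proof -
    obtain z where z: "z \<in> T n \<omega>" "\<And>y. y \<in> T n \<omega> \<Longrightarrow> \<pi> n y \<le> \<pi> n z" using max[of "T n \<omega>" n] T by blast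
    then have "t n \<omega> = \<pi> n z" unfolding t_def by (intro cSup_eq_maximum) auto
    with z show ?thesis by force
  qed
  have T: "closed (T n \<omega>) \<and> T n \<omega> \<subseteq> K \<and> T n \<omega> \<noteq> {}" if "\<omega> \<in> space M" for n \<omega>
  proof (induction n)
    case (Suc n)
    have "closed {z. \<pi> n z = t n \<omega>}" using cont by (intro closed_Collect_eq) auto
    moreover have "T (Suc n) \<omega> = T n \<omega> \<inter> {z. \<pi> n z = t n \<omega>}" by (auto simp: T_Suc t_def)
    ultimately show ?case using Suc t_max[OF Suc] by auto
  qed (use S[OF that] in \<open>simp add: T_0\<close>)
  \<comment> \<open>The induction must range over all closed \<open>C\<close>: the next stage
    intersects \<open>C\<close> with superlevel sets of the coordinate, and the maximum
    \<open>t n\<close> is measurable as soon as hitting superlevel sets is.\<close>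
  have hit_T: "{\<omega> \<in> space M. T n \<omega> \<inter> C \<noteq> {}} \<in> sets M \<and> t n \<in> borel_measurable M"
    if "closed C" for n C
    using that
  proof (induction n arbitrary: C)
    have t_meas: "t n \<in> borel_measurable M"
      if *: "\<And>C. closed C \<Longrightarrow> {\<omega> \<in> space M. T n \<omega> \<inter> C \<noteq> {}} \<in> sets M" for n
      unfolding borel_measurable_iff_ge
    proof
      fix a
      have "{\<omega> \<in> space M. a \<le> t n \<omega>} = {\<omega> \<in> space M. T n \<omega> \<inter> {z. a \<le> \<pi> n z} \<noteq> {}}"
      proof (intro Collect_cong conj_cong refl)
        fix \<omega> assume "\<omega> \<in> space M"
        from t_max[OF T[OF this, of n]] show "a \<le> t n \<omega> \<longleftrightarrow> T n \<omega> \<inter> {z. a \<le> \<pi> n z} \<noteq> {}"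
          by (force intro: order_trans)
      qed
      moreover have "closed {z. a \<le> \<pi> n z}" using cont by (intro closed_Collect_le) auto
      ultimately show "{\<omega> \<in> space M. a \<le> t n \<omega>} \<in> sets M" using * by simp
    qed
    {
      case 0
      then show ?case using hit t_meas[of 0] by (simp add: T_0)
    next
      case (Suc n)
      have [measurable]: "t n \<in> borel_measurable M" using Suc by blast
      have closed_ge: "closed {z. a \<le> \<pi> n z}" for a :: real
        using cont by (intro closed_Collect_le) auto
      have "{\<omega> \<in> space M. T (Suc n) \<omega> \<inter> C \<noteq> {}} \<in> sets M" if C: "closed C" for C
      proof -
        \<comment> \<open>\<open>C\<close> contains a maximizer exactly if it meets every rational
          superlevel set below the maximum: by compactness the coordinate attains its own maximum on
          the part of \<open>T n \<omega>\<close> in \<open>C\<close>. This leaves countably many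
          conditions.\<close>
        have "{\<omega> \<in> space M. T (Suc n) \<omega> \<inter> C \<noteq> {}} =
          (\<Inter>q::rat. {\<omega> \<in> space M. of_rat q < t n \<omega> \<longrightarrow>
            \<omega> \<in> {\<omega> \<in> space M. T n \<omega> \<inter> (C \<inter> {z. of_rat q \<le> \<pi> n z}) \<noteq> {}}})" (is "?A = ?B")
        proof
          show "?A \<subseteq> ?B" by (auto simp: T_Suc t_def)
          show "?B \<subseteq> ?A"
          proof
            fix \<omega> assume \<omega>B: "\<omega> \<in> ?B"
            then have \<omega>: "\<omega> \<in> space M" by auto
            have ge: "\<exists>z\<in>T n \<omega> \<inter> C. of_rat q \<le> \<pi> n z" if "of_rat q < t n \<omega>" for q
              using \<omega>B that by blast
            obtain q where "of_rat q < t n \<omega>" using of_rat_dense[of "t n \<omega> - 1" "t n \<omega>"] by auto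
            with ge have "T n \<omega> \<inter> C \<noteq> {}" by blast
            with max[of "T n \<omega> \<inter> C" n] T[OF \<omega>, of n] C
            obtain z where z: "z \<in> T n \<omega> \<inter> C" "\<And>y. y \<in> T n \<omega> \<inter> C \<Longrightarrow> \<pi> n y \<le> \<pi> n z" by blast
            have "t n \<omega> \<le> \<pi> n z"
            proof (rule ccontr)
              assume "\<not> t n \<omega> \<le> \<pi> n z"
              then obtain q where q: "\<pi> n z < of_rat q" "of_rat q < t n \<omega>"
                using of_rat_dense[of "\<pi> n z" "t n \<omega>"] by auto
              from ge[OF q(2)] z(2) q(1) show False by force
            qed
            moreover have "\<pi> n z \<le> t n \<omega>" using t_max[OF T[OF \<omega>]] z(1) by blast
            ultimately have "z \<in> T (Suc n) \<omega> \<inter> C" using z(1) by (simp add: T_Suc t_def)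
            with \<omega> show "\<omega> \<in> ?A" by blast
          qed
        qed
        moreover have "?B \<in> sets M"
        proof (intro sets.countable_INT image_subsetI)
          fix q
          have [measurable]: "{\<omega> \<in> space M. T n \<omega> \<inter> (C \<inter> {z. of_rat q \<le> \<pi> n z}) \<noteq> {}} \<in> sets M"
            using Suc.IH closed_Int[OF C closed_ge] by blast
          show "{\<omega> \<in> space M. of_rat q < t n \<omega> \<longrightarrow>
            \<omega> \<in> {\<omega> \<in> space M. T n \<omega> \<inter> (C \<inter> {z. of_rat q \<le> \<pi> n z}) \<noteq> {}}} \<in> sets M"
            by measurable
        qed simp
        ultimately show ?thesis by simp
      qed
      with t_meas[of "Suc n"] Suc.prems show ?case by blast
    }
  qed
  have "(\<Inter>n. T n \<omega>) \<noteq> {}" if "\<omega> \<in> space M" for \<omega>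
  proof -
    have mono: "T m \<omega> \<subseteq> T n \<omega>" if "n \<le> m" for m n
      using that by (induction m rule: dec_induct) (auto simp: T_Suc)
    have "K \<inter> (\<Inter>n\<in>UNIV. T n \<omega>) \<noteq> {}"
    proof (rule compact_imp_fip_image[OF \<open>compact K\<close>])
      show "closed (T n \<omega>)" for n using T[OF that] by blast
      fix I :: "nat set" assume "finite I"
      then obtain m where "\<And>n. n \<in> I \<Longrightarrow> n \<le> m" by (meson Max_ge)
      then have "T m \<omega> \<subseteq> K \<inter> (\<Inter>n\<in>I. T n \<omega>)" using mono T[OF that] by blast
      then show "K \<inter> (\<Inter>n\<in>I. T n \<omega>) \<noteq> {}" using T[OF that, of m] by blast
    qed
    then show ?thesis by blast
  qed
  note inhabited = this
  \<comment> \<open>The coordinates need not separate points, so any point of the intersection is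
    taken. Only its coordinates are claimed to be measurable, and these equal the maxima
    \<open>t n \<omega>\<close>.\<close>
  have u: "(SOME z. z \<in> (\<Inter>n. T n \<omega>)) \<in> (\<Inter>n. T n \<omega>)" if "\<omega> \<in> space M" for \<omega>
    unfolding some_in_eq by (rule inhabited[OF that])
  show thesis
  proof (rule that)
    let ?u = "\<lambda>\<omega>. SOME z. z \<in> (\<Inter>n. T n \<omega>)"
    show "?u \<omega> \<in> S \<omega>" if "\<omega> \<in> space M" for \<omega>
      using INT_D[OF u[OF that], of 0] by (simp add: T_0)
    have "\<pi> n (?u \<omega>) = t n \<omega>" if "\<omega> \<in> space M" for n \<omega>
    proof -
      have "?u \<omega> \<in> T (Suc n) \<omega>" using INT_D[OF u[OF that], of "Suc n"] by simp
      then show ?thesis by (simp add: T_Suc t_def)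
    qed
    moreover have "t n \<in> borel_measurable M" for n using hit_T[of UNIV] by simp
    ultimately show "(\<lambda>\<omega>. \<pi> n (?u \<omega>)) \<in> borel_measurable M" for n
      by (simp cong: measurable_cong)
  qed
qed

text \<open>Finitely many constraints, each depending on a countably valued index, split the space
  into countably many pieces on which the question is constant. Compactness reduces infinitely many
  constraints to these, so that no metrizability of the compact set enters.\<close>

lemma sets_countable_constraints:
  fixes v :: "nat \<Rightarrow> 'w \<Rightarrow> 'c::countable" and F :: "nat \<Rightarrow> 'c \<Rightarrow> 'z::topological_space set"
  assumes v[measurable]: "\<And>k. v k \<in> measurable M (count_space UNIV)"
    and F: "\<And>k c. closed (F k c)" and "compact K" and "closed C"
  shows "{\<omega> \<in> space M. K \<inter> C \<inter> (\<Inter>k. F k (v k \<omega>)) \<noteq> {}} \<in> sets M"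
proof -
  have finite: "{\<omega> \<in> space M. \<exists>z\<in>D. \<forall>k<n. z \<in> F k (v k \<omega>)} \<in> sets M" for n D
  proof (induction n arbitrary: D)
    case (Suc n)
    have "{\<omega> \<in> space M. \<exists>z\<in>D. \<forall>k<Suc n. z \<in> F k (v k \<omega>)} =
      (\<Union>c. {\<omega> \<in> space M. v n \<omega> = c} \<inter> {\<omega> \<in> space M. \<exists>z\<in>D \<inter> F n c. \<forall>k<n. z \<in> F k (v k \<omega>)})"
      by (auto simp: less_Suc_eq)
    moreover have "{\<omega> \<in> space M. v n \<omega> = c} \<in> sets M" for c by measurable
    ultimately show ?case using Suc by auto
  qed auto
  have "{\<omega> \<in> space M. K \<inter> C \<inter> (\<Inter>k. F k (v k \<omega>)) \<noteq> {}} =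
      (\<Inter>n. {\<omega> \<in> space M. \<exists>z\<in>K \<inter> C. \<forall>k<n. z \<in> F k (v k \<omega>)})"
  proof (intro equalityI subsetI)
    fix \<omega> assume \<omega>: "\<omega> \<in> (\<Inter>n. {\<omega> \<in> space M. \<exists>z\<in>K \<inter> C. \<forall>k<n. z \<in> F k (v k \<omega>)})"
    have "K \<inter> C \<inter> (\<Inter>k\<in>UNIV. F k (v k \<omega>)) \<noteq> {}"
    proof (rule compact_imp_fip_image[OF compact_Int_closed[OF \<open>compact K\<close> \<open>closed C\<close>] F])
      fix I :: "nat set" assume "finite I"
      then obtain n where n: "\<And>k. k \<in> I \<Longrightarrow> k < n" by (meson finite_nat_set_iff_bounded)
      from \<omega> obtain z where "z \<in> K \<inter> C" "\<forall>k<n. z \<in> F k (v k \<omega>)" by blast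
      with n show "K \<inter> C \<inter> (\<Inter>k\<in>I. F k (v k \<omega>)) \<noteq> {}" by blast
    qed
    with \<omega> show "\<omega> \<in> {\<omega> \<in> space M. K \<inter> C \<inter> (\<Inter>k. F k (v k \<omega>)) \<noteq> {}}" by blast
  qed blast
  with finite show ?thesis by auto
qed

section \<open>Weak-star compactness for families of functionals\<close>

lemma compact_box:
  fixes B :: "'i \<Rightarrow> real"
  shows "compact {u :: 'i \<Rightarrow> real. \<forall>i. \<bar>u i\<bar> \<le> B i}"
proof -
  have "{u :: 'i \<Rightarrow> real. \<forall>i. \<bar>u i\<bar> \<le> B i} = (\<Pi>\<^sub>E i\<in>UNIV. {- B i..B i})"
    by (auto simp: PiE_UNIV_domain abs_le_iff minus_le_iff Pi_iff)
  moreover have "compactin (product_topology (\<lambda>i. euclideanreal) UNIV) (\<Pi>\<^sub>E i\<in>UNIV. {- B i..B i})"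
    by (subst compactin_PiE) (simp add: compactin_euclidean_iff)
  ultimately show ?thesis
    by (simp add: euclidean_product_topology flip: compactin_euclidean_iff)
qed

text \<open>A family of functionals with norm bounds \<open>B i\<close>, written as one real
  function on pairs so that the product topology is pointwise, that is weak-star, convergence in
  every member. The indices are later natural numbers, for finitely many functionals at a time, or
  sets, for a vector measure.\<close>

definition dual_family :: "('i \<Rightarrow> real) \<Rightarrow> ('i \<times> 'e::real_normed_vector \<Rightarrow> real) set" where
  "dual_family B = {u. \<forall>i. (\<forall>x y. u (i, x + y) = u (i, x) + u (i, y)) \<and>
    (\<forall>c x. u (i, c *\<^sub>R x) = c * u (i, x)) \<and> (\<forall>x. \<bar>u (i, x)\<bar> \<le> B i * norm x)}"

lemma closed_dual_family: "closed (dual_family B :: ('i \<times> 'e::real_normed_vector \<Rightarrow> real) set)"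
proof -
  have "dual_family B = {u :: 'i \<times> 'e \<Rightarrow> real. \<forall>i x y. u (i, x + y) = u (i, x) + u (i, y)} \<inter>
    ({u. \<forall>i c x. u (i, c *\<^sub>R x) = c * u (i, x)} \<inter> {u. \<forall>i x. \<bar>u (i, x)\<bar> \<le> B i * norm x})"
    by (auto simp: dual_family_def)
  moreover have "closed {u :: 'i \<times> 'e \<Rightarrow> real. \<forall>i x y. u (i, x + y) = u (i, x) + u (i, y)}"
    by (intro closed_Collect_all closed_Collect_eq continuous_intros
        continuous_on_product_coordinates)
  moreover have "closed {u :: 'i \<times> 'e \<Rightarrow> real. \<forall>i c x. u (i, c *\<^sub>R x) = c * u (i, x)}"
    by (intro closed_Collect_all closed_Collect_eq continuous_intros
        continuous_on_product_coordinates)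
  moreover have "closed {u :: 'i \<times> 'e \<Rightarrow> real. \<forall>i x. \<bar>u (i, x)\<bar> \<le> B i * norm x}"
    by (intro closed_Collect_all closed_Collect_le continuous_intros
        continuous_on_product_coordinates)
  ultimately show ?thesis by (simp only:) (intro closed_Int; assumption)
qed

text \<open>The theorem of Banach and Alaoglu for all members at once: the family is a closed part
  of a product of compact intervals, and Tychonoff's theorem applies.\<close>

lemma compact_dual_family: "compact (dual_family B :: ('i \<times> 'e::real_normed_vector \<Rightarrow> real) set)"
proof -
  have eq: "dual_family B = {u :: 'i \<times> 'e \<Rightarrow> real. \<forall>p. \<bar>u p\<bar> \<le>
      B (fst p) * norm (snd p)} \<inter> dual_family B"
    by (auto simp: dual_family_def)
  show ?thesis
    by (subst eq) (rule compact_Int_closed[OF compact_box closed_dual_family])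
qed

lemma dual_family_blinfun:
  assumes "u \<in> dual_family B" and "B i \<ge> 0"
  shows "blinfun_apply (Blinfun (\<lambda>x. u (i, x))) x = u (i, x)"
    and "norm (Blinfun (\<lambda>x. u (i, x))) \<le> B i"
proof -
  have "bounded_linear (\<lambda>x. u (i, x))"
    using assms by (intro bounded_linear_intro[where K = "B i"])
        (auto simp: dual_family_def mult.commute)
  then have eq: "blinfun_apply (Blinfun (\<lambda>x. u (i, x))) = (\<lambda>x. u (i, x))"
    by (rule bounded_linear_Blinfun_apply)
  then show "blinfun_apply (Blinfun (\<lambda>x. u (i, x))) x = u (i, x)" by simp
  show "norm (Blinfun (\<lambda>x. u (i, x))) \<le> B i"
    using assms by (intro norm_blinfun_bound) (auto simp: eq dual_family_def)
qed

section \<open>Bounded densities\<close>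

text \<open>Domination by a multiple of the measure upgrades finite additivity: the remainder of a
  series is the value on a set whose measure tends to zero. It also supplies the two other
  hypotheses of the Radon-Nikodym property.\<close>

lemma (in finite_measure) dominated_additive_vector_measure:
  fixes G :: "'a set \<Rightarrow> 'x::banach"
  assumes add: "\<And>A B. A \<in> sets M \<Longrightarrow> B \<in> sets M \<Longrightarrow> A \<inter> B = {} \<Longrightarrow> G (A \<union> B) = G A + G B"
    and bound: "\<And>A. A \<in> sets M \<Longrightarrow> norm (G A) \<le> C * measure M A" and "C \<ge> 0"
  shows "vector_measure M G" and "vm_continuous M G" and "vm_bounded_variation M G"
proof -
  have empty: "G {} = 0" using bound[of "{}"] by simp
  show "vector_measure M G"
    unfolding vector_measure_def
  proof (intro allI impI)
    fix A :: "nat \<Rightarrow> 'a set" assume "range A \<subseteq> sets M \<and> disjoint_family A"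
    then have A: "range A \<subseteq> sets M" "disjoint_family A" by auto
    have A_sets: "(\<Union>i<n. A i) \<in> sets M" "(\<Union>n. A n) \<in> sets M" for n using A(1) by auto
    have partial: "G (\<Union>i<n. A i) = (\<Sum>i<n. G (A i))" for n
    proof (induction n)
      case (Suc n)
      have "A i \<inter> A n = {}" if "i < n" for i
        using disjoint_family_onD[OF A(2), of i n] that by simp
      then have "(\<Union>i<n. A i) \<inter> A n = {}" by blast
      moreover have "A n \<in> sets M" using A(1) by blast
      ultimately have "G ((\<Union>i<n. A i) \<union> A n) = G (\<Union>i<n. A i) + G (A n)"
        using add[OF A_sets(1)] by blast
      moreover have "(\<Union>i<Suc n. A i) = (\<Union>i<n. A i) \<union> A n" by (auto simp: less_Suc_eq)
      ultimately show ?case using Suc by simp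
    qed (simp add: empty)
    define D where "D n = (\<Union>n. A n) - (\<Union>i<n. A i)" for n
    have D: "D n \<in> sets M" for n using A_sets by (auto simp: D_def)
    have rest: "G (\<Union>n. A n) - (\<Sum>i<n. G (A i)) = G (D n)" for n
    proof -
      have "G ((\<Union>i<n. A i) \<union> D n) = G (\<Union>i<n. A i) + G (D n)"
        using add[OF A_sets(1) D[of n], of n] by (simp add: D_def)
      moreover have "(\<Union>i<n. A i) \<union> D n = (\<Union>n. A n)" by (auto simp: D_def)
      ultimately show ?thesis by (simp add: partial)
    qed
    have meas: "measure M (D n) = measure M (\<Union>n. A n) - (\<Sum>i<n. measure M (A i))" for n
    proof -
      have "measure M (\<Union>i<n. A i) = (\<Sum>i<n. measure M (A i))"
        using A by (intro finite_measure_finite_Union) (auto simp: disjoint_family_on_def)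
      moreover have "measure M (D n) = measure M (\<Union>n. A n) - measure M (\<Union>i<n. A i)"
        unfolding D_def by (intro finite_measure_Diff A_sets) auto
      ultimately show ?thesis by simp
    qed
    have "(\<lambda>n. measure M (\<Union>n. A n) - (\<Sum>i<n. measure M (A i))) \<longlonglongrightarrow>
        measure M (\<Union>n. A n) - measure M (\<Union>n. A n)"
      using finite_measure_UNION[OF A] by (intro tendsto_intros) (simp add: sums_def)
    then have "(\<lambda>n. measure M (D n)) \<longlonglongrightarrow> 0" by (simp add: meas)
    from tendsto_mult_right_zero[OF this] have lim: "(\<lambda>n. C * measure M (D n)) \<longlonglongrightarrow> 0" .
    have "(\<lambda>n. G (\<Union>n. A n) - (\<Sum>i<n. G (A i))) \<longlonglongrightarrow> 0"
      by (rule Lim_null_comparison[OF always_eventually lim]) (simp add: rest bound[OF D])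
    from tendsto_diff[OF tendsto_const[of "G (\<Union>n. A n)"] this]
    show "(\<lambda>n. G (A n)) sums G (\<Union>n. A n)" by (simp add: sums_def)
  qed
  show "vm_continuous M G"
    unfolding vm_continuous_def
  proof (intro allI impI)
    fix \<epsilon> :: real assume "\<epsilon> > 0"
    have "norm (G A) < \<epsilon>" if "A \<in> sets M" "measure M A < \<epsilon> / (C + 1)" for A
    proof -
      have "norm (G A) \<le> (C + 1) * measure M A"
        using bound[OF that(1)] measure_nonneg[of M A] unfolding distrib_right mult_1_left
          by linarith
      also have "\<dots> < \<epsilon>" using that(2) \<open>C \<ge> 0\<close> by (simp add: field_simps)
      finally show ?thesis .
    qed
    then show "\<exists>\<delta>>0. \<forall>A\<in>sets M. measure M A < \<delta> \<longrightarrow> norm (G A) < \<epsilon>"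
      using \<open>\<epsilon> > 0\<close> \<open>C \<ge> 0\<close> by (intro exI[of _ "\<epsilon> / (C + 1)"] conjI) simp_all
  qed
  show "vm_bounded_variation M G"
    unfolding vm_bounded_variation_def
  proof (intro exI allI impI)
    fix P assume P: "finite P \<and> P \<subseteq> sets M \<and> disjoint P"
    have "(\<Sum>A\<in>P. norm (G A)) \<le> (\<Sum>A\<in>P. C * measure M A)"
      using P bound by (intro sum_mono) auto
    also have "\<dots> = C * measure M (\<Union>A\<in>P. A)"
      using P by (subst finite_measure_finite_Union)
        (auto simp: sum_distrib_left disjoint_def disjoint_family_on_def)
    also have "\<dots> \<le> C * measure M (space M)"
      using \<open>C \<ge> 0\<close> by (intro mult_left_mono bounded_measure)
    finally show "(\<Sum>A\<in>P. norm (G A)) \<le> C * measure M (space M)" .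
  qed
qed

text \<open>The property yields only an integrable density. Testing it with simple vector fields of
  norm at most 1 bounds the integral of its norm over every set by \<open>C\<close> times the
  measure, hence the norm by \<open>C\<close> almost everywhere; on the exceptional set the density
  is replaced by zero.\<close>

lemma (in finite_measure) radon_nikodym_bounded_density:
  fixes G :: "'a set \<Rightarrow> 'e::banach \<Rightarrow>\<^sub>L real"
  assumes rnp: "radon_nikodym_property_wrt M TYPE('e \<Rightarrow>\<^sub>L real)"
    and add: "\<And>A B. A \<in> sets M \<Longrightarrow> B \<in> sets M \<Longrightarrow> A \<inter> B = {} \<Longrightarrow> G (A \<union> B) = G A + G B"
    and bound: "\<And>A. A \<in> sets M \<Longrightarrow> norm (G A) \<le> C * measure M A" and "C \<ge> 0"
  obtains b where "strongly_measurable M b" and "\<And>\<omega>. norm (b \<omega>) \<le> C"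
    and "\<And>A x. A \<in> sets M \<Longrightarrow> (LINT \<omega>|M. indicator A \<omega> * blinfun_apply (b \<omega>) x) =
        blinfun_apply (G A) x"
proof -
  from rnp dominated_additive_vector_measure[of G C, OF add bound \<open>C \<ge> 0\<close>]
  obtain g where g: "g \<in> bochner_L1 M"
    and gG: "\<And>A. A \<in> sets M \<Longrightarrow> has_strong_bochner_integral M (\<lambda>\<omega>. indicator A \<omega> *\<^sub>R g \<omega>) (G A)"
    unfolding radon_nikodym_property_wrt_def by blast
  have g_meas: "strongly_measurable M g" and g_int: "integrable M (\<lambda>\<omega>. norm (g \<omega>))"
    using g by (auto simp: bochner_L1_iff)
  have eval: "(LINT \<omega>|M. indicator A \<omega> * blinfun_apply (g \<omega>) x) = blinfun_apply (G A) x"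
    if "A \<in> sets M" for A x
    using has_strong_bochner_integral_blinfun[OF gG[OF that]
        bounded_bilinear.bounded_linear_left[OF bounded_bilinear_blinfun_apply, of x]]
    by (simp add: blinfun.scaleR_left)
  have int_x: "integrable M (\<lambda>\<omega>. blinfun_apply (g \<omega>) x)" for x
  proof (rule Bochner_Integration.integrable_bound)
    show "integrable M (\<lambda>\<omega>. norm x * norm (g \<omega>))" using g_int by simp
    show "(\<lambda>\<omega>. blinfun_apply (g \<omega>) x) \<in> borel_measurable M"
      by (rule strongly_measurable_blinfun_apply[OF g_meas strongly_measurable_simple_function])
          simp
    show "AE \<omega> in M. norm (blinfun_apply (g \<omega>) x) \<le> norm (norm x * norm (g \<omega>))"
      using norm_blinfun[of "g _" x] by (intro AE_I2) (simp add: mult.commute)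
  qed
  have le: "(LINT \<omega>|M. indicator A \<omega> * norm (g \<omega>)) \<le> C * measure M A" if A: "A \<in> sets M" for A
  proof (rule set_integral_norm_le_by_simple[OF g A bounded_bilinear_blinfun_apply])
    show "\<bar>blinfun_apply v c\<bar> \<le> norm v * norm c" for v :: "'e \<Rightarrow>\<^sub>L real" and c
      using norm_blinfun[of v c] by simp
    show "\<exists>c. norm c \<le> 1 \<and> norm v - e \<le> blinfun_apply v c" if "e > 0" for v :: "'e \<Rightarrow>\<^sub>L real" and e
      by (rule almost_norming_vector[OF that, of v]) blast
    fix c :: "'a \<Rightarrow> 'e" assume c: "simple_function M c" "\<And>\<omega>. norm (c \<omega>) \<le> 1"
    define V where "V = c ` space M"
    \<comment> \<open>On the piece where \<open>c\<close> has the value \<open>v\<close> the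
      integral is \<open>G (D v)\<close> applied to \<open>v\<close>, so the bound on
      \<open>G\<close> adds up over disjoint pieces.\<close>
    define D where "D v = A \<inter> {\<omega> \<in> space M. c \<omega> = v}" for v
    have "finite V" unfolding V_def by (rule simple_functionD(1)[OF c(1)])
    have D: "D v \<in> sets M" for v
    proof -
      have "c -` {v} \<inter> space M \<in> sets M" by (rule simple_functionD(2)[OF c(1)])
      moreover have "D v = A \<inter> (c -` {v} \<inter> space M)" by (auto simp: D_def)
      ultimately show ?thesis using A by auto
    qed
    have "(LINT \<omega>|M. indicator A \<omega> * blinfun_apply (g \<omega>) (c \<omega>)) =
        (LINT \<omega>|M. (\<Sum>v\<in>V. indicator (D v) \<omega> * blinfun_apply (g \<omega>) v))"
    proof (rule Bochner_Integration.integral_cong[OF refl])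
      fix \<omega> assume \<omega>: "\<omega> \<in> space M"
      have "(\<Sum>v\<in>V. indicator (D v) \<omega> * blinfun_apply (g \<omega>) v) =
          (\<Sum>v\<in>V. if v = c \<omega> then indicator A \<omega> * blinfun_apply (g \<omega>) v else 0)"
        using \<omega> by (intro sum.cong) (auto simp: D_def indicator_def)
      also have "\<dots> = indicator A \<omega> * blinfun_apply (g \<omega>) (c \<omega>)"
        using \<omega> \<open>finite V\<close> by (simp add: V_def)
      finally show "indicator A \<omega> * blinfun_apply (g \<omega>) (c \<omega>) =
          (\<Sum>v\<in>V. indicator (D v) \<omega> * blinfun_apply (g \<omega>) v)" by simp
    qed
    also have "\<dots> = (\<Sum>v\<in>V. blinfun_apply (G (D v)) v)"
      using integrable_mult_indicator[OF D int_x]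
      by (subst Bochner_Integration.integral_sum) (simp_all add: eval[OF D])
    also have "\<dots> \<le> (\<Sum>v\<in>V. C * measure M (D v))"
    proof (rule sum_mono)
      fix v assume "v \<in> V"
      then have "norm v \<le> 1" using c(2) by (auto simp: V_def)
      have "blinfun_apply (G (D v)) v \<le> norm (G (D v)) * norm v"
        using norm_blinfun[of "G (D v)" v] by simp
      also have "\<dots> \<le> (C * measure M (D v)) * 1"
        using bound[OF D] \<open>norm v \<le> 1\<close>
          by (intro mult_mono) (auto intro: order_trans[OF norm_ge_zero])
      finally show "blinfun_apply (G (D v)) v \<le> C * measure M (D v)" by simp
    qed
    also have "\<dots> = C * measure M (\<Union>v\<in>V. D v)"
      using D \<open>finite V\<close> by (subst finite_measure_finite_Union)
        (auto simp: sum_distrib_left disjoint_family_on_def D_def)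
    also have "(\<Union>v\<in>V. D v) = A" using sets.sets_into_space[OF A] by (auto simp: D_def V_def)
    finally show "(LINT \<omega>|M. indicator A \<omega> * blinfun_apply (g \<omega>) (c \<omega>)) \<le> C * measure M A" .
  qed
  note [measurable] = strongly_measurable_norm[OF g_meas]
  define B where "B = {\<omega> \<in> space M. norm (g \<omega>) \<le> C}"
  have B: "B \<in> sets M" unfolding B_def by measurable
  have AE_B: "AE \<omega> in M. \<omega> \<in> B"
  proof -
    have B': "space M - B \<in> sets M" using B by auto
    have int_1: "integrable M (\<lambda>\<omega>. indicator (space M - B) \<omega> * norm (g \<omega>))"
      using integrable_mult_indicator[OF B' g_int] by simp
    have int_2: "integrable M (indicat_real (space M - B))"
      using B' by (simp add: integrable_real_indicator less_top[symmetric])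
    have int: "integrable M (\<lambda>\<omega>. indicator (space M - B) \<omega> * norm (g \<omega>) - C * indicator (space M -
        B) \<omega>)"
      using int_1 int_2 by simp
    have nonneg: "AE \<omega> in M. 0 \<le>
        indicator (space M - B) \<omega> * norm (g \<omega>) - C * indicator (space M - B) \<omega>"
      by (rule AE_I2) (auto simp: B_def indicator_def)
    have "(LINT \<omega>|M. indicator (space M - B) \<omega> * norm (g \<omega>) - C * indicator (space M - B) \<omega>) \<le> 0"
      using le[OF B'] int_1 int_2 B' by simp
    with integral_nonneg_AE[OF nonneg]
    have "(LINT \<omega>|M. indicator (space M - B) \<omega> * norm (g \<omega>) - C * indicator (space M - B) \<omega>) = 0"
      by (rule antisym[rotated])
    then have "AE \<omega> in M. indicator (space M - B) \<omega> * norm (g \<omega>) - C * indicator (space M - B) \<omega> =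
        0"
      using integral_nonneg_eq_0_iff_AE[OF int nonneg] by simp
    then show ?thesis
      by (rule AE_mp) (rule AE_I2, auto simp: B_def indicator_def)
  qed
  show thesis
  proof (rule that)
    show "strongly_measurable M (\<lambda>\<omega>. indicator B \<omega> *\<^sub>R g \<omega>)"
      by (rule strongly_measurable_indicator[OF B g_meas])
    show "norm (indicator B \<omega> *\<^sub>R g \<omega>) \<le> C" for \<omega>
      using \<open>C \<ge> 0\<close> by (auto simp: B_def indicator_def)
    fix A x assume A: "A \<in> sets M"
    have "(LINT \<omega>|M. indicator A \<omega> * blinfun_apply (indicator B \<omega> *\<^sub>R g \<omega>) x) =
        (LINT \<omega>|M. indicator A \<omega> * blinfun_apply (g \<omega>) x)"
    proof (rule integral_cong_AE)
      note [measurable] = A B borel_measurable_integrable[OF int_x[of x]]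
      show "(\<lambda>\<omega>. indicator A \<omega> * blinfun_apply (g \<omega>) x) \<in> borel_measurable M" by measurable
      show "(\<lambda>\<omega>. indicator A \<omega> * blinfun_apply (indicator B \<omega> *\<^sub>R g \<omega>) x) \<in> borel_measurable M"
        by (simp add: blinfun.scaleR_left)
      show "AE \<omega> in M. indicator A \<omega> * blinfun_apply (indicator B \<omega> *\<^sub>R g \<omega>) x =
          indicator A \<omega> * blinfun_apply (g \<omega>) x"
        using AE_B by (rule AE_mp) simp
    qed
    with eval[OF A] show "(LINT \<omega>|M. indicator A \<omega> * blinfun_apply (indicator B \<omega> *\<^sub>R g \<omega>) x) =
        blinfun_apply (G A) x" by simp
  qed
qed

lemma measurable_map_upt:
  fixes c :: "nat \<Rightarrow> 'w \<Rightarrow> 'c::countable"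
  assumes c: "\<And>k. c k \<in> measurable M (count_space UNIV)"
  shows "(\<lambda>\<omega>. map (\<lambda>k. c k \<omega>) [0..<n]) \<in> measurable M (count_space UNIV)"
proof (induction n)
  case (Suc n)
  have "(\<lambda>\<omega>. (\<lambda>l \<omega>. l @ [c n \<omega>]) (map (\<lambda>k. c k \<omega>) [0..<n]) \<omega>) \<in> measurable M (count_space UNIV)"
  proof (rule measurable_compose_countable[OF _ Suc])
    show "(\<lambda>\<omega>. l @ [c n \<omega>]) \<in> measurable M (count_space UNIV)" for l
      by (rule measurable_compose[OF c]) simp
  qed
  then show ?case by simp
qed simp

text \<open>The pointwise functionals \<open>y \<omega>\<close> are measurable only along the sequence \<open>x\<close>, so their indefinite
  integral need not exist. Averaging a representative of each cell of a countable partition gives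
  measures that are almost correct along \<open>x\<close>, and a cluster point is taken by compactness.\<close>

lemma (in prob_space) additive_extension:
  fixes y :: "'a \<Rightarrow> 'e::banach \<Rightarrow>\<^sub>L real" and x :: "nat \<Rightarrow> 'e"
  assumes norm_y: "\<And>\<omega>. \<omega> \<in> space M \<Longrightarrow> norm (y \<omega>) \<le> 1"
    and meas_y: "\<And>n. (\<lambda>\<omega>. blinfun_apply (y \<omega>) (x n)) \<in> borel_measurable M"
  obtains G :: "'a set \<Rightarrow> 'e \<Rightarrow>\<^sub>L real"
  where "\<And>A. norm (G A) \<le> measure M A"
    and "\<And>A B. A \<in> sets M \<Longrightarrow> B \<in> sets M \<Longrightarrow> A \<inter> B = {} \<Longrightarrow> G (A \<union> B) = G A + G B"
    and "\<And>A n. A \<in> sets M \<Longrightarrow> blinfun_apply (G A) (x n) =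
        (LINT \<omega>|M. indicator A \<omega> * blinfun_apply (y \<omega>) (x n))"
proof -
  define T where "T A n = (LINT \<omega>|M. indicator A \<omega> * blinfun_apply (y \<omega>) (x n))" for A n
  \<comment> \<open>Exact additivity is kept, but agreement with the integrals is asked only at the
    points of index below \<open>j\<close> and up to \<open>1 / Suc j\<close>. A countably valued
    substitute for \<open>y\<close> can meet this much.\<close>
  define F where "F j = {u :: 'a set \<times> 'e \<Rightarrow> real.
      (\<forall>A\<in>sets M. \<forall>B\<in>sets M. A \<inter> B = {} \<longrightarrow> (\<forall>z. u (A \<union> B, z) = u (A, z) + u (B, z)))} \<inter>
      {u. \<forall>n<j. \<forall>A\<in>sets M. \<bar>u (A, x n) - T A n\<bar> \<le> 1 / Suc j}" for j
  have closed_F: "closed (F j)" for j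
  proof -
    have "F j = (\<Inter>A\<in>sets M. \<Inter>B\<in>{B \<in> sets M. A \<inter> B = {}}. \<Inter>z. {u. u (A \<union> B, z) =
        u (A, z) + u (B, z)}) \<inter>
        (\<Inter>n\<in>{..<j}. \<Inter>A\<in>sets M. {u. \<bar>u (A, x n) - T A n\<bar> \<le> 1 / Suc j})"
      by (auto simp: F_def)
    then show ?thesis
      by (auto intro!: closed_Int closed_INT closed_Collect_eq closed_Collect_le continuous_intros
          continuous_on_product_coordinates)
  qed
  have pointwise: "\<bar>blinfun_apply (y \<omega>) z\<bar> \<le> norm z" if "\<omega> \<in> space M" for \<omega> z
    using norm_blinfun[of "y \<omega>" z] mult_right_mono[OF norm_y[OF that] norm_ge_zero[of z]] by simp
  have nonempty: "dual_family (measure M) \<inter> F j \<noteq> {}" for j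
  proof -
    \<comment> \<open>The cell of a point records the first \<open>j\<close> coordinates rounded
      down to multiples of \<open>1 / Suc j\<close>, so functionals of one cell agree there up to
      this error.\<close>
    define c where "c \<omega> = map (\<lambda>n. \<lfloor>real (Suc j) * blinfun_apply (y \<omega>) (x n)\<rfloor>) [0..<j]" for \<omega>
    have c_meas: "c \<in> measurable M (count_space UNIV)"
      unfolding c_def using meas_y by (intro measurable_map_upt) measurable
    \<comment> \<open>Replacing \<open>y\<close> by its value at one representative of the cell
      gives a function of a countable code, which is measurable against every vector and not only
      along \<open>x\<close>.\<close>
    define rep where "rep l = (SOME \<omega>. \<omega> \<in> space M \<and> c \<omega> = l)" for l
    have rep: "rep (c \<omega>) \<in> space M \<and> c (rep (c \<omega>)) = c \<omega>" if "\<omega> \<in> space M" for \<omega>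
      unfolding rep_def by (rule someI[of _ \<omega>]) (use that in simp)
    define y' where "y' \<omega> = y (rep (c \<omega>))" for \<omega>
    have y'_meas: "(\<lambda>\<omega>. blinfun_apply (y' \<omega>) z) \<in> borel_measurable M" for z
      unfolding y'_def by (rule measurable_compose[OF c_meas]) simp
    have y'_le: "\<bar>blinfun_apply (y' \<omega>) z\<bar> \<le> norm z" if "\<omega> \<in> space M" for \<omega> z
      unfolding y'_def using pointwise rep[OF that] by blast
    have near: "\<bar>blinfun_apply (y' \<omega>) (x n) - blinfun_apply (y \<omega>) (x n)\<bar> \<le> 1 / Suc j"
      if "\<omega> \<in> space M" "n < j" for \<omega> n
    proof -
      have "c (rep (c \<omega>)) ! n = c \<omega> ! n" using rep[OF that(1)] by simp
      then have "\<lfloor>real (Suc j) * blinfun_apply (y' \<omega>) (x n)\<rfloor> =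
          \<lfloor>real (Suc j) * blinfun_apply (y \<omega>) (x n)\<rfloor>"
        using that(2) by (simp add: c_def y'_def)
      then have "\<bar>real (Suc j) * blinfun_apply (y' \<omega>) (x n) - real (Suc j) * blinfun_apply (y \<omega>) (x
          n)\<bar> \<le> 1"
        by linarith
      then have "real (Suc j) * \<bar>blinfun_apply (y' \<omega>) (x n) - blinfun_apply (y \<omega>) (x n)\<bar> \<le> 1"
        by (simp only: right_diff_distrib[symmetric] abs_mult abs_of_nat)
      then show ?thesis by (simp add: field_simps)
    qed
    have int_y': "integrable M (\<lambda>\<omega>. indicator A \<omega> * blinfun_apply (y' \<omega>) z)" if "A \<in> sets M" for A z
      using integrable_mult_indicator[OF that
          integrable_const_bound[where B = "norm z", OF AE_I2 y'_meas]] y'_le by simp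
    have int_y: "integrable M (\<lambda>\<omega>. indicator A \<omega> * blinfun_apply (y \<omega>) (x n))"
      if "A \<in> sets M" for A n
      using integrable_mult_indicator[OF that
          integrable_const_bound[where B = "norm (x n)", OF AE_I2 meas_y]] pointwise by simp
    \<comment> \<open>A set outside \<open>sets M\<close> has \<open>measure M\<close> equal to 0,
      so the norm bound in \<open>dual_family\<close> forces the value 0 there.\<close>
    define u where "u p = (if fst p \<in> sets M
      then LINT \<omega>|M. indicator (fst p) \<omega> * blinfun_apply (y' \<omega>) (snd p) else 0)" for p
    have "u \<in> dual_family (measure M)"
      unfolding dual_family_def
    proof (intro CollectI allI conjI)
      fix A z w c
      show "u (A, z + w) = u (A, z) + u (A, w)"
        using int_y' by (simp add: u_def blinfun.add_right distrib_left)
      show "u (A, c *\<^sub>R z) = c * u (A, z)"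
        by (simp add: u_def blinfun.scaleR_right mult.left_commute)
      show "\<bar>u (A, z)\<bar> \<le> measure M A * norm z"
      proof (cases "A \<in> sets M")
        case True
        have "\<bar>LINT \<omega>|M. indicator A \<omega> * blinfun_apply (y' \<omega>) z\<bar> \<le>
            (LINT \<omega>|M. \<bar>indicator A \<omega> * blinfun_apply (y' \<omega>) z\<bar>)"
          by (rule integral_abs_bound)
        also have "\<dots> \<le> (LINT \<omega>|M. norm z * indicator A \<omega>)"
        proof (rule integral_mono[OF integrable_abs[OF int_y'[OF True]]])
          have "integrable M (indicat_real A)"
            using True by (simp add: integrable_real_indicator less_top[symmetric])
          then show "integrable M (\<lambda>\<omega>. norm z * indicat_real A \<omega>)" by simp
          show "\<bar>indicat_real A \<omega> * blinfun_apply (y' \<omega>) z\<bar> \<le> norm z * indicat_real A \<omega>"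
            if "\<omega> \<in> space M" for \<omega>
            using y'_le[OF that, of z] by (simp add: indicator_def)
        qed
        finally show ?thesis using True by (simp add: u_def mult.commute)
      qed (simp add: u_def)
    qed
    moreover have "u (A \<union> B, z) = u (A, z) + u (B, z)"
      if "A \<in> sets M" "B \<in> sets M" "A \<inter> B = {}" for A B z
    proof -
      have "u (A \<union> B, z) = (LINT \<omega>|M. indicator A \<omega> * blinfun_apply (y' \<omega>) z +
          indicator B \<omega> * blinfun_apply (y' \<omega>) z)"
      proof -
        have "indicat_real (A \<union> B) \<omega> = indicat_real A \<omega> + indicat_real B \<omega>" for \<omega>
          using \<open>A \<inter> B = {}\<close> by (auto simp: indicator_def)
        then show ?thesis using that by (simp add: u_def distrib_right)
      qed
      then show ?thesis using int_y' that by (simp add: u_def)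
    qed
    moreover have "\<bar>u (A, x n) - T A n\<bar> \<le> 1 / Suc j" if "A \<in> sets M" "n < j" for A n
    proof -
      have "u (A, x n) - T A n = (LINT \<omega>|M. indicator A \<omega> * blinfun_apply (y' \<omega>) (x n) -
          indicator A \<omega> * blinfun_apply (y \<omega>) (x n))"
        using that int_y int_y' by (simp add: u_def T_def)
      also have "\<bar>\<dots>\<bar> \<le> (LINT \<omega>|M. \<bar>indicator A \<omega> * blinfun_apply (y' \<omega>) (x n) -
          indicator A \<omega> * blinfun_apply (y \<omega>) (x n)\<bar>)"
        by (rule integral_abs_bound)
      also have "\<dots> \<le> (LINT \<omega>|M. 1 / Suc j)"
      proof (rule integral_mono)
        show "integrable M (\<lambda>\<omega>. \<bar>indicator A \<omega> * blinfun_apply (y' \<omega>) (x n) -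
            indicator A \<omega> * blinfun_apply (y \<omega>) (x n)\<bar>)"
          by (intro integrable_abs Bochner_Integration.integrable_diff int_y int_y' that)
        show "\<bar>indicator A \<omega> * blinfun_apply (y' \<omega>) (x n) -
            indicator A \<omega> * blinfun_apply (y \<omega>) (x n)\<bar> \<le> 1 / Suc j" if "\<omega> \<in> space M" for \<omega>
          using near[OF that \<open>n < j\<close>] by (cases "\<omega> \<in> A") auto
      qed simp
      finally show ?thesis by (simp add: prob_space)
    qed
    ultimately have "u \<in> dual_family (measure M) \<inter> F j" by (auto simp: F_def)
    then show ?thesis by blast
  qed
  have "dual_family (measure M) \<inter> (\<Inter>j\<in>UNIV. F j) \<noteq> {}"
  proof (rule compact_imp_fip_image[OF compact_dual_family closed_F])
    fix I :: "nat set" assume "finite I"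
    then obtain m where m: "\<And>j. j \<in> I \<Longrightarrow> j \<le> m" by (meson Max_ge)
    have "F m \<subseteq> F j" if "j \<le> m" for j
    proof -
      have "1 / real (Suc m) \<le> 1 / real (Suc j)" using that by (simp add: field_simps)
      then have le: "\<bar>a\<bar> \<le> 1 / real (Suc j)" if "\<bar>a\<bar> \<le> 1 / real (Suc m)" for a :: real
        using that by linarith
      show ?thesis using le less_le_trans[OF _ \<open>j \<le> m\<close>] unfolding F_def by blast
    qed
    with m nonempty[of m] show "dual_family (measure M) \<inter> (\<Inter>j\<in>I. F j) \<noteq> {}" by blast
  qed
  then obtain u where u: "u \<in> dual_family (measure M)" "\<And>j. u \<in> F j" by blast
  note G = dual_family_blinfun[OF u(1) measure_nonneg]
  show thesis
  proof (rule that[of "\<lambda>A. Blinfun (\<lambda>z. u (A, z))"])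
    show "norm (Blinfun (\<lambda>z. u (A, z))) \<le> measure M A" for A by (rule G(2))
    show "Blinfun (\<lambda>z. u (A \<union> B, z)) = Blinfun (\<lambda>z. u (A, z)) + Blinfun (\<lambda>z. u (B, z))"
      if "A \<in> sets M" "B \<in> sets M" "A \<inter> B = {}" for A B
    proof (rule blinfun_eqI)
      fix z
      have "u (A \<union> B, z) = u (A, z) + u (B, z)" using u(2)[of 0] that by (simp add: F_def)
      then show "blinfun_apply (Blinfun (\<lambda>z. u (A \<union> B, z))) z =
          blinfun_apply (Blinfun (\<lambda>z. u (A, z)) + Blinfun (\<lambda>z. u (B, z))) z"
        by (simp only: blinfun.add_left G(1))
    qed
    show "blinfun_apply (Blinfun (\<lambda>z. u (A, z))) (x n) =
        (LINT \<omega>|M. indicator A \<omega> * blinfun_apply (y \<omega>) (x n))"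
      if "A \<in> sets M" for A n
    proof -
      have small: "\<bar>u (A, x n) - T A n\<bar> \<le> \<epsilon>" if "\<epsilon> > 0" for \<epsilon> :: real
      proof -
        obtain j where "1 / real (Suc j) < \<epsilon>" by (rule nat_approx_posE[OF \<open>\<epsilon> > 0\<close>])
        \<comment> \<open>The index must exceed \<open>n\<close>, since \<open>F j\<close> controls
          only coordinates below \<open>j\<close>, and be at least the index chosen for the
          precision.\<close>
        moreover have "1 / real (Suc (max j (Suc n))) \<le> 1 / real (Suc j)"
          by (intro divide_left_mono) auto
        moreover have "\<bar>u (A, x n) - T A n\<bar> \<le> 1 / real (Suc (max j (Suc n)))"
          using u(2)[of "max j (Suc n)"] \<open>A \<in> sets M\<close> by (auto simp: F_def)
        ultimately show ?thesis by linarith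
      qed
      have "\<bar>u (A, x n) - T A n\<bar> \<le> 0"
        by (rule field_le_epsilon) (use small in simp)
      then show ?thesis by (simp add: G(1) T_def)
    qed
  qed
qed

section \<open>Weakly continuous integrands in probability\<close>

text \<open>A normal form in which one number \<open>m\<close> counts the functionals and fixes the
  radius. Neighbourhoods are then indexed by natural numbers, so countably many sets can exhaust the
  space, and the norm bound puts the functionals in a compact family.\<close>

lemma dual_weak_neighbourhood_zero:
  fixes U :: "'e::banach set"
  assumes "openin dual_weak_topology U" and "0 \<in> U"
  shows "\<exists>m>0. \<exists>c :: nat \<Rightarrow> 'e \<Rightarrow>\<^sub>L real. (\<forall>i. norm (c i) \<le> 1) \<and>
    (\<forall>z. (\<forall>i<m. \<bar>blinfun_apply (c i) z\<bar> < 1 / real m) \<longrightarrow> z \<in> U)"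
proof -
  have "generate_topology_on {{z \<in> UNIV. \<phi> z \<in> V} |\<phi> V. \<phi> \<in> range (blinfun_apply :: ('e \<Rightarrow>\<^sub>L real) \<Rightarrow>
      _) \<and> open V} U"
    using assms(1) unfolding dual_weak_topology_def initial_topology_def
    by (rule openin_topology_generated_by)
  then show ?thesis
    using \<open>0 \<in> U\<close>
  proof (induction U)
    case (Int U V)
    then obtain m c where "m > 0" and c: "\<And>i. norm (c i) \<le> 1"
      and U: "\<And>z. (\<forall>i<m. \<bar>blinfun_apply (c i) z\<bar> < 1 / real m) \<Longrightarrow> z \<in> U" by blast
    from Int obtain n d where "n > 0" and d: "\<And>i. norm (d i) \<le> 1"
      and V: "\<And>z. (\<forall>i<n. \<bar>blinfun_apply (d i) z\<bar> < 1 / real n) \<Longrightarrow> z \<in> V" by blast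
    \<comment> \<open>Both lists are concatenated; the larger count \<open>m + n\<close> also
      shrinks the radius below those of the two neighbourhoods.\<close>
    define b where "b i = (if i < m then c i else d (i - m))" for i
    have "z \<in> U \<inter> V" if z: "\<And>i. i < m + n \<Longrightarrow> \<bar>blinfun_apply (b i) z\<bar> < 1 / real (m + n)" for z
    proof
      have le: "1 / real (m + n) \<le> 1 / real m" "1 / real (m + n) \<le> 1 / real n"
        using \<open>m > 0\<close> \<open>n > 0\<close> by (auto intro!: divide_left_mono)
      show "z \<in> U"
      proof (rule U, intro allI impI)
        fix i assume "i < m"
        with z[of i] le show "\<bar>blinfun_apply (c i) z\<bar> < 1 / real m" by (simp add: b_def)
      qed
      show "z \<in> V"
      proof (rule V, intro allI impI)
        fix i assume "i < n"
        with z[of "m + i"] le show "\<bar>blinfun_apply (d i) z\<bar> < 1 / real n" by (simp add: b_def)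
      qed
    qed
    moreover have "norm (b i) \<le> 1" for i using c d by (simp add: b_def)
    ultimately show ?case using \<open>m > 0\<close> by (intro exI[of _ "m + n"] conjI exI[of _ b]) auto
  next
    case (UN \<U>)
    then obtain V where "V \<in> \<U>" "0 \<in> V" by blast
    with UN.IH[OF this] show ?case by (meson UnionI)
  next
    case (Basis U)
    then obtain b :: "'e \<Rightarrow>\<^sub>L real" and V where U: "U = {z. blinfun_apply b z \<in> V}" and "open V"
      by auto
    with Basis have "0 \<in> V" by simp
    with \<open>open V\<close> obtain e where "e > 0" and e: "\<And>r. \<bar>r\<bar> < e \<Longrightarrow> r \<in> V"
      by (auto simp: open_dist dist_real_def)
    \<comment> \<open>After scaling \<open>b\<close> by \<open>1 / (1 + norm b)\<close>, the radius
      \<open>1 / m\<close> for the scaled functional means \<open>(1 + norm b) / m\<close> for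
      \<open>b\<close>, which this choice puts below \<open>e\<close>.\<close>
    obtain m :: nat where m: "(1 + norm b) / e < real m" using reals_Archimedean2 by blast
    moreover have "0 < (1 + norm b) / e" using \<open>e > 0\<close> by (simp add: add_pos_nonneg)
    ultimately have "m > 0" by (intro gr0I) simp
    define c where "c = (1 / (1 + norm b)) *\<^sub>R b"
    have pos: "0 < 1 + norm b" by (simp add: add_pos_nonneg)
    then have "norm c \<le> 1" by (simp add: c_def)
    moreover have "z \<in> U" if "\<bar>blinfun_apply c z\<bar> < 1 / real m" for z
    proof -
      from pos have "blinfun_apply b z = (1 + norm b) * blinfun_apply c z"
        by (simp add: c_def blinfun.scaleR_left)
      with pos have "\<bar>blinfun_apply b z\<bar> = (1 + norm b) * \<bar>blinfun_apply c z\<bar>"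
        by (simp only: abs_mult abs_of_pos)
      also have "\<dots> \<le> (1 + norm b) * (1 / real m)"
        using that pos by (intro mult_left_mono) linarith+
      also have "\<dots> < e" using m \<open>e > 0\<close> \<open>m > 0\<close> by (simp add: field_simps)
      finally show ?thesis using e by (simp add: U)
    qed
    ultimately show ?case using \<open>m > 0\<close> by (intro exI[of _ m] conjI exI[of _ "\<lambda>_. c"]) auto
  qed simp
qed

text \<open>Finitely many of the sets already carry probability more than
  \<open>1 - \<epsilon> / 2\<close>, and finitely many limits may be added.\<close>

lemma (in prob_space) prob_tendsto_0_on_cover:
  fixes W :: "nat \<Rightarrow> 'a set"
  assumes X: "\<And>k. X k \<in> sets M" and W: "\<And>n. W n \<in> sets M" and cover: "(\<Union>n. W n) = space M"
    and lim: "\<And>n. (\<lambda>k. prob (X k \<inter> W n)) \<longlonglongrightarrow> 0"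
  shows "(\<lambda>k. prob (X k)) \<longlonglongrightarrow> 0"
proof (rule tendstoI)
  fix \<epsilon> :: real assume "\<epsilon> > 0"
  define V where "V n = (\<Union>i<n. W i)" for n :: nat
  have V: "V n \<in> sets M" for n using W by (auto simp: V_def)
  have "incseq V" unfolding incseq_def V_def by (intro allI impI UN_mono) auto
  have "(\<Union>n. V n) = space M" using cover by (auto simp: V_def)
  then have "(\<lambda>n. prob (V n)) \<longlonglongrightarrow> 1"
    using finite_Lim_measure_incseq[OF _ \<open>incseq V\<close>] V by (auto simp: prob_space)
  then have "\<forall>\<^sub>F n in sequentially. 1 - \<epsilon> / 2 < prob (V n)"
    using \<open>\<epsilon> > 0\<close> by (intro order_tendstoD) auto
  then obtain n where n: "1 - \<epsilon> / 2 < prob (V n)" by (auto simp: eventually_sequentially)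
  have "(\<lambda>k. \<Sum>i<n. prob (X k \<inter> W i)) \<longlonglongrightarrow> (\<Sum>i<n. 0)" by (intro tendsto_sum lim)
  then have "\<forall>\<^sub>F k in sequentially. (\<Sum>i<n. prob (X k \<inter> W i)) < \<epsilon> / 2"
    using \<open>\<epsilon> > 0\<close> by (intro order_tendstoD(2)[where y = 0]) auto
  then show "\<forall>\<^sub>F k in sequentially. dist (prob (X k)) 0 < \<epsilon>"
  proof eventually_elim
    fix k assume k: "(\<Sum>i<n. prob (X k \<inter> W i)) < \<epsilon> / 2"
    have XW: "X k \<inter> W i \<in> sets M" for i using X W by auto
    then have U: "(\<Union>i<n. X k \<inter> W i) \<in> sets M" by (intro sets.finite_UN) auto
    have "X k \<subseteq> (space M - V n) \<union> (\<Union>i<n. X k \<inter> W i)"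
      using sets.sets_into_space[OF X] by (auto simp: V_def)
    then have "prob (X k) \<le> prob ((space M - V n) \<union> (\<Union>i<n. X k \<inter> W i))"
      using V U by (intro finite_measure_mono) auto
    also have "\<dots> \<le> prob (space M - V n) + prob (\<Union>i<n. X k \<inter> W i)"
      using V U by (intro measure_Un_le) auto
    also have "prob (space M - V n) = 1 - prob (V n)" by (rule prob_compl[OF V])
    also have "prob (\<Union>i<n. X k \<inter> W i) \<le> (\<Sum>i<n. prob (X k \<inter> W i))"
      using XW by (intro measure_UNION_le) auto
    finally show "dist (prob (X k)) 0 < \<epsilon>" using k n by simp
  qed
qed

text \<open>All values of all approximating simple functions form one countable set. It replaces
  separability of the space for this particular sequence.\<close>

lemma strongly_measurable_countable_dense:
  fixes d :: "nat \<Rightarrow> 'w \<Rightarrow> 'e::real_normed_vector"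
  assumes "\<And>k. strongly_measurable M (d k)"
  shows "\<exists>x :: nat \<Rightarrow> 'e. \<forall>k. \<forall>\<omega>\<in>space M. \<forall>e>0. \<exists>n. norm (d k \<omega> - x n) < e"
proof -
  have "\<forall>k. \<exists>s. (\<forall>n::nat. simple_function M (s n)) \<and> (\<forall>\<omega>\<in>space M. (\<lambda>n. s n \<omega>) \<longlonglongrightarrow> d k \<omega>)"
    using assms unfolding strongly_measurable_def by blast
  from choice[OF this] obtain s where s: "\<And>k n. simple_function M (s k n)"
    and lim: "\<And>k \<omega>. \<omega> \<in> space M \<Longrightarrow> (\<lambda>n. s k n \<omega>) \<longlonglongrightarrow> d k \<omega>" by blast
  define D where "D = insert 0 (\<Union>k n. s k n ` space M)"
  have "countable D"
    unfolding D_def using countable_finite[OF simple_functionD(1)[OF s]]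
    by (simp only: countable_insert_eq) (intro countable_UN countableI_type)
  show ?thesis
  proof (intro exI[of _ "from_nat_into D"] allI ballI impI)
    fix k \<omega> and e :: real assume \<omega>: "\<omega> \<in> space M" and "e > 0"
    have "\<forall>\<^sub>F n in sequentially. dist (s k n \<omega>) (d k \<omega>) < e" using lim[OF \<omega>] \<open>e > 0\<close>
      by (rule tendstoD)
    then obtain n where n: "dist (s k n \<omega>) (d k \<omega>) < e" by (auto simp: eventually_sequentially)
    have "s k n \<omega> \<in> D" using \<omega> by (auto simp: D_def)
    then obtain i where "from_nat_into D i = s k n \<omega>" using from_nat_into_surj[OF \<open>countable D\<close>]
      by blast
    with n show "\<exists>i. norm (d k \<omega> - from_nat_into D i) < e"
      by (intro exI[of _ i]) (simp add: dist_norm norm_minus_commute)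
  qed
qed

text \<open>The density of the additive extension has the same integrals as \<open>y\<close> over
  every set at each point \<open>x n\<close>, hence the same values there almost everywhere.
  Elsewhere it may differ from \<open>y\<close>, which is harmless as long as only the points
  \<open>x n\<close> are tested.\<close>

lemma (in prob_space) strongly_measurable_version:
  fixes y :: "'a \<Rightarrow> 'e::banach \<Rightarrow>\<^sub>L real" and x :: "nat \<Rightarrow> 'e"
  assumes rnp: "radon_nikodym_property_wrt M TYPE('e \<Rightarrow>\<^sub>L real)"
    and norm_y: "\<And>\<omega>. \<omega> \<in> space M \<Longrightarrow> norm (y \<omega>) \<le> 1"
    and meas_y: "\<And>n. (\<lambda>\<omega>. blinfun_apply (y \<omega>) (x n)) \<in> borel_measurable M"
  shows "\<exists>\<beta> :: 'a \<Rightarrow> 'e \<Rightarrow>\<^sub>L real. strongly_measurable M \<beta> \<and> (\<forall>\<omega>. norm (\<beta> \<omega>) \<le> 1) \<and>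
    (AE \<omega> in M. \<forall>n. blinfun_apply (\<beta> \<omega>) (x n) = blinfun_apply (y \<omega>) (x n))"
proof (rule additive_extension[of y x, OF norm_y meas_y])
  fix G :: "'a set \<Rightarrow> 'e \<Rightarrow>\<^sub>L real"
  assume G: "\<And>A. norm (G A) \<le> measure M A"
    "\<And>A B. A \<in> sets M \<Longrightarrow> B \<in> sets M \<Longrightarrow> A \<inter> B = {} \<Longrightarrow> G (A \<union> B) = G A + G B"
    "\<And>A n. A \<in> sets M \<Longrightarrow> blinfun_apply (G A) (x n) =
        (LINT \<omega>|M. indicator A \<omega> * blinfun_apply (y \<omega>) (x n))"
  show ?thesis
  proof (rule radon_nikodym_bounded_density[of G 1, OF rnp G(2)])
    show "norm (G A) \<le> 1 * measure M A" for A using G(1) by simp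
    fix b :: "'a \<Rightarrow> 'e \<Rightarrow>\<^sub>L real"
    assume b: "strongly_measurable M b" "\<And>\<omega>. norm (b \<omega>) \<le> 1"
      "\<And>A x. A \<in> sets M \<Longrightarrow> (LINT \<omega>|M. indicator A \<omega> * blinfun_apply (b \<omega>) x) = blinfun_apply (G A) x"
    have "AE \<omega> in M. blinfun_apply (b \<omega>) (x n) = blinfun_apply (y \<omega>) (x n)" for n
    proof (rule density_unique_real)
      have le: "\<bar>blinfun_apply v (x n)\<bar> \<le> norm (x n)" if "norm v \<le> 1" for v :: "'e \<Rightarrow>\<^sub>L real"
        using norm_blinfun[of v "x n"] mult_right_mono[OF that norm_ge_zero[of "x n"]] by simp
      have "(\<lambda>\<omega>. blinfun_apply (b \<omega>) (x n)) \<in> borel_measurable M"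
        by (rule strongly_measurable_blinfun_apply[OF b(1) strongly_measurable_simple_function])
            simp
      then show "integrable M (\<lambda>\<omega>. blinfun_apply (b \<omega>) (x n))"
        by (rule integrable_const_bound[where B = "norm (x n)", rotated]) (use le b(2) in simp)
      show "integrable M (\<lambda>\<omega>. blinfun_apply (y \<omega>) (x n))"
        by (rule integrable_const_bound[where B = "norm (x n)", OF AE_I2 meas_y])
            (use le norm_y in simp)
      show "(LINT \<omega>:A|M. blinfun_apply (b \<omega>) (x n)) = (LINT \<omega>:A|M. blinfun_apply (y \<omega>) (x n))"
        if "A \<in> sets M" for A
        using b(3)[OF that] G(3)[OF that] by (simp add: set_lebesgue_integral_def)
    qed
    then have "AE \<omega> in M. \<forall>n. blinfun_apply (b \<omega>) (x n) = blinfun_apply (y \<omega>) (x n)"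
      by (simp add: AE_all_countable)
    with b(1,2) show ?thesis by blast
  qed auto
qed

text \<open>By weak continuity of \<open>g\<close> at zero there are, on sets exhausting \<open>\<Omega>\<close>, finitely many functionals
  that stay away from zero along all \<open>d\<^sub>k\<close>
    for which \<open>g\<close> does. The constraints involve only the indices
  \<open>N k \<omega>\<close> of nearby points in a countable dense set, so that a measurable selection exists.\<close>

lemma (in prob_space) weakly_continuous_null_in_probability:
  fixes d :: "nat \<Rightarrow> 'a \<Rightarrow> 'e::banach" and g :: "'a \<Rightarrow> 'e \<Rightarrow> real"
  assumes rnp: "radon_nikodym_property_wrt M TYPE('e \<Rightarrow>\<^sub>L real)"
    and d: "\<And>k. d k \<in> bochner_L1 M" and bound: "\<And>k. (LINT \<omega>|M. norm (d k \<omega>)) \<le> R"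
    and null: "\<And>x :: 'e \<Rightarrow>\<^sub>L real. (\<lambda>k. LINT \<omega>|M. \<bar>blinfun_apply x (d k \<omega>)\<bar>) \<longlonglongrightarrow> 0"
    and g_zero: "\<And>\<omega>. \<omega> \<in> space M \<Longrightarrow> g \<omega> 0 = 0"
    and g_cont: "\<And>\<omega>. \<omega> \<in> space M \<Longrightarrow> continuous_map dual_weak_topology euclideanreal (g \<omega>)"
    and g_meas: "\<And>k. (\<lambda>\<omega>. g \<omega> (d k \<omega>)) \<in> borel_measurable M" and "\<eta> > 0"
  shows "(\<lambda>k. prob {\<omega> \<in> space M. \<eta> \<le> \<bar>g \<omega> (d k \<omega>)\<bar>}) \<longlonglongrightarrow> 0"
proof -
  have d_meas: "strongly_measurable M (d k)" for k using d[of k] by (simp add: bochner_L1_iff)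
  obtain x :: "nat \<Rightarrow> 'e" where
    dense: "\<And>k \<omega> e. \<omega> \<in> space M \<Longrightarrow> e > 0 \<Longrightarrow> \<exists>n. norm (d k \<omega> - x n) < e"
    using strongly_measurable_countable_dense[of M d, OF d_meas] by blast
  define X where "X k = {\<omega> \<in> space M. \<eta> \<le> \<bar>g \<omega> (d k \<omega>)\<bar>}" for k
  have X[measurable]: "X k \<in> sets M" for k unfolding X_def using g_meas by measurable
  \<comment> \<open>Keeping only the index of a nearby point makes the constraint imposed by
    \<open>d k \<omega>\<close> countably valued, at an error that vanishes as \<open>k\<close>
    grows.\<close>
  define N where "N k \<omega> = (LEAST n. norm (d k \<omega> - x n) \<le> 1 / Suc k)" for k \<omega>
  have N_meas[measurable]: "N k \<in> measurable M (count_space UNIV)" for k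
  proof -
    have [measurable]: "(\<lambda>\<omega>. norm (d k \<omega> - x n)) \<in> borel_measurable M" for n
      by (rule strongly_measurable_norm[OF strongly_measurable_diff[OF d_meas
            strongly_measurable_simple_function]]) simp
    show ?thesis unfolding N_def by (intro measurable_Least) measurable
  qed
  have N: "norm (d k \<omega> - x (N k \<omega>)) \<le> 1 / Suc k" if \<omega>: "\<omega> \<in> space M" for k \<omega>
  proof -
    obtain n where "norm (d k \<omega> - x n) < 1 / Suc k" using dense[OF \<omega>, of "1 / Suc k" k] by auto
    then have "norm (d k \<omega> - x n) \<le> 1 / Suc k" by simp
    then show ?thesis
      unfolding N_def by (rule LeastI[of "\<lambda>n. norm (d k \<omega> - x n) \<le> 1 / Suc k" n])
  qed
  define v where "v k \<omega> = (if \<omega> \<in> X k then Some (N k \<omega>) else None)" for k \<omega>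
  have v_meas: "v k \<in> measurable M (count_space UNIV)" for k unfolding v_def by measurable
  define K where "K = (dual_family (\<lambda>_. 1) :: (nat \<times> 'e \<Rightarrow> real) set)"
  have K: "compact K" "closed K" unfolding K_def
    by (rule compact_dual_family, rule closed_dual_family)
  \<comment> \<open>One of the first \<open>m\<close> functionals must have modulus at least
    \<open>1 / m\<close> at the nearby point. Nothing is asked for \<open>k < m\<close>, where the
    approximation is too coarse, or off \<open>X k\<close>, coded by \<open>None\<close>.\<close>
  define F where "F m k c = (if k < m then UNIV else case c of None \<Rightarrow> UNIV
    | Some n \<Rightarrow> (\<Union>i\<in>{..<m}. {u :: nat \<times> 'e \<Rightarrow> real. 1 / real m \<le> \<bar>u (i, x n)\<bar>}))" for m k c
  have F: "closed (F m k c)" for m k c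
    unfolding F_def by (auto split: option.split intro!: closed_UN closed_Collect_le
        continuous_intros
        continuous_on_product_coordinates)
  define S where "S m \<omega> = K \<inter> (\<Inter>k. F m k (v k \<omega>))" for m \<omega>
  have S_closed: "closed (S m \<omega>)" for m \<omega> unfolding S_def using K(2) F
    by (intro closed_Int closed_INT) auto
  have S_hit: "{\<omega> \<in> space M. S m \<omega> \<inter> C \<noteq> {}} \<in> sets M" if "closed C" for m C
  proof -
    have "S m \<omega> \<inter> C = K \<inter> C \<inter> (\<Inter>k. F m k (v k \<omega>))" for \<omega> by (auto simp: S_def)
    then show ?thesis using sets_countable_constraints[of v M "F m", OF v_meas F K(1) that] by simp
  qed
  define W where "W m = {\<omega> \<in> space M. S m \<omega> \<noteq> {}}" for m
  have W: "W m \<in> sets M" for m using S_hit[of UNIV m] by (simp add: W_def)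
  have cover: "\<exists>m>0. \<omega> \<in> W m" if \<omega>: "\<omega> \<in> space M" for \<omega>
  proof -
    have "openin dual_weak_topology {z. \<bar>g \<omega> z\<bar> < \<eta>}"
    proof -
      have top: "topspace dual_weak_topology = (UNIV :: 'e set)"
        unfolding dual_weak_topology_def by (rule topspace_initial_topology) simp
      have "openin dual_weak_topology {z \<in> topspace dual_weak_topology. g \<omega> z \<in> {- \<eta><..<\<eta>}}"
        by (rule openin_continuous_map_preimage[OF g_cont[OF \<omega>]]) simp
      then show ?thesis by (simp add: top abs_less_iff minus_less_iff conj_commute)
    qed
    moreover have "0 \<in> {z. \<bar>g \<omega> z\<bar> < \<eta>}" using g_zero[OF \<omega>] \<open>\<eta> > 0\<close> by simp
    ultimately obtain m and c :: "nat \<Rightarrow> 'e \<Rightarrow>\<^sub>L real" where "m > 0" and c: "\<And>i. norm (c i) \<le> 1"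
      and small: "\<And>z. (\<forall>i<m. \<bar>blinfun_apply (c i) z\<bar> < 1 / real m) \<Longrightarrow> \<bar>g \<omega> z\<bar> < \<eta>"
      using dual_weak_neighbourhood_zero[of "{z. \<bar>g \<omega> z\<bar> < \<eta>}"] by auto
    have le: "\<bar>blinfun_apply (c i) z\<bar> \<le> norm z" for i z
      using norm_blinfun[of "c i" z] mult_right_mono[OF c[of i] norm_ge_zero[of z]] by simp
    define u where "u p = blinfun_apply (c (fst p)) (snd p)" for p
    have "u \<in> K"
      using le by (simp add: K_def dual_family_def u_def blinfun.add_right blinfun.scaleR_right)
    \<comment> \<open>Moving from \<open>d k \<omega>\<close> to the nearby point costs at most
      \<open>1 / Suc k\<close>, which is at most half of \<open>1 / m\<close> once
      \<open>2 * m \<le> k\<close>; doubling the index absorbs this loss.\<close>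
    moreover have "u \<in> F (2 * m) k (v k \<omega>)" for k
    proof (cases "k < 2 * m \<or> \<omega> \<notin> X k")
      case False
      then have "\<eta> \<le> \<bar>g \<omega> (d k \<omega>)\<bar>" "2 * m \<le> k" by (auto simp: X_def)
      then have "\<not> (\<forall>i<m. \<bar>blinfun_apply (c i) (d k \<omega>)\<bar> < 1 / real m)"
        using small[of "d k \<omega>"] by (meson not_less)
      then obtain i where i: "i < m" "1 / real m \<le> \<bar>blinfun_apply (c i) (d k \<omega>)\<bar>"
        by (auto simp: not_less)
      have "\<bar>blinfun_apply (c i) (d k \<omega>) - blinfun_apply (c i) (x (N k \<omega>))\<bar> \<le> 1 / Suc k"
        using le[of i "d k \<omega> - x (N k \<omega>)"] N[OF \<omega>, of k] by (simp add: blinfun.diff_right)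
      moreover have "1 / real (Suc k) \<le> 1 / real (2 * m)"
        using \<open>m > 0\<close> \<open>2 * m \<le> k\<close> by (intro divide_left_mono) auto
      moreover have "1 / real m = 1 / real (2 * m) + 1 / real (2 * m)" using \<open>m > 0\<close>
        by (simp add: field_simps)
      ultimately have "1 / real (2 * m) \<le> \<bar>blinfun_apply (c i) (x (N k \<omega>))\<bar>" using i(2) by linarith
      with False i(1) show ?thesis by (auto simp: F_def v_def u_def intro!: bexI[of _ i])
    qed (auto simp: F_def v_def)
    ultimately have "\<omega> \<in> W (2 * m)" using \<omega> by (auto simp: W_def S_def)
    with \<open>m > 0\<close> show ?thesis by (intro exI[of _ "2 * m"]) simp
  qed
  have main: "(\<lambda>k. prob (X k \<inter> W m)) \<longlonglongrightarrow> 0" if "m > 0" for m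
  proof -
    \<comment> \<open>Off \<open>W m\<close> no functionals satisfy the constraints. Falling back to
      all of \<open>K\<close> keeps the sets nonempty, so that the selection is defined
      everywhere.\<close>
    define T where "T \<omega> = (if \<omega> \<in> W m then S m \<omega> else K)" for \<omega>
    \<comment> \<open>A single sequence of coordinates that runs through all pairs of a functional
      and a point \<open>x n\<close>.\<close>
    define \<pi> where "\<pi> n u = u (fst (prod_decode n), x (snd (prod_decode n)))"
      for n and u :: "nat \<times> 'e \<Rightarrow> real"
    have "(\<lambda>_. 0) \<in> K" by (simp add: K_def dual_family_def)
    have "\<exists>u. (\<forall>\<omega>\<in>space M. u \<omega> \<in> T \<omega>) \<and> (\<forall>n. (\<lambda>\<omega>. \<pi> n (u \<omega>)) \<in> borel_measurable M)"
    proof (rule measurable_selection[of K M T \<pi>, OF K(1)])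
      show "closed (T \<omega>) \<and> T \<omega> \<subseteq> K \<and> T \<omega> \<noteq> {}" for \<omega>
        using K(2) S_closed[of m \<omega>] \<open>(\<lambda>_. 0) \<in> K\<close> by (auto simp: T_def W_def S_def)
      show "continuous_on UNIV (\<pi> n)" for n unfolding \<pi>_def
        by (rule continuous_on_product_coordinates)
      show "{\<omega> \<in> space M. T \<omega> \<inter> C \<noteq> {}} \<in> sets M" if "closed C" for C
      proof -
        have "{\<omega> \<in> space M. T \<omega> \<inter> C \<noteq> {}} =
            {\<omega> \<in> space M. S m \<omega> \<inter> C \<noteq> {}} \<union> (if K \<inter> C \<noteq> {} then space M - W m else {})"
          by (auto simp: T_def W_def)
        then show ?thesis using S_hit[OF that, of m] W[of m] by auto
      qed
    qed blast+
    then obtain u where u: "\<And>\<omega>. \<omega> \<in> space M \<Longrightarrow> u \<omega> \<in> T \<omega>"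
      and u_meas: "\<And>n. (\<lambda>\<omega>. \<pi> n (u \<omega>)) \<in> borel_measurable M" by blast
    have u_K: "u \<omega> \<in> dual_family (\<lambda>_. 1)" if "\<omega> \<in> space M" for \<omega>
      using u[OF that] by (auto simp: T_def S_def K_def split: if_splits)
    define y where "y i \<omega> = Blinfun (\<lambda>z. u \<omega> (i, z))" for i \<omega>
    have y: "blinfun_apply (y i \<omega>) z = u \<omega> (i, z)" "norm (y i \<omega>) \<le> 1" if "\<omega> \<in> space M" for i \<omega> z
      unfolding y_def using dual_family_blinfun[OF u_K[OF that], of i] by auto
    have y_meas: "(\<lambda>\<omega>. blinfun_apply (y i \<omega>) (x n)) \<in> borel_measurable M" for i n
      using u_meas[of "prod_encode (i, n)"] by (simp add: \<pi>_def y(1) cong: measurable_cong)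
    have "\<forall>i. \<exists>\<beta> :: 'a \<Rightarrow> 'e \<Rightarrow>\<^sub>L real. strongly_measurable M \<beta> \<and> (\<forall>\<omega>. norm (\<beta> \<omega>) \<le> 1) \<and>
      (AE \<omega> in M. \<forall>n. blinfun_apply (\<beta> \<omega>) (x n) = blinfun_apply (y i \<omega>) (x n))"
      by (intro allI strongly_measurable_version[of "y _" x, OF rnp _ y_meas]) (rule y(2))
    from choice[OF this] obtain \<beta> :: "nat \<Rightarrow> 'a \<Rightarrow> 'e \<Rightarrow>\<^sub>L real" where
      \<beta>: "\<And>i. strongly_measurable M (\<beta> i)" "\<And>i \<omega>. norm (\<beta> i \<omega>) \<le> 1"
      and \<beta>y: "\<And>i. AE \<omega> in M. \<forall>n. blinfun_apply (\<beta> i \<omega>) (x n) = blinfun_apply (y i \<omega>) (x n)"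
        by blast
    \<comment> \<open>The constraint gives \<open>1 / m\<close> at the nearby point; returning to
      \<open>d k \<omega>\<close> costs at most \<open>1 / (2 * m)\<close> for
      \<open>k \<ge> 2 * m\<close>, so half remains.\<close>
    define Y where "Y i k = {\<omega> \<in> space M. 1 / real (2 * m) \<le> \<bar>blinfun_apply (\<beta> i \<omega>) (d k \<omega>)\<bar>}"
      for i k
    have Y_meas: "Y i k \<in> sets M" for i k
    proof -
      note [measurable] = strongly_measurable_blinfun_apply[OF \<beta>(1)[of i] d_meas[of k]]
      show ?thesis unfolding Y_def by measurable
    qed
    have "(\<lambda>k. \<Sum>i<m. prob (Y i k)) \<longlonglongrightarrow> (\<Sum>i<m. 0)"
      unfolding Y_def using \<open>m > 0\<close>
      by (intro tendsto_sum prob_pairing_ge_tendsto_0[OF d bound null \<beta>(1)]) simp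
    then have lim: "(\<lambda>k. \<Sum>i<m. prob (Y i k)) \<longlonglongrightarrow> 0" by simp
    have "prob (X k \<inter> W m) \<le> (\<Sum>i<m. prob (Y i k))" if "k \<ge> 2 * m" for k
    proof -
      have UY: "(\<Union>i<m. Y i k) \<in> sets M" using Y_meas by auto
      have "AE \<omega> in M. \<omega> \<in> X k \<inter> W m \<longrightarrow> \<omega> \<in> (\<Union>i<m. Y i k)"
        using AE_all_countable[THEN iffD2, OF allI, OF \<beta>y]
      proof (rule AE_mp[OF _ AE_I2], intro impI)
        fix \<omega> assume \<omega>: "\<omega> \<in> space M" "\<omega> \<in> X k \<inter> W m"
          and eq: "\<forall>i n. blinfun_apply (\<beta> i \<omega>) (x n) = blinfun_apply (y i \<omega>) (x n)"
        from u[OF \<omega>(1)] \<omega>(2) have "u \<omega> \<in> F m k (v k \<omega>)" by (auto simp: T_def S_def)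
        then obtain i where i: "i < m" "1 / real m \<le> \<bar>u \<omega> (i, x (N k \<omega>))\<bar>"
          using \<omega>(2) \<open>k \<ge> 2 * m\<close> by (auto simp: F_def v_def)
        then have "1 / real m \<le> \<bar>blinfun_apply (\<beta> i \<omega>) (x (N k \<omega>))\<bar>" using eq y(1)[OF \<omega>(1)] by simp
        moreover have "\<bar>blinfun_apply (\<beta> i \<omega>) (d k \<omega>) - blinfun_apply (\<beta> i \<omega>) (x (N k \<omega>))\<bar> \<le>
            1 / Suc k"
          using norm_blinfun[of "\<beta> i \<omega>" "d k \<omega> - x (N k \<omega>)"] N[OF \<omega>(1), of k]
            mult_right_mono[OF \<beta>(2)[of i \<omega>] norm_ge_zero[of "d k \<omega> - x (N k \<omega>)"]]
          by (simp add: blinfun.diff_right)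
        moreover have "1 / real (Suc k) \<le> 1 / real (2 * m)"
          using \<open>m > 0\<close> \<open>k \<ge> 2 * m\<close> by (intro divide_left_mono) auto
        moreover have "1 / real m = 1 / real (2 * m) + 1 / real (2 * m)" using \<open>m > 0\<close>
          by (simp add: field_simps)
        ultimately have "1 / real (2 * m) \<le> \<bar>blinfun_apply (\<beta> i \<omega>) (d k \<omega>)\<bar>" by linarith
        with \<omega>(1) i(1) show "\<omega> \<in> (\<Union>i<m. Y i k)" by (auto simp: Y_def)
      qed
      then have "prob (X k \<inter> W m) \<le> prob (\<Union>i<m. Y i k)" by (rule finite_measure_mono_AE[OF _ UY])
      also have "\<dots> \<le> (\<Sum>i<m. prob (Y i k))" using Y_meas by (intro measure_UNION_le) auto
      finally show ?thesis .
    qed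
    then have "\<forall>\<^sub>F k in sequentially. prob (X k \<inter> W m) \<le> (\<Sum>i<m. prob (Y i k))"
      unfolding eventually_sequentially by blast
    then show ?thesis by (intro tendsto_sandwich[OF _ _ tendsto_const lim]) auto
  qed
  have "(\<lambda>k. prob (X k)) \<longlonglongrightarrow> 0"
  proof (rule prob_tendsto_0_on_cover[of X "\<lambda>n. W (Suc n)", OF X W])
    show "(\<Union>n. W (Suc n)) = space M"
    proof
      show "(\<Union>n. W (Suc n)) \<subseteq> space M" by (auto simp: W_def)
      show "space M \<subseteq> (\<Union>n. W (Suc n))"
      proof
        fix \<omega> assume "\<omega> \<in> space M"
        from cover[OF this] obtain m where "m > 0" "\<omega> \<in> W m" by blast
        then have "\<omega> \<in> W (Suc (m - 1))" by simp
        then show "\<omega> \<in> (\<Union>n. W (Suc n))" by blast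
      qed
    qed
  qed (simp add: main)
  then show ?thesis by (simp add: X_def)
qed

text \<open>A Vitali argument: where \<open>g\<close> is below \<open>\<eta>\<close> it contributes
  at most \<open>\<eta>\<close>. The remaining set has small probability, and there the growth bound
  is controlled by equi-integrability of the norms and absolute continuity of
  \<open>\<phi>\<close>.\<close>

lemma (in prob_space) limited_integral_tendsto_0:
  fixes d :: "nat \<Rightarrow> 'a \<Rightarrow> 'e::banach" and g :: "'a \<Rightarrow> 'e \<Rightarrow> real"
  assumes d: "\<And>k. d k \<in> bochner_L1 M" and equi: "equi_integrable M (\<lambda>k \<omega>. norm (d k \<omega>))"
    and g_zero: "\<And>\<omega>. \<omega> \<in> space M \<Longrightarrow> g \<omega> 0 = 0"
    and g_meas: "\<And>k. (\<lambda>\<omega>. g \<omega> (d k \<omega>)) \<in> borel_measurable M"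
    and growth: "\<And>\<omega> x. \<omega> \<in> space M \<Longrightarrow> \<bar>g \<omega> x\<bar> \<le> C * norm x + \<phi> \<omega>" and "C > 0"
    and \<phi>: "integrable M \<phi>"
    and null: "\<And>\<eta>. \<eta> > 0 \<Longrightarrow> (\<lambda>k. prob {\<omega> \<in> space M. \<eta> \<le> \<bar>g \<omega> (d k \<omega>)\<bar>}) \<longlonglongrightarrow> 0"
  shows "(\<lambda>k. LINT \<omega>|M. g \<omega> (d k \<omega>)) \<longlonglongrightarrow> 0"
proof (rule tendstoI)
  fix \<epsilon> :: real assume "\<epsilon> > 0"
  \<comment> \<open>Three contributions of size \<open>\<eta>\<close> arise, from the set where
    \<open>g\<close> is small, from the norms and from \<open>\<phi>\<close>; a quarter leaves
    strict room.\<close>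
  define \<eta> where "\<eta> = \<epsilon> / 4"
  have "\<eta> > 0" using \<open>\<epsilon> > 0\<close> by (simp add: \<eta>_def)
  have d_int: "integrable M (\<lambda>\<omega>. norm (d k \<omega>))" for k using d[of k] by (simp add: bochner_L1_iff)
  have \<phi>_nonneg: "0 \<le> \<phi> \<omega>" if "\<omega> \<in> space M" for \<omega>
    using growth[OF that, of 0] g_zero[OF that] by simp
  have dom_int: "integrable M (\<lambda>\<omega>. C * norm (d k \<omega>) + \<phi> \<omega>)" for k using d_int \<phi> by simp
  have g_int: "integrable M (\<lambda>\<omega>. g \<omega> (d k \<omega>))" for k
  proof (rule Bochner_Integration.integrable_bound[OF dom_int g_meas])
    show "AE \<omega> in M. norm (g \<omega> (d k \<omega>)) \<le> norm (C * norm (d k \<omega>) + \<phi> \<omega>)"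
      using growth by (intro AE_I2) (auto intro: order_trans[OF _ abs_ge_self])
  qed
  have "\<phi> \<in> bochner_L1 M"
    using \<phi> by (simp add: bochner_L1_iff strongly_measurable_borel)
  then have "\<exists>\<delta>>0. \<forall>A\<in>sets M. measure M A < \<delta> \<longrightarrow> (LINT \<omega>|M. indicator A \<omega> * norm (\<phi> \<omega>)) \<le> \<eta>"
    by (rule bochner_L1_absolutely_continuous[OF _ \<open>\<eta> > 0\<close>]) blast
  then obtain \<delta>1 where \<delta>1: "\<delta>1 > 0" "\<And>A. A \<in> sets M \<Longrightarrow> measure M A < \<delta>1 \<Longrightarrow>
      (LINT \<omega>|M. indicator A \<omega> * norm (\<phi> \<omega>)) \<le> \<eta>" by blast
  have "\<eta> / C > 0" using \<open>\<eta> > 0\<close> \<open>C > 0\<close> by simp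
  then have "\<exists>\<delta>>0. \<forall>k. \<forall>A\<in>sets M. measure M A < \<delta> \<longrightarrow>
      (LINT \<omega>|M. indicator A \<omega> * \<bar>norm (d k \<omega>)\<bar>) \<le> \<eta> / C"
    using equi unfolding equi_integrable_def by blast
  then obtain \<delta>2 where \<delta>2: "\<delta>2 > 0" "\<And>k A. A \<in> sets M \<Longrightarrow> measure M A < \<delta>2 \<Longrightarrow>
      (LINT \<omega>|M. indicator A \<omega> * \<bar>norm (d k \<omega>)\<bar>) \<le> \<eta> / C" by blast
  have "\<forall>\<^sub>F k in sequentially. prob {\<omega> \<in> space M. \<eta> \<le> \<bar>g \<omega> (d k \<omega>)\<bar>} < min \<delta>1 \<delta>2"
    using null[OF \<open>\<eta> > 0\<close>] \<delta>1(1) \<delta>2(1) by (intro order_tendstoD) auto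
  then show "\<forall>\<^sub>F k in sequentially. dist (LINT \<omega>|M. g \<omega> (d k \<omega>)) 0 < \<epsilon>"
  proof eventually_elim
    fix k
    define A where "A = {\<omega> \<in> space M. \<eta> \<le> \<bar>g \<omega> (d k \<omega>)\<bar>}"
    assume "prob {\<omega> \<in> space M. \<eta> \<le> \<bar>g \<omega> (d k \<omega>)\<bar>} < min \<delta>1 \<delta>2"
    then have small: "prob A < \<delta>1" "prob A < \<delta>2" by (auto simp: A_def)
    have A: "A \<in> sets M" unfolding A_def using g_meas[of k] by measurable
    have int_1: "integrable M (\<lambda>\<omega>. indicator A \<omega> * norm (d k \<omega>))"
      using integrable_mult_indicator[OF A d_int] by simp
    have int_2: "integrable M (\<lambda>\<omega>. indicator A \<omega> * norm (\<phi> \<omega>))"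
      using integrable_mult_indicator[OF A integrable_norm[OF \<phi>]] by simp
    have "\<bar>LINT \<omega>|M. g \<omega> (d k \<omega>)\<bar> \<le> (LINT \<omega>|M. \<bar>g \<omega> (d k \<omega>)\<bar>)"
      by (rule integral_abs_bound)
    also have "\<dots> \<le> (LINT \<omega>|M. \<eta> + (C * (indicator A \<omega> * norm (d k \<omega>)) +
        indicator A \<omega> * norm (\<phi> \<omega>)))"
    proof (rule integral_mono[OF integrable_abs[OF g_int]])
      show "integrable M (\<lambda>\<omega>. \<eta> + (C * (indicator A \<omega> * norm (d k \<omega>)) +
          indicator A \<omega> * norm (\<phi> \<omega>)))"
        using int_1 int_2 by simp
      fix \<omega> assume \<omega>: "\<omega> \<in> space M"
      show "\<bar>g \<omega> (d k \<omega>)\<bar> \<le> \<eta> + (C * (indicator A \<omega> * norm (d k \<omega>)) + indicator A \<omega> * norm (\<phi> \<omega>))"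
      proof (cases "\<omega> \<in> A")
        case True
        then show ?thesis using growth[OF \<omega>, of "d k \<omega>"] \<phi>_nonneg[OF \<omega>] \<open>\<eta> > 0\<close> by simp
      qed (use \<omega> in \<open>simp add: A_def\<close>)
    qed
    also have "\<dots> = \<eta> + (C * (LINT \<omega>|M. indicator A \<omega> * norm (d k \<omega>)) +
        (LINT \<omega>|M. indicator A \<omega> * norm (\<phi> \<omega>)))"
      using int_1 int_2 by (simp add: prob_space)
    also have "\<dots> \<le> \<eta> + (C * (\<eta> / C) + \<eta>)"
      using \<delta>1(2)[OF A small(1)] \<delta>2(2)[OF A small(2), of k] \<open>C > 0\<close>
      by (intro add_mono mult_left_mono) auto
    also have "\<dots> < \<epsilon>" using \<open>C > 0\<close> \<open>\<epsilon> > 0\<close> by (simp add: \<eta>_def)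
    finally show "dist (LINT \<omega>|M. g \<omega> (d k \<omega>)) 0 < \<epsilon>" by simp
  qed
qed

section \<open>Oscillation on small sets and stability of the Bocce criterion\<close>

text \<open>The range is cut into countably many slabs of width \<open>\<delta>\<close>; their
  preimages cover \<open>B\<close>, so not all of them are null.\<close>

lemma (in finite_measure) exists_small_oscillation_set:
  fixes q :: "'a \<Rightarrow> real"
  assumes q[measurable]: "q \<in> borel_measurable M" and B: "B \<in> pos_sets M" and "\<delta> > 0"
  shows "\<exists>A\<in>pos_sets M. A \<subseteq> B \<and> (\<exists>a. \<forall>\<omega>\<in>A. a \<le> q \<omega> \<and> q \<omega> \<le> a + \<delta>)"
proof -
  define D where "D n = B \<inter> {\<omega> \<in> space M. \<lfloor>q \<omega> / \<delta>\<rfloor> = n}" for n :: int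
  have B_sets[measurable]: "B \<in> sets M" and B_pos: "measure M B > 0" using B
    by (auto simp: pos_sets_def)
  have D: "D n \<in> sets M" for n unfolding D_def by measurable
  have "B = (\<Union>n. D n)" using sets.sets_into_space[OF B_sets] by (auto simp: D_def)
  have "\<exists>n. measure M (D n) \<noteq> 0"
  proof (rule ccontr)
    assume "\<not> ?thesis"
    then have "D n \<in> null_sets M" for n using D by (auto simp: null_sets_def emeasure_eq_measure)
    then have "B \<in> null_sets M" unfolding \<open>B = (\<Union>n. D n)\<close> by (intro null_sets_UN)
    with B_pos show False by (simp add: null_sets_def emeasure_eq_measure)
  qed
  then obtain n where "measure M (D n) \<noteq> 0" by blast
  then have "D n \<in> pos_sets M" using D by (auto simp: pos_sets_def zero_less_measure_iff)
  moreover have "D n \<subseteq> B" by (auto simp: D_def)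
  moreover have "of_int n * \<delta> \<le> q \<omega> \<and> q \<omega> \<le> of_int n * \<delta> + \<delta>" if "\<omega> \<in> D n" for \<omega>
  proof -
    have "of_int n \<le> q \<omega> / \<delta>" "q \<omega> / \<delta> < of_int n + 1" using that by (auto simp: D_def floor_eq_iff)
    then show ?thesis using \<open>\<delta> > 0\<close> by (simp add: field_simps)
  qed
  ultimately show ?thesis by blast
qed

lemma set_mean_eq: "set_mean M A h = (LINT \<omega>|M. indicator A \<omega> * h \<omega>) / measure M A"
  by (simp add: set_mean_def set_lebesgue_integral_def)

lemma bocce_osc_eq:
  "bocce_osc M h A = (LINT \<omega>|M. indicator A \<omega> * \<bar>h \<omega> - set_mean M A h\<bar>) / measure M A"
  by (simp add: bocce_osc_def set_lebesgue_integral_def)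

context finite_measure
begin

lemma integrable_indicator_mult:
  fixes h :: "'a \<Rightarrow> real"
  assumes "A \<in> sets M" and "integrable M h"
  shows "integrable M (\<lambda>\<omega>. indicator A \<omega> * h \<omega>)"
  using integrable_mult_indicator[OF assms] by simp

lemma bocce_osc_add_le:
  assumes h: "integrable M h" and q: "integrable M q" and A: "A \<in> pos_sets M"
  shows "bocce_osc M (\<lambda>\<omega>. h \<omega> + q \<omega>) A \<le> bocce_osc M h A + bocce_osc M q A"
proof -
  have A_sets: "A \<in> sets M" and A_pos: "measure M A > 0" using A by (auto simp: pos_sets_def)
  note ind = integrable_indicator_mult[OF A_sets]
  have mean: "set_mean M A (\<lambda>\<omega>. h \<omega> + q \<omega>) = set_mean M A h + set_mean M A q"
    using ind[OF h] ind[OF q] by (simp add: set_mean_eq distrib_left add_divide_distrib)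
  let ?I = "\<lambda>f \<omega>. indicator A \<omega> * \<bar>f \<omega> - set_mean M A f\<bar>"
  have int: "integrable M (?I f)" if "integrable M f" for f using that by (intro ind) simp
  have "(LINT \<omega>|M. ?I (\<lambda>\<omega>. h \<omega> + q \<omega>) \<omega>) \<le> (LINT \<omega>|M. ?I h \<omega> + ?I q \<omega>)"
  proof (rule integral_mono)
    show "integrable M (?I (\<lambda>\<omega>. h \<omega> + q \<omega>))" using h q by (intro int) simp
    show "integrable M (\<lambda>\<omega>. ?I h \<omega> + ?I q \<omega>)" using int[OF h] int[OF q] by simp
  qed (auto simp: mean indicator_def abs_if)
  also have "\<dots> = (LINT \<omega>|M. ?I h \<omega>) + (LINT \<omega>|M. ?I q \<omega>)" using int[OF h] int[OF q] by simp
  finally show ?thesis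
    using A_pos by (simp add: bocce_osc_eq divide_right_mono flip: add_divide_distrib)
qed

text \<open>Any constant may replace the mean at the cost of a factor 2, because the mean itself
  differs from \<open>a\<close> by no more than the average of the modulus of
  \<open>h - a\<close>.\<close>

lemma bocce_osc_le:
  assumes h: "integrable M h" and A: "A \<in> pos_sets M"
  shows "bocce_osc M h A \<le> 2 * (LINT \<omega>|M. indicator A \<omega> * \<bar>h \<omega> - a\<bar>) / measure M A"
proof -
  have A_sets: "A \<in> sets M" and A_pos: "measure M A > 0" using A by (auto simp: pos_sets_def)
  note ind = integrable_indicator_mult[OF A_sets]
  have int_A: "integrable M (indicat_real A)"
    using A_sets by (simp add: integrable_real_indicator less_top[symmetric])
  define m where "m = set_mean M A h"
  have int_a: "integrable M (\<lambda>\<omega>. indicator A \<omega> * \<bar>h \<omega> - a\<bar>)" using h by (intro ind) simp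
  have "(m - a) * measure M A = (LINT \<omega>|M. indicator A \<omega> * (h \<omega> - a))"
    using ind[OF h] int_A A_sets A_pos
      by (simp add: m_def set_mean_eq right_diff_distrib left_diff_distrib)
  then have "\<bar>m - a\<bar> * measure M A = \<bar>LINT \<omega>|M. indicator A \<omega> * (h \<omega> - a)\<bar>"
    by (metis abs_mult abs_of_nonneg measure_nonneg)
  also have "\<dots> \<le> (LINT \<omega>|M. \<bar>indicator A \<omega> * (h \<omega> - a)\<bar>)" by (rule integral_abs_bound)
  also have "\<dots> = (LINT \<omega>|M. indicator A \<omega> * \<bar>h \<omega> - a\<bar>)" by (simp add: abs_mult)
  finally have m: "\<bar>m - a\<bar> * measure M A \<le> (LINT \<omega>|M. indicator A \<omega> * \<bar>h \<omega> - a\<bar>)" .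
  have "(LINT \<omega>|M. indicator A \<omega> * \<bar>h \<omega> - m\<bar>) \<le>
      (LINT \<omega>|M. indicator A \<omega> * \<bar>h \<omega> - a\<bar> + \<bar>m - a\<bar> * indicator A \<omega>)"
  proof (rule integral_mono)
    show "integrable M (\<lambda>\<omega>. indicator A \<omega> * \<bar>h \<omega> - m\<bar>)" using h by (intro ind) simp
    show "integrable M (\<lambda>\<omega>. indicator A \<omega> * \<bar>h \<omega> - a\<bar> + \<bar>m - a\<bar> * indicator A \<omega>)"
      using int_a int_A by simp
  qed (auto simp: indicator_def abs_if)
  also have "\<dots> = (LINT \<omega>|M. indicator A \<omega> * \<bar>h \<omega> - a\<bar>) + \<bar>m - a\<bar> * measure M A"
    using int_a int_A A_sets by simp
  finally have "(LINT \<omega>|M. indicator A \<omega> * \<bar>h \<omega> - m\<bar>) \<le> 2 * (LINT \<omega>|M. indicator A \<omega> * \<bar>h \<omega> - a\<bar>)"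
    using m by simp
  then show ?thesis unfolding bocce_osc_eq m_def by (rule divide_right_mono) simp
qed

end

text \<open>On a suitable \<open>B'\<close> inside \<open>B\<close> the fixed function
  \<open>q\<close> varies by at most \<open>\<epsilon> / 4\<close>, and it does so on every subset.
  The criterion for \<open>h\<close> is therefore applied inside \<open>B'\<close>; the factor 2 of
  \<open>bocce_osc_le\<close> leaves \<open>\<epsilon> / 2\<close> for each summand.\<close>

lemma (in finite_measure) sequential_bocce_criterion_add:
  fixes h :: "nat \<Rightarrow> 'a \<Rightarrow> real" and q :: "'a \<Rightarrow> real"
  assumes bocce: "sequential_bocce_criterion M h"
    and h: "\<And>k. integrable M (h k)" and q: "integrable M q"
  shows "sequential_bocce_criterion M (\<lambda>k \<omega>. h k \<omega> + q \<omega>)"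
  unfolding sequential_bocce_criterion_def
proof (intro allI impI ballI)
  fix r :: "nat \<Rightarrow> nat" and \<epsilon> :: real and B
  assume r: "strict_mono r" and "\<epsilon> > 0" and B: "B \<in> pos_sets M"
  have "\<epsilon> / 2 > 0" "\<epsilon> / 4 > 0" using \<open>\<epsilon> > 0\<close> by auto
  from exists_small_oscillation_set[OF borel_measurable_integrable[OF q] B this(2)]
  obtain B' a where B': "B' \<in> pos_sets M" "B' \<subseteq> B"
    and a: "\<And>\<omega>. \<omega> \<in> B' \<Longrightarrow> a \<le> q \<omega> \<and> q \<omega> \<le> a + \<epsilon> / 4" by blast
  from bocce r \<open>\<epsilon> / 2 > 0\<close> B'(1) obtain A where A: "A \<in> pos_sets M" "A \<subseteq> B'"
    and lim: "liminf (\<lambda>j. ereal (bocce_osc M (h (r j)) A)) < ereal (\<epsilon> / 2)"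
    unfolding sequential_bocce_criterion_def by blast
  have A_sets: "A \<in> sets M" and A_pos: "measure M A > 0" using A(1) by (auto simp: pos_sets_def)
  have "(LINT \<omega>|M. indicator A \<omega> * \<bar>q \<omega> - a\<bar>) \<le> (LINT \<omega>|M. (\<epsilon> / 4) * indicator A \<omega>)"
  proof (rule integral_mono)
    show "integrable M (\<lambda>\<omega>. indicator A \<omega> * \<bar>q \<omega> - a\<bar>)"
      using q by (intro integrable_indicator_mult A_sets) simp
    have "integrable M (indicat_real A)"
      using A_sets by (simp add: integrable_real_indicator less_top[symmetric])
    then show "integrable M (\<lambda>\<omega>. (\<epsilon> / 4) * indicat_real A \<omega>)" by simp
    show "indicator A \<omega> * \<bar>q \<omega> - a\<bar> \<le> (\<epsilon> / 4) * indicator A \<omega>" for \<omega>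
      using a[of \<omega>] A(2) by (cases "\<omega> \<in> A") auto
  qed
  also have "\<dots> = (\<epsilon> / 4) * measure M A" using A_sets by simp
  finally have "2 * (LINT \<omega>|M. indicator A \<omega> * \<bar>q \<omega> - a\<bar>) / measure M A \<le> \<epsilon> / 2"
    using A_pos by (simp add: pos_divide_le_eq)
  then have "bocce_osc M q A \<le> \<epsilon> / 2" by (rule order_trans[OF bocce_osc_le[OF q A(1)]])
  then have "bocce_osc M (\<lambda>\<omega>. h k \<omega> + q \<omega>) A \<le> bocce_osc M (h k) A + \<epsilon> / 2" for k
    using bocce_osc_add_le[OF h[of k] q A(1)] by linarith
  then have "liminf (\<lambda>j. ereal (bocce_osc M (\<lambda>\<omega>. h (r j) \<omega> + q \<omega>) A)) \<le>
      liminf (\<lambda>j. ereal (bocce_osc M (h (r j)) A) + ereal (\<epsilon> / 2))"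
    by (intro Liminf_mono always_eventually) simp
  also have "\<dots> = liminf (\<lambda>j. ereal (bocce_osc M (h (r j)) A)) + ereal (\<epsilon> / 2)"
    by (rule Liminf_add_ereal_right) auto
  also have "\<dots> < ereal (\<epsilon> / 2) + ereal (\<epsilon> / 2)"
    using lim by (cases "liminf (\<lambda>j. ereal (bocce_osc M (h (r j)) A))") auto
  also have "\<dots> = ereal \<epsilon>" by simp
  finally show "\<exists>A\<in>pos_sets M. A \<subseteq> B \<and>
      liminf (\<lambda>j. ereal (bocce_osc M (\<lambda>\<omega>. h (r j) \<omega> + q \<omega>) A)) < ereal \<epsilon>"
    using A B'(2) by blast
qed

text \<open>No smaller set has to be found: on the given set the oscillation is at most twice the
  mean modulus, by comparison with the constant 0.\<close>

lemma (in finite_measure) L1_null_imp_bocce: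
  fixes h :: "nat \<Rightarrow> 'a \<Rightarrow> real"
  assumes h: "\<And>k. integrable M (h k)" and null: "(\<lambda>k. LINT \<omega>|M. \<bar>h k \<omega>\<bar>) \<longlonglongrightarrow> 0"
  shows "sequential_bocce_criterion M h"
  unfolding sequential_bocce_criterion_def
proof (intro allI impI ballI)
  fix r :: "nat \<Rightarrow> nat" and \<epsilon> :: real and A
  assume r: "strict_mono r" and "\<epsilon> > 0" and A: "A \<in> pos_sets M"
  have A_sets: "A \<in> sets M" and A_pos: "measure M A > 0" using A by (auto simp: pos_sets_def)
  have le: "bocce_osc M (h k) A \<le> 2 * (LINT \<omega>|M. \<bar>h k \<omega>\<bar>) / measure M A" for k
  proof -
    have "(LINT \<omega>|M. indicator A \<omega> * \<bar>h k \<omega>\<bar>) \<le> (LINT \<omega>|M. \<bar>h k \<omega>\<bar>)"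
      by (rule integral_mono[OF integrable_indicator_mult[OF A_sets integrable_abs[OF h]]
            integrable_abs[OF h]]) (simp add: indicator_def)
    then have "2 * (LINT \<omega>|M. indicator A \<omega> * \<bar>h k \<omega>\<bar>) / measure M A \<le>
        2 * (LINT \<omega>|M. \<bar>h k \<omega>\<bar>) / measure M A" by (intro divide_right_mono) auto
    with bocce_osc_le[OF h A, of k 0] show ?thesis by simp
  qed
  have "(\<lambda>j. LINT \<omega>|M. \<bar>h (r j) \<omega>\<bar>) \<longlonglongrightarrow> 0"
    using LIMSEQ_subseq_LIMSEQ[OF null r] by (simp add: o_def)
  then have "(\<lambda>j. 2 * (LINT \<omega>|M. \<bar>h (r j) \<omega>\<bar>) / measure M A) \<longlonglongrightarrow> 2 * 0 / measure M A"
    using A_pos by (intro tendsto_intros) auto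
  then have "\<forall>\<^sub>F j in sequentially. 2 * (LINT \<omega>|M. \<bar>h (r j) \<omega>\<bar>) / measure M A < \<epsilon> / 2"
    using \<open>\<epsilon> > 0\<close> by (intro order_tendstoD) auto
  then have "\<forall>\<^sub>F j in sequentially. ereal (bocce_osc M (h (r j)) A) \<le> ereal (\<epsilon> / 2)"
  proof eventually_elim
    fix j assume "2 * (LINT \<omega>|M. \<bar>h (r j) \<omega>\<bar>) / measure M A < \<epsilon> / 2"
    with le[of "r j"] show "ereal (bocce_osc M (h (r j)) A) \<le> ereal (\<epsilon> / 2)" by simp
  qed
  then have "liminf (\<lambda>j. ereal (bocce_osc M (h (r j)) A)) \<le> liminf (\<lambda>j. ereal (\<epsilon> / 2))"
    by (rule Liminf_mono)
  also have "\<dots> < ereal \<epsilon>" using \<open>\<epsilon> > 0\<close> by (simp add: Liminf_const)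
  finally show "\<exists>A'\<in>pos_sets M. A' \<subseteq> A \<and> liminf (\<lambda>j. ereal (bocce_osc M (h (r j)) A')) < ereal \<epsilon>"
    using A by blast
qed

section \<open>The dual of the space of integrable functions\<close>

lemma (in finite_measure) L1_dual_pairing:
  fixes b :: "'a \<Rightarrow> 'e::banach \<Rightarrow>\<^sub>L real"
  assumes b: "b \<in> bochner_Linf M"
  shows "(\<lambda>f. LINT \<omega>|M. blinfun_apply (b \<omega>) (f \<omega>)) \<in> L1_dual M"
proof -
  obtain C where meas: "strongly_measurable M b" and C: "\<And>\<omega>. \<omega> \<in> space M \<Longrightarrow> norm (b \<omega>) \<le> C"
    using b by (auto simp: bochner_Linf_def)
  note pairing = bochner_L1_pairing[of _ b C, OF _ meas C]
  show ?thesis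
    unfolding L1_dual_def
  proof (intro CollectI conjI ballI allI exI)
    fix f h :: "'a \<Rightarrow> 'e" assume "f \<in> bochner_L1 M" "h \<in> bochner_L1 M"
    then show "(LINT \<omega>|M. blinfun_apply (b \<omega>) (f \<omega> + h \<omega>)) =
        (LINT \<omega>|M. blinfun_apply (b \<omega>) (f \<omega>)) + (LINT \<omega>|M. blinfun_apply (b \<omega>) (h \<omega>))"
      using pairing(1) by (simp add: blinfun.add_right)
  next
    fix f :: "'a \<Rightarrow> 'e" assume f: "f \<in> bochner_L1 M"
    show "(LINT \<omega>|M. blinfun_apply (b \<omega>) (c *\<^sub>R f \<omega>)) = c * (LINT \<omega>|M. blinfun_apply (b \<omega>) (f \<omega>))"
      for c
      by (simp add: blinfun.scaleR_right)
    show "\<bar>LINT \<omega>|M. blinfun_apply (b \<omega>) (f \<omega>)\<bar> \<le> C * L1_seminorm M f"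
      using pairing(2)[OF f] by (simp add: L1_seminorm_def)
  qed
qed

lemma L1_dual_add:
  "\<Lambda> \<in> L1_dual M \<Longrightarrow> f \<in> bochner_L1 M \<Longrightarrow> h \<in> bochner_L1 M \<Longrightarrow> \<Lambda> (\<lambda>\<omega>. f \<omega> + h \<omega>) = \<Lambda> f + \<Lambda> h"
  by (simp add: L1_dual_def)

lemma L1_dual_scaleR:
  "\<Lambda> \<in> L1_dual M \<Longrightarrow> f \<in> bochner_L1 M \<Longrightarrow> \<Lambda> (\<lambda>\<omega>. c *\<^sub>R f \<omega>) = c * \<Lambda> f"
  by (simp add: L1_dual_def)

lemma L1_dual_bounded:
  assumes "\<Lambda> \<in> L1_dual M"
  shows "\<exists>C. \<forall>f\<in>bochner_L1 M. \<bar>\<Lambda> f\<bar> \<le> C * L1_seminorm M f"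
  using assms by (simp add: L1_dual_def)

lemma (in finite_measure) L1_dual_sum:
  assumes \<Lambda>: "\<Lambda> \<in> L1_dual M" and "finite V" and f: "\<And>v. v \<in> V \<Longrightarrow> f v \<in> bochner_L1 M"
  shows "(\<lambda>\<omega>. \<Sum>v\<in>V. f v \<omega>) \<in> bochner_L1 M \<and> \<Lambda> (\<lambda>\<omega>. \<Sum>v\<in>V. f v \<omega>) = (\<Sum>v\<in>V. \<Lambda> (f v))"
  using \<open>finite V\<close> f
proof (induction V)
  case empty
  have zero: "(\<lambda>_. 0 :: 'b) \<in> bochner_L1 M" by (rule bochner_L1_simple) simp
  from L1_dual_scaleR[OF \<Lambda> this, of 0] zero show ?case by simp
next
  case (insert v V)
  then have "f v \<in> bochner_L1 M" "(\<lambda>\<omega>. \<Sum>v\<in>V. f v \<omega>) \<in> bochner_L1 M" by auto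
  from bochner_L1_add[OF this] L1_dual_add[OF \<Lambda> this] show ?case using insert by simp
qed

lemma (in finite_measure) simple_function_sum_indicator:
  fixes s :: "'a \<Rightarrow> 'e::real_vector"
  assumes s: "simple_function M s"
  defines "D \<equiv> \<lambda>v. {\<omega> \<in> space M. s \<omega> = v}"
  shows "D v \<in> sets M"
    and "\<omega> \<in> space M \<Longrightarrow> s \<omega> = (\<Sum>v\<in>s ` space M. indicat_real (D v) \<omega> *\<^sub>R v)"
proof -
  have "D v = s -` {v} \<inter> space M" by (auto simp: D_def)
  then show "D v \<in> sets M" using simple_functionD(2)[OF s] by simp
  assume \<omega>: "\<omega> \<in> space M"
  have "(\<Sum>v\<in>s ` space M. indicat_real (D v) \<omega> *\<^sub>R v) = (\<Sum>v\<in>s ` space M. if v = s \<omega> then v else 0)"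
    using \<omega> by (intro sum.cong) (auto simp: D_def indicator_def)
  then show "s \<omega> = (\<Sum>v\<in>s ` space M. indicat_real (D v) \<omega> *\<^sub>R v)"
    using \<omega> simple_functionD(1)[OF s] by simp
qed

text \<open>Indicators times vectors span the simple functions, which are dense for the seminorm,
  and both functionals are bounded by it.\<close>

lemma (in finite_measure) L1_dual_eqI:
  fixes \<Lambda> \<Gamma> :: "('a \<Rightarrow> 'e::banach) \<Rightarrow> real"
  assumes \<Lambda>: "\<Lambda> \<in> L1_dual M" and \<Gamma>: "\<Gamma> \<in> L1_dual M" and f: "f \<in> bochner_L1 M"
    and eq: "\<And>A x. A \<in> sets M \<Longrightarrow> \<Lambda> (\<lambda>\<omega>. indicat_real A \<omega> *\<^sub>R x) = \<Gamma> (\<lambda>\<omega>. indicat_real A \<omega> *\<^sub>R x)"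
  shows "\<Lambda> f = \<Gamma> f"
proof -
  obtain C1 where C1: "\<And>h. h \<in> bochner_L1 M \<Longrightarrow> \<bar>\<Lambda> h\<bar> \<le> C1 * L1_seminorm M h"
    using L1_dual_bounded[OF \<Lambda>] by blast
  obtain C2 where C2: "\<And>h. h \<in> bochner_L1 M \<Longrightarrow> \<bar>\<Gamma> h\<bar> \<le> C2 * L1_seminorm M h"
    using L1_dual_bounded[OF \<Gamma>] by blast
  \<comment> \<open>Functionals are evaluated at functions that may differ off
    \<open>space M\<close>. The difference has seminorm 0, hence value 0.\<close>
  have cong: "\<Psi> h = \<Psi> h'"
    if \<Psi>: "\<Psi> \<in> L1_dual M" and h: "h \<in> bochner_L1 M" "h' \<in> bochner_L1 M"
      and "\<And>\<omega>. \<omega> \<in> space M \<Longrightarrow> h \<omega> = h' \<omega>" for \<Psi> and h h' :: "'a \<Rightarrow> 'e"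
  proof -
    have "\<Psi> (\<lambda>\<omega>. h' \<omega> + (h \<omega> - h' \<omega>)) = \<Psi> h' + \<Psi> (\<lambda>\<omega>. h \<omega> - h' \<omega>)"
      by (rule L1_dual_add[OF \<Psi> h(2) bochner_L1_diff[OF h]])
    moreover obtain C where "\<bar>\<Psi> (\<lambda>\<omega>. h \<omega> - h' \<omega>)\<bar> \<le> C * L1_seminorm M (\<lambda>\<omega>. h \<omega> - h' \<omega>)"
      using L1_dual_bounded[OF \<Psi>] bochner_L1_diff[OF h] by blast
    moreover have "L1_seminorm M (\<lambda>\<omega>. h \<omega> - h' \<omega>) = (LINT \<omega>|M. 0)"
      unfolding L1_seminorm_def using that(4) by (intro Bochner_Integration.integral_cong) auto
    ultimately show ?thesis by simp
  qed
  have simple: "\<Lambda> s = \<Gamma> s" if s: "simple_function M s" for s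
  proof -
    let ?f = "\<lambda>v \<omega>. indicat_real {\<omega> \<in> space M. s \<omega> = v} \<omega> *\<^sub>R v"
    have ind: "?f v \<in> bochner_L1 M" for v
      by (rule bochner_L1_indicator[OF simple_function_sum_indicator(1)[OF s]])
    have fin: "finite (s ` space M)" by (rule simple_functionD(1)[OF s])
    have s_eq: "s \<omega> = (\<Sum>v\<in>s ` space M. ?f v \<omega>)" if "\<omega> \<in> space M" for \<omega>
      by (rule simple_function_sum_indicator(2)[OF s that])
    have "\<Psi> s = (\<Sum>v\<in>s ` space M. \<Psi> (?f v))" if \<Psi>: "\<Psi> \<in> L1_dual M" for \<Psi>
    proof -
      have sum: "(\<lambda>\<omega>. \<Sum>v\<in>s ` space M. ?f v \<omega>) \<in> bochner_L1 M"
        "\<Psi> (\<lambda>\<omega>. \<Sum>v\<in>s ` space M. ?f v \<omega>) = (\<Sum>v\<in>s ` space M. \<Psi> (?f v))"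
        using L1_dual_sum[OF \<Psi> fin, of ?f] ind by auto
      have "\<Psi> s = \<Psi> (\<lambda>\<omega>. \<Sum>v\<in>s ` space M. ?f v \<omega>)"
        by (rule cong[OF \<Psi> bochner_L1_simple[OF s] sum(1) s_eq])
      with sum(2) show ?thesis by simp
    qed
    from this[OF \<Lambda>] this[OF \<Gamma>] show ?thesis
      using eq[OF simple_function_sum_indicator(1)[OF s]] by simp
  qed
  have "\<bar>\<Lambda> f - \<Gamma> f\<bar> \<le> \<epsilon>" if "\<epsilon> > 0" for \<epsilon> :: real
  proof -
    define e where "e = \<epsilon> / (\<bar>C1\<bar> + \<bar>C2\<bar> + 1)"
    have den: "\<bar>C1\<bar> + \<bar>C2\<bar> + 1 > 0" by simp
    then have "e > 0" using that by (simp add: e_def)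
    obtain s where s: "simple_function M s" and fs: "(LINT \<omega>|M. norm (f \<omega> - s \<omega>)) < e"
      by (rule bochner_L1_approx[OF f \<open>e > 0\<close>])
    have diff: "(\<lambda>\<omega>. f \<omega> - s \<omega>) \<in> bochner_L1 M"
      by (rule bochner_L1_diff[OF f bochner_L1_simple[OF s]])
    have "\<Psi> (\<lambda>\<omega>. s \<omega> + (f \<omega> - s \<omega>)) = \<Psi> s + \<Psi> (\<lambda>\<omega>. f \<omega> - s \<omega>)" if "\<Psi> \<in> L1_dual M" for \<Psi>
      by (rule L1_dual_add[OF that bochner_L1_simple[OF s] diff])
    from this[OF \<Lambda>] this[OF \<Gamma>] simple[OF s]
    have "\<Lambda> f - \<Gamma> f = \<Lambda> (\<lambda>\<omega>. f \<omega> - s \<omega>) - \<Gamma> (\<lambda>\<omega>. f \<omega> - s \<omega>)" by simp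
    also have "\<bar>\<dots>\<bar> \<le> C1 * L1_seminorm M (\<lambda>\<omega>. f \<omega> - s \<omega>) + C2 * L1_seminorm M (\<lambda>\<omega>. f \<omega> - s \<omega>)"
      using C1[OF diff] C2[OF diff] by linarith
    also have "\<dots> \<le> (\<bar>C1\<bar> + \<bar>C2\<bar> + 1) * L1_seminorm M (\<lambda>\<omega>. f \<omega> - s \<omega>)"
    proof -
      have "0 \<le> L1_seminorm M (\<lambda>\<omega>. f \<omega> - s \<omega>)" by (simp add: L1_seminorm_def)
      then show ?thesis unfolding distrib_right[symmetric] by (intro mult_right_mono) auto
    qed
    also have "\<dots> \<le> (\<bar>C1\<bar> + \<bar>C2\<bar> + 1) * e"
      using fs by (intro mult_left_mono) (auto simp: L1_seminorm_def)
    also have "\<dots> = \<epsilon>" using den by (simp add: e_def)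
    finally show ?thesis .
  qed
  note small = this
  have "\<bar>\<Lambda> f - \<Gamma> f\<bar> \<le> 0" by (rule field_le_epsilon) (use small in simp)
  then show ?thesis by simp
qed

text \<open>Evaluating \<open>\<Lambda>\<close> at an indicator times a vector defines an additive
  set function with values in the dual, dominated by the bound of \<open>\<Lambda>\<close> times the
  measure; its bounded density is the representing field.\<close>

lemma (in finite_measure) L1_dual_representation:
  fixes \<Lambda> :: "('a \<Rightarrow> 'e::banach) \<Rightarrow> real"
  assumes rnp: "radon_nikodym_property_wrt M TYPE('e \<Rightarrow>\<^sub>L real)" and \<Lambda>: "\<Lambda> \<in> L1_dual M"
  shows "\<exists>b\<in>bochner_Linf M. \<forall>f\<in>bochner_L1 M. \<Lambda> f = (LINT \<omega>|M. blinfun_apply (b \<omega>) (f \<omega>))"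
proof -
  note add = L1_dual_add[OF \<Lambda>] and scale = L1_dual_scaleR[OF \<Lambda>]
  obtain C0 where C0: "\<And>f. f \<in> bochner_L1 M \<Longrightarrow> \<bar>\<Lambda> f\<bar> \<le> C0 * L1_seminorm M f"
    using L1_dual_bounded[OF \<Lambda>] by blast
  define C where "C = \<bar>C0\<bar>"
  have C: "\<bar>\<Lambda> f\<bar> \<le> C * L1_seminorm M f" if "f \<in> bochner_L1 M" for f
  proof -
    have "C0 * L1_seminorm M f \<le> C * L1_seminorm M f"
      by (intro mult_right_mono) (auto simp: C_def L1_seminorm_def)
    with C0[OF that] show ?thesis by linarith
  qed
  define ind where "ind A x \<omega> = indicat_real A \<omega> *\<^sub>R x" for A :: "'a set" and x :: 'e and \<omega>
  have ind: "ind A x \<in> bochner_L1 M" if "A \<in> sets M" for A x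
    unfolding ind_def by (rule bochner_L1_indicator[OF that])
  have seminorm: "L1_seminorm M (ind A x) = measure M A * norm x" if "A \<in> sets M" for A x
    using that by (simp add: L1_seminorm_def ind_def)
  define G where "G A = Blinfun (\<lambda>x. \<Lambda> (ind A x))" for A
  have bl: "bounded_linear (\<lambda>x. \<Lambda> (ind A x))" if A: "A \<in> sets M" for A
  proof (rule bounded_linear_intro[where K = "C * measure M A"])
    show "\<Lambda> (ind A (x + z)) = \<Lambda> (ind A x) + \<Lambda> (ind A z)" for x z
      using add[OF ind[OF A, of x] ind[OF A, of z]] by (simp add: ind_def[abs_def] scaleR_add_right)
    show "\<Lambda> (ind A (c *\<^sub>R x)) = c *\<^sub>R \<Lambda> (ind A x)" for c x
      using scale[OF ind[OF A, of x], of c] by (simp add: ind_def[abs_def] mult.commute)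
    show "norm (\<Lambda> (ind A x)) \<le> norm x * (C * measure M A)" for x
      using C[OF ind[OF A, of x]] seminorm[OF A] by (simp add: mult_ac)
  qed
  have G: "blinfun_apply (G A) x = \<Lambda> (ind A x)" if "A \<in> sets M" for A x
    unfolding G_def using bounded_linear_Blinfun_apply[OF bl[OF that]] by simp
  have "\<exists>b. strongly_measurable M b \<and> (\<forall>\<omega>. norm (b \<omega>) \<le> C) \<and> (\<forall>A\<in>sets M. \<forall>x.
      (LINT \<omega>|M. indicator A \<omega> * blinfun_apply (b \<omega>) x) = blinfun_apply (G A) x)"
  proof (rule radon_nikodym_bounded_density[of G C, OF rnp])
    show "G (A \<union> B) = G A + G B" if AB: "A \<in> sets M" "B \<in> sets M" "A \<inter> B = {}" for A B
    proof (rule blinfun_eqI)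
      fix x
      have "ind (A \<union> B) x \<omega> = ind A x \<omega> + ind B x \<omega>" for \<omega>
        using AB(3) by (auto simp: ind_def indicator_def)
      then have "ind (A \<union> B) x = (\<lambda>\<omega>. ind A x \<omega> + ind B x \<omega>)" by blast
      then have "\<Lambda> (ind (A \<union> B) x) = \<Lambda> (ind A x) + \<Lambda> (ind B x)"
        using add[OF ind[OF AB(1)] ind[OF AB(2)]] by simp
      then show "blinfun_apply (G (A \<union> B)) x = blinfun_apply (G A + G B) x"
        using AB by (simp add: G blinfun.add_left)
    qed
    show "norm (G A) \<le> C * measure M A" if A: "A \<in> sets M" for A
      using C[OF ind[OF A]] seminorm[OF A]
      by (intro norm_blinfun_bound) (auto simp: G[OF A] C_def mult_ac)
    show "C \<ge> 0" by (simp add: C_def)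
  qed blast
  then obtain b where b: "strongly_measurable M b" "\<And>\<omega>. norm (b \<omega>) \<le> C"
    and bG: "\<And>A x. A \<in> sets M \<Longrightarrow>
      (LINT \<omega>|M. indicator A \<omega> * blinfun_apply (b \<omega>) x) = blinfun_apply (G A) x" by blast
  have b_Linf: "b \<in> bochner_Linf M" using b by (auto simp: bochner_Linf_def)
  have "\<Lambda> f = (LINT \<omega>|M. blinfun_apply (b \<omega>) (f \<omega>))" if f: "f \<in> bochner_L1 M" for f
  proof (rule L1_dual_eqI[OF \<Lambda> L1_dual_pairing[OF b_Linf] f])
    show "\<Lambda> (\<lambda>\<omega>. indicat_real A \<omega> *\<^sub>R x) = (LINT \<omega>|M. blinfun_apply (b \<omega>) (indicat_real A \<omega> *\<^sub>R x))"
      if "A \<in> sets M" for A x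
      using bG[OF that, of x] G[OF that, of x] by (simp add: blinfun.scaleR_right ind_def[abs_def])
  qed
  with b_Linf show ?thesis by blast
qed

section \<open>Limited convergence\<close>

lemma limitin_initial_topology:
  assumes "\<Phi> \<noteq> {}" and f: "\<And>k. f k \<in> S" and "l \<in> S"
  shows "limitin (initial_topology S \<Phi>) f l sequentially \<longleftrightarrow> (\<forall>\<phi>\<in>\<Phi>. (\<lambda>k. \<phi> (f k)) \<longlonglongrightarrow> \<phi> l)"
proof
  assume lim: "limitin (initial_topology S \<Phi>) f l sequentially"
  show "\<forall>\<phi>\<in>\<Phi>. (\<lambda>k. \<phi> (f k)) \<longlonglongrightarrow> \<phi> l"
  proof (intro ballI topological_tendstoI)
    fix \<phi> U assume "\<phi> \<in> \<Phi>" "open U" "\<phi> l \<in> U"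
    then have "openin (initial_topology S \<Phi>) {x \<in> S. \<phi> x \<in> U}"
      unfolding initial_topology_def by (intro topology_generated_by_Basis) blast
    moreover have "l \<in> {x \<in> S. \<phi> x \<in> U}" using \<open>l \<in> S\<close> \<open>\<phi> l \<in> U\<close> by simp
    ultimately have "\<forall>\<^sub>F k in sequentially. f k \<in> {x \<in> S. \<phi> x \<in> U}"
      using lim unfolding limitin_def by blast
    then show "\<forall>\<^sub>F k in sequentially. \<phi> (f k) \<in> U" by eventually_elim simp
  qed
next
  assume lim: "\<forall>\<phi>\<in>\<Phi>. (\<lambda>k. \<phi> (f k)) \<longlonglongrightarrow> \<phi> l"
  have "\<forall>\<^sub>F k in sequentially. f k \<in> U"
    if "generate_topology_on {{x \<in> S. \<phi> x \<in> V} |\<phi> V. \<phi> \<in> \<Phi> \<and> open V} U" "l \<in> U" for U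
    using that
  proof (induction U)
    case (Int U V)
    then show ?case by (simp add: eventually_conj)
  next
    case (UN \<U>)
    then obtain V where "V \<in> \<U>" "l \<in> V" by blast
    from UN.IH[OF this] show ?case by eventually_elim (use \<open>V \<in> \<U>\<close> in blast)
  next
    case (Basis U)
    then obtain \<phi> V where U: "U = {x \<in> S. \<phi> x \<in> V}" "\<phi> \<in> \<Phi>" "open V" by blast
    with Basis have "\<phi> l \<in> V" by simp
    with lim U have "\<forall>\<^sub>F k in sequentially. \<phi> (f k) \<in> V" by (blast dest: topological_tendstoD)
    then show ?case by eventually_elim (simp add: U f)
  qed simp
  then show "limitin (initial_topology S \<Phi>) f l sequentially"
    using \<open>l \<in> S\<close> topspace_initial_topology[OF assms(1), of S]
    by (simp add: limitin_def initial_topology_def openin_topology_generated_by_iff)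
qed

lemma limitin_sigma_L1_Linf:
  fixes f :: "nat \<Rightarrow> 'w \<Rightarrow> 'e::banach"
  assumes "\<And>k. f k \<in> bochner_L1 M" and "f0 \<in> bochner_L1 M"
  shows "limitin (sigma_L1_Linf M) f f0 sequentially \<longleftrightarrow>
    (\<forall>b :: 'w \<Rightarrow> 'e \<Rightarrow>\<^sub>L real. b \<in> bochner_Linf M \<longrightarrow>
      (\<lambda>k. LINT \<omega>|M. blinfun_apply (b \<omega>) (f k \<omega>)) \<longlonglongrightarrow> (LINT \<omega>|M. blinfun_apply (b \<omega>) (f0 \<omega>)))"
proof -
  \<comment> \<open>The zero field shows that the generating family is nonempty, so that the carrier
    of the topology is all of \<open>bochner_L1 M\<close>.\<close>
  have "(\<lambda>_. 0 :: 'e \<Rightarrow>\<^sub>L real) \<in> bochner_Linf M"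
    by (auto simp: bochner_Linf_def intro!: strongly_measurable_simple_function exI[of _ 0])
  then show ?thesis
    unfolding sigma_L1_Linf_def by (subst limitin_initial_topology) (use assms in auto)
qed

lemma continuous_map_dual_weak_topology_blinfun:
  "continuous_map dual_weak_topology euclideanreal (blinfun_apply b)"
  unfolding continuous_map_def
proof (intro conjI allI impI)
  fix U :: "real set" assume "openin euclideanreal U"
  then have "openin dual_weak_topology {x \<in> UNIV. blinfun_apply b x \<in> U}"
    unfolding dual_weak_topology_def initial_topology_def
    by (intro topology_generated_by_Basis) auto
  moreover have "topspace dual_weak_topology = (UNIV :: 'a set)"
    unfolding dual_weak_topology_def by (rule topspace_initial_topology) simp
  ultimately show "openin dual_weak_topology {x \<in> topspace dual_weak_topology. blinfun_apply b x \<in>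
      U}"
    by simp
qed simp

section \<open>Implications between the modes of convergence\<close>

context prob_space
begin

lemma limited_imp_pairing_null:
  fixes f :: "nat \<Rightarrow> 'a \<Rightarrow> 'e::banach" and b :: "'a \<Rightarrow> 'e \<Rightarrow>\<^sub>L real"
  assumes lim: "converges_limitedly M f f0" and b: "b \<in> bochner_Linf M"
  shows "(\<lambda>k. LINT \<omega>|M. blinfun_apply (b \<omega>) (f k \<omega> - f0 \<omega>)) \<longlonglongrightarrow> 0"
proof -
  obtain C where meas: "strongly_measurable M b" and C: "\<And>\<omega>. \<omega> \<in> space M \<Longrightarrow> norm (b \<omega>) \<le> C"
    using b by (auto simp: bochner_Linf_def)
  have "(\<lambda>\<omega>. blinfun_apply (b \<omega>)) \<in> limited_integrands M"
    unfolding limited_integrands_def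
  proof (intro CollectI conjI ballI exI allI)
    \<comment> \<open>The growth constant has to be strictly positive, which \<open>C\<close> need
      not be, hence the maximum with 1; \<open>\<phi>\<close> is zero.\<close>
    show "\<bar>blinfun_apply (b \<omega>) x\<bar> \<le> max 1 C * norm x + 0" if "\<omega> \<in> space M" for \<omega> x
    proof -
      have "\<bar>blinfun_apply (b \<omega>) x\<bar> \<le> norm (b \<omega>) * norm x" using norm_blinfun[of "b \<omega>" x] by simp
      also have "\<dots> \<le> max 1 C * norm x" using C[OF that] by (intro mult_right_mono) auto
      finally show ?thesis by simp
    qed
    show "(\<lambda>\<omega>. blinfun_apply (b \<omega>) (h \<omega>)) \<in> borel_measurable M" if "h \<in> bochner_L1 M" for h
      using that meas by (simp add: bochner_L1_iff strongly_measurable_blinfun_apply)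
  qed (auto simp: continuous_map_dual_weak_topology_blinfun)
  from bspec[OF lim[unfolded converges_limitedly_def] this] show ?thesis .
qed

lemma limited_imp_L1_null:
  fixes f :: "nat \<Rightarrow> 'a \<Rightarrow> 'e::banach" and x :: "'e \<Rightarrow>\<^sub>L real"
  assumes lim: "converges_limitedly M f f0"
  shows "(\<lambda>k. LINT \<omega>|M. \<bar>blinfun_apply x (f k \<omega> - f0 \<omega>)\<bar>) \<longlonglongrightarrow> 0"
proof -
  have "(\<lambda>_ z. \<bar>blinfun_apply x z\<bar>) \<in> limited_integrands M"
    unfolding limited_integrands_def
  proof (intro CollectI conjI ballI exI allI)
    show "\<bar>\<bar>blinfun_apply x z\<bar>\<bar> \<le> (norm x + 1) * norm z + 0" for z
      using norm_blinfun[of x z] by (simp add: distrib_right add_increasing2)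
    show "continuous_map dual_weak_topology euclideanreal (\<lambda>z. \<bar>blinfun_apply x z\<bar>)"
      by (intro continuous_map_real_abs continuous_map_dual_weak_topology_blinfun)
    show "(\<lambda>\<omega>. \<bar>blinfun_apply x (h \<omega>)\<bar>) \<in> borel_measurable M" if "h \<in> bochner_L1 M" for h
      using that strongly_measurable_blinfun_apply[OF strongly_measurable_simple_function, of M
          "\<lambda>_. x" h]
      by (simp add: bochner_L1_iff)
  qed (auto simp: add_nonneg_pos)
  from bspec[OF lim[unfolded converges_limitedly_def] this] show ?thesis .
qed

lemma integrable_blinfun_apply:
  fixes x :: "'e::banach \<Rightarrow>\<^sub>L real"
  assumes "h \<in> bochner_L1 M"
  shows "integrable M (\<lambda>\<omega>. blinfun_apply x (h \<omega>))"
  using bochner_L1_pairing(1)[OF assms strongly_measurable_simple_function, of "\<lambda>_. x" "norm x"]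
    by simp

lemma limited_imp_bocce:
  fixes f :: "nat \<Rightarrow> 'a \<Rightarrow> 'e::banach" and x :: "'e \<Rightarrow>\<^sub>L real"
  assumes lim: "converges_limitedly M f f0"
    and f: "\<And>k. f k \<in> bochner_L1 M" and f0: "f0 \<in> bochner_L1 M"
  shows "sequential_bocce_criterion M (\<lambda>k \<omega>. blinfun_apply x (f k \<omega>))"
proof -
  have int: "integrable M (\<lambda>\<omega>. blinfun_apply x (f k \<omega> - f0 \<omega>))" for k
    by (rule integrable_blinfun_apply[OF bochner_L1_diff[OF f f0]])
  have "sequential_bocce_criterion M (\<lambda>k \<omega>. blinfun_apply x (f k \<omega> - f0 \<omega>) +
      blinfun_apply x (f0 \<omega>))"
    by (rule sequential_bocce_criterion_add[OF L1_null_imp_bocce[OF int limited_imp_L1_null[OF lim]]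
          int integrable_blinfun_apply[OF f0]])
  then show ?thesis by (simp add: blinfun.diff_right)
qed

lemma limited_imp_weak:
  fixes f :: "nat \<Rightarrow> 'a \<Rightarrow> 'e::banach"
  assumes rnp: "radon_nikodym_property_wrt M TYPE('e \<Rightarrow>\<^sub>L real)"
    and lim: "converges_limitedly M f f0"
    and f: "\<And>k. f k \<in> bochner_L1 M" and f0: "f0 \<in> bochner_L1 M"
  shows "L1_weakly_converges M f f0"
  unfolding L1_weakly_converges_def
proof
  fix \<Lambda> :: "('a \<Rightarrow> 'e) \<Rightarrow> real" assume \<Lambda>: "\<Lambda> \<in> L1_dual M"
  obtain b where b: "b \<in> bochner_Linf M"
    and eq: "\<And>f. f \<in> bochner_L1 M \<Longrightarrow> \<Lambda> f = (LINT \<omega>|M. blinfun_apply (b \<omega>) (f \<omega>))"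
    using L1_dual_representation[OF rnp \<Lambda>] by blast
  have "\<Lambda> (f k) = (LINT \<omega>|M. blinfun_apply (b \<omega>) (f k \<omega> - f0 \<omega>)) + \<Lambda> f0" for k
    using L1_dual_add[OF \<Lambda> bochner_L1_diff[OF f f0] f0, of k] eq[OF bochner_L1_diff[OF f f0], of k]
    by simp
  then show "(\<lambda>k. \<Lambda> (f k)) \<longlonglongrightarrow> \<Lambda> f0"
    using tendsto_add[OF limited_imp_pairing_null[OF lim b] tendsto_const[of "\<Lambda> f0"]] by simp
qed

lemma weak_imp_sigma:
  assumes weak: "L1_weakly_converges M f f0"
    and f: "\<And>k. f k \<in> bochner_L1 M" and f0: "f0 \<in> bochner_L1 M"
  shows "limitin (sigma_L1_Linf M) f f0 sequentially"
  unfolding limitin_sigma_L1_Linf[OF f f0]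
proof (intro allI impI)
  fix b :: "'a \<Rightarrow> 'b \<Rightarrow>\<^sub>L real" assume "b \<in> bochner_Linf M"
  from bspec[OF weak[unfolded L1_weakly_converges_def] L1_dual_pairing[OF this]]
  show "(\<lambda>k. LINT \<omega>|M. blinfun_apply (b \<omega>) (f k \<omega>)) \<longlonglongrightarrow> (LINT \<omega>|M. blinfun_apply (b \<omega>) (f0 \<omega>))" .
qed

text \<open>The scalar sequence inherits what \<open>bocce_imp_L1_null\<close> asks for: the field
  equal to \<open>x\<close> on \<open>A\<close> and zero elsewhere gives null integrals over
  \<open>A\<close>, and equi-integrability passes on with the factor \<open>norm x + 1\<close>,
  which is positive even for \<open>x = 0\<close>.\<close>

lemma sigma_bocce_imp_L1_null:
  fixes d :: "nat \<Rightarrow> 'a \<Rightarrow> 'e::banach" and x :: "'e \<Rightarrow>\<^sub>L real"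
  assumes d: "\<And>k. d k \<in> bochner_L1 M"
    and lim: "\<And>b :: 'a \<Rightarrow> 'e \<Rightarrow>\<^sub>L real. b \<in> bochner_Linf M \<Longrightarrow>
        (\<lambda>k. LINT \<omega>|M. blinfun_apply (b \<omega>) (d k \<omega>)) \<longlonglongrightarrow> 0"
    and equi: "equi_integrable M (\<lambda>k \<omega>. norm (d k \<omega>))"
    and bocce: "sequential_bocce_criterion M (\<lambda>k \<omega>. blinfun_apply x (d k \<omega>))"
  shows "(\<lambda>k. LINT \<omega>|M. \<bar>blinfun_apply x (d k \<omega>)\<bar>) \<longlonglongrightarrow> 0"
proof (rule bocce_imp_L1_null[OF integrable_blinfun_apply[OF d] _ _ bocce])
  show "(\<lambda>k. LINT \<omega>|M. indicator A \<omega> * blinfun_apply x (d k \<omega>)) \<longlonglongrightarrow> 0" if A: "A \<in> sets M" for A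
  proof -
    have "(\<lambda>\<omega>. indicat_real A \<omega> *\<^sub>R x) \<in> bochner_Linf M"
      using strongly_measurable_indicator[OF A strongly_measurable_simple_function, of "\<lambda>_. x"]
      by (auto simp: bochner_Linf_def indicator_def intro!: exI[of _ "norm x"])
    from lim[OF this] show ?thesis by (simp add: blinfun.scaleR_left)
  qed
  have d_int: "integrable M (\<lambda>\<omega>. norm (d k \<omega>))" for k using d[of k] by (simp add: bochner_L1_iff)
  have le: "(LINT \<omega>|M. indicator A \<omega> * \<bar>blinfun_apply x (d k \<omega>)\<bar>) \<le>
      (norm x + 1) * (LINT \<omega>|M. indicator A \<omega> * \<bar>norm (d k \<omega>)\<bar>)" if A: "A \<in> sets M" for A k
  proof -
    have "(LINT \<omega>|M. indicator A \<omega> * \<bar>blinfun_apply x (d k \<omega>)\<bar>) \<le>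
        (LINT \<omega>|M. (norm x + 1) * (indicator A \<omega> * \<bar>norm (d k \<omega>)\<bar>))"
    proof (rule integral_mono)
      show "integrable M (\<lambda>\<omega>. indicat_real A \<omega> * \<bar>blinfun_apply x (d k \<omega>)\<bar>)"
        using integrable_mult_indicator[OF A integrable_abs[OF integrable_blinfun_apply[OF d]]]
          by simp
      show "integrable M (\<lambda>\<omega>. (norm x + 1) * (indicat_real A \<omega> * \<bar>norm (d k \<omega>)\<bar>))"
        using integrable_mult_indicator[OF A d_int] by simp
      show "indicat_real A \<omega> * \<bar>blinfun_apply x (d k \<omega>)\<bar> \<le>
          (norm x + 1) * (indicat_real A \<omega> * \<bar>norm (d k \<omega>)\<bar>)" for \<omega>
        using norm_blinfun[of x "d k \<omega>"]
          by (cases "\<omega> \<in> A") (auto simp: distrib_right add_increasing2)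
    qed
    then show ?thesis by simp
  qed
  obtain R where R: "\<And>k. (LINT \<omega>|M. \<bar>norm (d k \<omega>)\<bar>) \<le> R"
    and small: "\<And>\<epsilon>. \<epsilon> > 0 \<Longrightarrow> \<exists>\<delta>>0. \<forall>k. \<forall>A\<in>sets M. measure M A < \<delta> \<longrightarrow>
      (LINT \<omega>|M. indicator A \<omega> * \<bar>norm (d k \<omega>)\<bar>) \<le> \<epsilon>"
    using equi unfolding equi_integrable_def by blast
  have pos: "norm x + 1 > 0" by (simp add: add_nonneg_pos)
  show "equi_integrable M (\<lambda>k \<omega>. blinfun_apply x (d k \<omega>))"
    unfolding equi_integrable_def
  proof (intro conjI)
    show "\<exists>R. \<forall>k. (LINT \<omega>|M. \<bar>blinfun_apply x (d k \<omega>)\<bar>) \<le> R"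
    proof (intro exI allI)
      fix k
      have "(LINT \<omega>|M. indicator (space M) \<omega> * h \<omega>) = (LINT \<omega>|M. h \<omega>)" for h :: "'a \<Rightarrow> real"
        by (rule Bochner_Integration.integral_cong) auto
      with le[OF sets.top, of k] have "(LINT \<omega>|M. \<bar>blinfun_apply x (d k \<omega>)\<bar>) \<le>
          (norm x + 1) * (LINT \<omega>|M. \<bar>norm (d k \<omega>)\<bar>)" by simp
      also have "\<dots> \<le> (norm x + 1) * R" using R[of k] pos by (intro mult_left_mono) auto
      finally show "(LINT \<omega>|M. \<bar>blinfun_apply x (d k \<omega>)\<bar>) \<le> (norm x + 1) * R" .
    qed
  next
    show "\<forall>\<epsilon>>0. \<exists>\<delta>>0. \<forall>k. \<forall>A\<in>sets M. prob A < \<delta> \<longrightarrow>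
        (LINT \<omega>|M. indicator A \<omega> * \<bar>blinfun_apply x (d k \<omega>)\<bar>) \<le> \<epsilon>"
    proof (intro allI impI)
      fix \<epsilon> :: real assume "\<epsilon> > 0"
      then have "\<epsilon> / (norm x + 1) > 0" using pos by simp
      from small[OF this] obtain \<delta> where "\<delta> > 0" and \<delta>: "\<And>k A. A \<in> sets M \<Longrightarrow> measure M A < \<delta> \<Longrightarrow>
          (LINT \<omega>|M. indicator A \<omega> * \<bar>norm (d k \<omega>)\<bar>) \<le> \<epsilon> / (norm x + 1)" by blast
      have "(LINT \<omega>|M. indicator A \<omega> * \<bar>blinfun_apply x (d k \<omega>)\<bar>) \<le> \<epsilon>"
        if "A \<in> sets M" "measure M A < \<delta>" for k A
      proof -
        have "(LINT \<omega>|M. indicator A \<omega> * \<bar>blinfun_apply x (d k \<omega>)\<bar>) \<le>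
            (norm x + 1) * (\<epsilon> / (norm x + 1))"
          using le[OF that(1), of k] mult_left_mono[OF \<delta>[OF that, of k], of "norm x + 1"] pos
            by linarith
        also have "\<dots> = \<epsilon>" using pos by simp
        finally show ?thesis .
      qed
      with \<open>\<delta> > 0\<close> show "\<exists>\<delta>>0. \<forall>k. \<forall>A\<in>sets M. prob A < \<delta> \<longrightarrow>
          (LINT \<omega>|M. indicator A \<omega> * \<bar>blinfun_apply x (d k \<omega>)\<bar>) \<le> \<epsilon>" by blast
    qed
  qed
qed

lemma sigma_bocce_imp_limited:
  fixes f :: "nat \<Rightarrow> 'a \<Rightarrow> 'e::banach"
  assumes rnp: "radon_nikodym_property_wrt M TYPE('e \<Rightarrow>\<^sub>L real)"
    and f: "\<And>k. f k \<in> bochner_L1 M" and f0: "f0 \<in> bochner_L1 M"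
    and sigma: "limitin (sigma_L1_Linf M) f f0 sequentially"
    and bocce: "\<And>x :: 'e \<Rightarrow>\<^sub>L real. sequential_bocce_criterion M (\<lambda>k \<omega>. blinfun_apply x (f k \<omega>))"
  shows "converges_limitedly M f f0"
proof -
  define d where "d k \<omega> = f k \<omega> - f0 \<omega>" for k \<omega>
  have d: "d k \<in> bochner_L1 M" for k unfolding d_def[abs_def] by (rule bochner_L1_diff[OF f f0])
  have lim: "(\<lambda>k. LINT \<omega>|M. blinfun_apply (b \<omega>) (d k \<omega>)) \<longlonglongrightarrow> 0"
    if b: "b \<in> bochner_Linf M" for b :: "'a \<Rightarrow> 'e \<Rightarrow>\<^sub>L real"
  proof -
    obtain C where meas: "strongly_measurable M b" and C: "\<And>\<omega>. \<omega> \<in> space M \<Longrightarrow> norm (b \<omega>) \<le> C"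
      using b by (auto simp: bochner_Linf_def)
    note int = bochner_L1_pairing(1)[of _ b C, OF _ meas C]
    have "(\<lambda>k. (LINT \<omega>|M. blinfun_apply (b \<omega>) (f k \<omega>)) - (LINT \<omega>|M. blinfun_apply (b \<omega>) (f0 \<omega>)))
        \<longlonglongrightarrow> (LINT \<omega>|M. blinfun_apply (b \<omega>) (f0 \<omega>)) - (LINT \<omega>|M. blinfun_apply (b \<omega>) (f0 \<omega>))"
      using sigma b unfolding limitin_sigma_L1_Linf[OF f f0]
        by (intro tendsto_diff tendsto_const) blast
    then show ?thesis using int[OF f] int[OF f0] by (simp add: d_def blinfun.diff_right)
  qed
  have "unit_fields M \<subseteq> (bochner_Linf M :: ('a \<Rightarrow> 'e \<Rightarrow>\<^sub>L real) set)"
    by (auto simp: unit_fields_def bochner_Linf_def)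
  then have equi: "equi_integrable M (\<lambda>k \<omega>. norm (d k \<omega>))"
    using lim by (intro weakly_null_equi_integrable[of d, OF d]) blast
  then obtain R where R: "\<And>k. (LINT \<omega>|M. norm (d k \<omega>)) \<le> R"
    by (auto simp: equi_integrable_def)
  have null: "(\<lambda>k. LINT \<omega>|M. \<bar>blinfun_apply x (d k \<omega>)\<bar>) \<longlonglongrightarrow> 0" for x :: "'e \<Rightarrow>\<^sub>L real"
  proof (rule sigma_bocce_imp_L1_null[OF d lim equi])
    \<comment> \<open>The criterion is given for \<open>f k\<close>; adding the fixed function
      \<open>- x (f0)\<close> carries it over to the differences.\<close>
    have "integrable M (\<lambda>\<omega>. - blinfun_apply x (f0 \<omega>))" using integrable_blinfun_apply[OF f0] by simp
    from sequential_bocce_criterion_add[OF bocce[of x] integrable_blinfun_apply[OF f] this]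
    show "sequential_bocce_criterion M (\<lambda>k \<omega>. blinfun_apply x (d k \<omega>))"
      by (simp add: d_def blinfun.diff_right)
  qed
  have "(\<lambda>k. LINT \<omega>|M. g \<omega> (d k \<omega>)) \<longlonglongrightarrow> 0" if g: "g \<in> limited_integrands M" for g
  proof -
    from g have zero: "\<And>\<omega>. \<omega> \<in> space M \<Longrightarrow> g \<omega> 0 = 0"
      and cont: "\<And>\<omega>. \<omega> \<in> space M \<Longrightarrow> continuous_map dual_weak_topology euclideanreal (g \<omega>)"
      and meas: "\<And>k. (\<lambda>\<omega>. g \<omega> (d k \<omega>)) \<in> borel_measurable M"
      using d by (auto simp: limited_integrands_def)
    from g obtain C and \<phi> :: "'a \<Rightarrow> real" where "C > 0" and \<phi>: "integrable M \<phi>"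
      and growth: "\<And>\<omega> x. \<omega> \<in> space M \<Longrightarrow> \<bar>g \<omega> x\<bar> \<le> C * norm x + \<phi> \<omega>"
      unfolding limited_integrands_def by blast
    show ?thesis
      by (rule limited_integral_tendsto_0[OF d equi zero meas growth \<open>C > 0\<close> \<phi>
            weakly_continuous_null_in_probability[OF rnp d R null zero cont meas]])
  qed
  then show ?thesis by (simp add: converges_limitedly_def d_def)
qed

end

theorem theorem3p8:
  fixes M :: "'w measure"
    and f :: "nat \<Rightarrow> 'w \<Rightarrow> 'e::banach"
    and f0 :: "'w \<Rightarrow> 'e"
  assumes "prob_space M"
    and "radon_nikodym_property TYPE('w) TYPE('e \<Rightarrow>\<^sub>L real)"
    and "radon_nikodym_property TYPE(real) TYPE('e \<Rightarrow>\<^sub>L real)"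
    and "\<And>k. f k \<in> bochner_L1 M"
    and "f0 \<in> bochner_L1 M"
  shows "(converges_limitedly M f f0 \<longleftrightarrow>
            L1_weakly_converges M f f0 \<and>
            (\<forall>x :: 'e \<Rightarrow>\<^sub>L real. sequential_bocce_criterion M (\<lambda>k \<omega>. blinfun_apply x (f k \<omega>))))
       \<and> (converges_limitedly M f f0 \<longleftrightarrow>
            limitin (sigma_L1_Linf M) f f0 sequentially \<and>
            (\<forall>x :: 'e \<Rightarrow>\<^sub>L real. sequential_bocce_criterion M (\<lambda>k \<omega>. blinfun_apply x (f k \<omega>))))"
proof -
  interpret prob_space M by fact
  have rnp: "radon_nikodym_property_wrt M TYPE('e \<Rightarrow>\<^sub>L real)"
    using assms(2) finite_measure_axioms by (simp add: radon_nikodym_property_def)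
  let ?bocce = "\<forall>x :: 'e \<Rightarrow>\<^sub>L real. sequential_bocce_criterion M (\<lambda>k \<omega>. blinfun_apply x (f k \<omega>))"
  \<comment> \<open>Limited convergence gives weak convergence, this gives convergence for the
    weaker topology, and together with the Bocce criterion this returns to limited convergence. The
    cycle settles both equivalences at once.\<close>
  have "converges_limitedly M f f0 \<Longrightarrow> L1_weakly_converges M f f0 \<and> ?bocce"
    using limited_imp_weak[where f = f, OF rnp _ assms(4,5)]
      limited_imp_bocce[where f = f, OF _ assms(4,5)] by blast
  moreover have "L1_weakly_converges M f f0 \<Longrightarrow> limitin (sigma_L1_Linf M) f f0 sequentially"
    by (rule weak_imp_sigma[where f = f, OF _ assms(4,5)])
  moreover have "limitin (sigma_L1_Linf M) f f0 sequentially \<and> ?bocce \<Longrightarrow> converges_limitedly M f f0"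
    using sigma_bocce_imp_limited[where f = f, OF rnp assms(4,5)] by blast
  ultimately show ?thesis by blast
qed

end
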